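(* Let $N\ge2$, $1<p_1,\dots,p_N<\infty$ and $X=\ell_{p_1}\hat\otimes\cdots\hat\otimes\ell_{p_N}$. Assume that for some $i\neq j$ in $\{1,\dots,N\}$ we have $\frac1{p_i}+\frac1{p_j}>1$ and that, for $k=i$ and for $k=j$, $p_k\notin\{r_A : \emptyset\ne A\subset\{1,\dots,N\},\ k\notin A\}$. Then $X$ is not primary.
   Context: $\hat\otimes$ denotes the (completed) projective tensor product of Banach spaces. For a non-empty $A\subset\{1,\dots,N\}$, $r_A$ is defined by $\frac1{r_A}=\min\bigl\{1,\sum_{l\in A}\frac1{p_l}\bigr\}$. A Banach space $X$ is primary if whenever $X=Y\oplus Z$ (a topological direct sum of closed subspaces), $X$ is isomorphic (linearly homeomorphic) to $Y$ or to $Z$. *)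

theory Defs
  imports "HOL-Analysis.Analysis"
begin

section \<open>Normed spaces over the scalar field\<close>

text \<open>
  The scalar field is a type \<open>'k\<close> of sort \<open>{real_normed_field, euclidean_space}\<close>, so that real
  and complex spaces are treated at the same time (up to isomorphism, \<open>\<real>\<close> and \<open>\<complex>\<close> are the only
  such fields).  A Banach space over \<open>'k\<close> is a closed \<open>'k\<close>-subspace of a type of class
  \<open>banach\<close> that carries a scalar multiplication by \<open>'k\<close> compatible with the norm.  Additivity and
  continuity force \<open>smul (of_real r) x = r *\<^sub>R x\<close>.
\<close>

locale normed_space_over = vector_space smul
  for smul :: "'k::real_normed_field \<Rightarrow> 'x::real_normed_vector \<Rightarrow> 'x" +
  assumes norm_smul: "norm (smul a x) = norm a * norm x"

definition linear_on ::
    "('k::field \<Rightarrow> 'x::ab_group_add \<Rightarrow> 'x) \<Rightarrow> 'x set \<Rightarrow> ('x \<Rightarrow> 'x) \<Rightarrow> bool" where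
  "linear_on smul Y T \<longleftrightarrow>
     (\<forall>x\<in>Y. \<forall>y\<in>Y. T (x + y) = T x + T y) \<and> (\<forall>c. \<forall>x\<in>Y. T (smul c x) = smul c (T x))"

definition linearly_homeomorphic ::
    "('k::field \<Rightarrow> 'x::real_normed_vector \<Rightarrow> 'x) \<Rightarrow> 'x set \<Rightarrow> 'x set \<Rightarrow> bool" where
  "linearly_homeomorphic smul Y Z \<longleftrightarrow> (\<exists>T S. linear_on smul Y T \<and> homeomorphism Y Z T S)"

definition closed_subspace ::
    "('k::field \<Rightarrow> 'x::real_normed_vector \<Rightarrow> 'x) \<Rightarrow> 'x set \<Rightarrow> bool" where
  "closed_subspace smul Y \<longleftrightarrow> module.subspace smul Y \<and> closed Y"

text \<open>
  The last condition says that addition is a homeomorphism of \<open>Y \<times> Z\<close> onto \<open>X\<close>; in particular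
  \<open>Y\<close> and \<open>Z\<close> are contained in \<open>X\<close>, and they span it and meet only in \<open>0\<close>.
\<close>

definition topological_direct_sum ::
    "('k::field \<Rightarrow> 'x::real_normed_vector \<Rightarrow> 'x) \<Rightarrow> 'x set \<Rightarrow> 'x set \<Rightarrow> 'x set \<Rightarrow> bool" where
  "topological_direct_sum smul X Y Z \<longleftrightarrow>
     closed_subspace smul Y \<and> closed_subspace smul Z \<and>
     (\<exists>g. homeomorphism (Y \<times> Z) X (\<lambda>(y, z). y + z) g)"

definition primary ::
    "('k::field \<Rightarrow> 'x::real_normed_vector \<Rightarrow> 'x) \<Rightarrow> 'x set \<Rightarrow> bool" where
  "primary smul X \<longleftrightarrow>
     (\<forall>Y Z. topological_direct_sum smul X Y Z \<longrightarrow>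
        linearly_homeomorphic smul X Y \<or> linearly_homeomorphic smul X Z)"


section \<open>The sequence spaces\<close>

definition lp_space :: "real \<Rightarrow> (nat \<Rightarrow> 'k::real_normed_vector) set" where
  "lp_space p = {x. summable (\<lambda>n. norm (x n) powr p)}"

definition lp_norm :: "real \<Rightarrow> (nat \<Rightarrow> 'k::real_normed_vector) \<Rightarrow> real" where
  "lp_norm p x = (\<Sum>n. norm (x n) powr p) powr (1 / p)"


section \<open>Projective tensor products of sequence spaces\<close>

text \<open>
  \<open>E i\<close> (for \<open>i \<in> I\<close>, with \<open>I\<close> finite) is a linear space of scalar sequences with norm \<open>nrm i\<close>.
  No boundedness is required of a multilinear form: the algebraic tensor product is realised as the
  space of functionals, on all multilinear forms, spanned by the evaluations at the tuples
  \<open>x \<in> \<Pi>\<^sub>E i\<in>I. E i\<close>.  Scalars can be absorbed into a factor, so every element is a finite sum of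
  evaluations.  Two such sums are equal iff every multilinear form takes the same value on them,
  that is, iff they are equal in the algebraic tensor product.
\<close>

definition multilinear_form ::
    "'i set \<Rightarrow> ('i \<Rightarrow> (nat \<Rightarrow> 'k::field) set) \<Rightarrow> (('i \<Rightarrow> nat \<Rightarrow> 'k) \<Rightarrow> 'k) \<Rightarrow> bool" where
  "multilinear_form I E \<phi> \<longleftrightarrow>
     (\<forall>x \<in> Pi\<^sub>E I E. \<forall>i\<in>I. \<forall>u \<in> E i. \<forall>v \<in> E i.
        \<phi> (x(i := (\<lambda>n. u n + v n))) = \<phi> (x(i := u)) + \<phi> (x(i := v))) \<and>
     (\<forall>x \<in> Pi\<^sub>E I E. \<forall>i\<in>I. \<forall>c. \<forall>u \<in> E i.
        \<phi> (x(i := (\<lambda>n. c * u n))) = c * \<phi> (x(i := u)))"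

definition elementary_tensor ::
    "'i set \<Rightarrow> ('i \<Rightarrow> (nat \<Rightarrow> 'k::field) set) \<Rightarrow> ('i \<Rightarrow> nat \<Rightarrow> 'k) \<Rightarrow>
     (('i \<Rightarrow> nat \<Rightarrow> 'k) \<Rightarrow> 'k) \<Rightarrow> 'k" where
  "elementary_tensor I E x = (\<lambda>\<phi>. if multilinear_form I E \<phi> then \<phi> x else 0)"

definition tensor_of ::
    "'i set \<Rightarrow> ('i \<Rightarrow> (nat \<Rightarrow> 'k::field) set) \<Rightarrow> ('i \<Rightarrow> nat \<Rightarrow> 'k) list \<Rightarrow>
     (('i \<Rightarrow> nat \<Rightarrow> 'k) \<Rightarrow> 'k) \<Rightarrow> 'k" where
  "tensor_of I E xs = (\<lambda>\<phi>. \<Sum>x\<leftarrow>xs. elementary_tensor I E x \<phi>)"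

definition algebraic_tensor_product ::
    "'i set \<Rightarrow> ('i \<Rightarrow> (nat \<Rightarrow> 'k::field) set) \<Rightarrow> ((('i \<Rightarrow> nat \<Rightarrow> 'k) \<Rightarrow> 'k) \<Rightarrow> 'k) set" where
  "algebraic_tensor_product I E = tensor_of I E ` lists (Pi\<^sub>E I E)"

definition projective_norm ::
    "'i set \<Rightarrow> ('i \<Rightarrow> (nat \<Rightarrow> 'k::field) set) \<Rightarrow> ('i \<Rightarrow> (nat \<Rightarrow> 'k) \<Rightarrow> real) \<Rightarrow>
     ((('i \<Rightarrow> nat \<Rightarrow> 'k) \<Rightarrow> 'k) \<Rightarrow> 'k) \<Rightarrow> real" where
  "projective_norm I E nrm t =
     Inf {(\<Sum>x\<leftarrow>xs. \<Prod>i\<in>I. nrm i (x i)) | xs. xs \<in> lists (Pi\<^sub>E I E) \<and> tensor_of I E xs = t}"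

text \<open>
  A completion is only determined up to isometric isomorphism, so the completed projective tensor
  product is introduced as a predicate on \<open>X\<close>: there is a linear isometry \<open>J\<close> from the algebraic
  tensor product with the projective norm onto a dense subspace of \<open>X\<close>.  The set \<open>X\<close>, being the
  closure of a subspace of a Banach space, is itself a Banach space.
\<close>

definition completed_projective_tensor_product ::
    "('k::real_normed_field \<Rightarrow> 'x::banach \<Rightarrow> 'x) \<Rightarrow> 'i set \<Rightarrow> ('i \<Rightarrow> (nat \<Rightarrow> 'k) set) \<Rightarrow>
     ('i \<Rightarrow> (nat \<Rightarrow> 'k) \<Rightarrow> real) \<Rightarrow> 'x set \<Rightarrow> bool" where
  "completed_projective_tensor_product smul I E nrm X \<longleftrightarrow>
     (\<exists>J. (\<forall>s \<in> algebraic_tensor_product I E. \<forall>t \<in> algebraic_tensor_product I E.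
              J (\<lambda>\<phi>. s \<phi> + t \<phi>) = J s + J t) \<and>
          (\<forall>c. \<forall>t \<in> algebraic_tensor_product I E. J (\<lambda>\<phi>. c * t \<phi>) = smul c (J t)) \<and>
          (\<forall>t \<in> algebraic_tensor_product I E. norm (J t) = projective_norm I E nrm t) \<and>
          closure (J ` algebraic_tensor_product I E) = X)"


section \<open>The exponents\<close>

definition r_exponent :: "(nat \<Rightarrow> real) \<Rightarrow> nat set \<Rightarrow> real" where
  "r_exponent p A = 1 / min 1 (\<Sum>l\<in>A. 1 / p l)"

end

theory Submission imports Defs begin

text \<open>
  In the matrix of the coordinates \<open>i\<close> and \<open>j\<close>, deleting the entries on one side of the diagonal is a
  bounded projection of \<open>X\<close>, because \<open>1 / p i + 1 / p j > 1\<close>. Its range contains no copy of the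
  sequence space with exponent \<open>p i\<close> and its kernel none of that with exponent \<open>p j\<close>, while \<open>X\<close> contains
  both. For if \<open>t\<close> is the image of the unit vector basis of such a space, then a gliding hump produces
  normalised blocks of \<open>t\<close> which are, up to small errors, block diagonal in the coordinates of some set
  \<open>A\<close> and supported at a single index in every other coordinate. The set \<open>A = {i}\<close> does not occur in
  the range, whose columns are finite, nor does \<open>A = {j}\<close> in the kernel, whose rows are finite. For any
  other non-empty \<open>A\<close>, block diagonal sequences behave like the unit vector basis of the sequence space
  with exponent \<open>r\<close>, where \<open>1 / r = min 1 (\<Sum>l\<in>A. 1 / p l)\<close>, and \<open>r\<close> differs from the exponent of \<open>t\<close>.
\<close>

section \<open>Sequences\<close>

text \<open>The hypotheses on the exponents amount to \<open>r_A = p k\<close> only for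
  \<open>A = {k}\<close>, where k is i or j: if A contains k and another index, then
  \<open>1 / r_A\<close> exceeds \<open>1 / p k\<close> anyway. So blocks that behave like the unit
  vectors of exponent \<open>p k\<close> can only have the shape \<open>A = {k}\<close>, and each
  side of the diagonal excludes this shape for one of the two exponents. A sequence in X need not be
  weakly null, so it does not leave the low indices by itself. The substitute is a class of small
  operators: those that produce arbitrarily small normalised blocks from every sequence with an
  upper estimate of exponent q. Upper estimates pass to blocks, which makes the class closed under
  finite sums. Fixing one coordinate at one index leaves fewer free coordinates; hence, by induction
  on A, removing everything below a level M costs only a small operator, and the hump may start
  beyond any level. At the end only sums with coefficients 1 are compared: L blocks give about
  \<open>L powr (1 / q)\<close> by their position in the sequence and about
  \<open>L powr (1 / r)\<close> by their shape.\<close>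

definition cutoff :: "nat set \<Rightarrow> (nat \<Rightarrow> 'k::zero) \<Rightarrow> nat \<Rightarrow> 'k" where
  "cutoff B u = (\<lambda>n. if n \<in> B then u n else 0)"

definition lp_sum :: "real \<Rightarrow> (nat \<Rightarrow> 'k::real_normed_vector) \<Rightarrow> real" where
  "lp_sum q u = (\<Sum>n. norm (u n) powr q)"

definition unit_seq :: "nat \<Rightarrow> nat \<Rightarrow> 'k::zero_neq_one" where
  "unit_seq m = (\<lambda>n. if n = m then 1 else 0)"

lemma lp_norm_eq: "lp_norm q u = lp_sum q u powr (1 / q)"
  by (simp add: lp_norm_def lp_sum_def)

lemma lp_norm_nonneg: "0 \<le> lp_norm q u"
  by (simp add: lp_norm_def)

lemma lp_summable: "u \<in> lp_space q \<Longrightarrow> summable (\<lambda>n. norm (u n) powr q)"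
  by (simp add: lp_space_def)

lemma lp_sum_nonneg: "u \<in> lp_space q \<Longrightarrow> 0 \<le> lp_sum q u"
  by (simp add: lp_sum_def suminf_nonneg lp_summable)

lemma lp_norm_powr: "0 < q \<Longrightarrow> u \<in> lp_space q \<Longrightarrow> lp_norm q u powr q = lp_sum q u"
  by (simp add: lp_norm_eq powr_powr lp_sum_nonneg)

lemma cutoff_cutoff: "cutoff B (cutoff C u) = cutoff (B \<inter> C) u"
  by (auto simp: cutoff_def)

lemma cutoff_UNIV [simp]: "cutoff UNIV u = u"
  by (simp add: cutoff_def)

lemma cutoff_empty: "cutoff {} u = (\<lambda>n. 0)"
  by (simp add: cutoff_def)

lemma cutoff_add: "cutoff B (\<lambda>n. u n + v n) = (\<lambda>n. cutoff B u n + cutoff B (v::nat \<Rightarrow> 'k::monoid_add) n)"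
  by (auto simp: cutoff_def)

lemma cutoff_scale: "cutoff B (\<lambda>n. c * u n) = (\<lambda>n. c * cutoff B (u::nat \<Rightarrow> 'k::mult_zero) n)"
  by (auto simp: cutoff_def)

lemma cutoff_Un: "B \<inter> C = {} \<Longrightarrow> cutoff (B \<union> C) u = (\<lambda>n. cutoff B u n + cutoff C (u::nat \<Rightarrow> 'k::monoid_add) n)"
  by (auto simp: cutoff_def fun_eq_iff)

lemma cutoff_singleton: "cutoff {m} u = (\<lambda>n. u m * unit_seq m (n::nat))" for u :: "nat \<Rightarrow> 'k::{semiring_1}"
  by (auto simp: cutoff_def unit_seq_def)

lemma cutoff_unit_seq: "cutoff B (unit_seq m) = (if m \<in> B then unit_seq m else (\<lambda>n. 0))"
  by (auto simp: cutoff_def unit_seq_def)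

lemma lp_space_cutoff:
  assumes "u \<in> lp_space q"
  shows "cutoff B u \<in> lp_space q"
  unfolding lp_space_def mem_Collect_eq
  by (rule summable_comparison_test'[OF lp_summable[OF assms], of 0])
     (auto simp: cutoff_def)

lemma lp_space_zero: "(\<lambda>n. 0) \<in> lp_space q"
  by (simp add: lp_space_def)

lemma lp_sum_cutoff_Un:
  assumes "u \<in> lp_space q" "B \<inter> C = {}"
  shows "lp_sum q (cutoff (B \<union> C) u) = lp_sum q (cutoff B u) + lp_sum q (cutoff C u)"
proof -
  have "norm (cutoff (B \<union> C) u n) powr q = norm (cutoff B u n) powr q + norm (cutoff C u n) powr q" for n
    using assms(2) by (auto simp: cutoff_def)
  then show ?thesis
    unfolding lp_sum_def
    by (simp add: suminf_add lp_summable lp_space_cutoff assms(1))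
qed

lemma lp_sum_empty [simp]: "lp_sum q (cutoff {} u) = 0"
  by (simp add: lp_sum_def cutoff_def)

lemma lp_sum_zero [simp]: "lp_sum q (\<lambda>n. 0) = 0"
  by (simp add: lp_sum_def)

lemma lp_norm_zero [simp]: "lp_norm q (\<lambda>n. 0) = 0"
  by (simp add: lp_norm_eq)

lemma lp_sum_cutoff_mono:
  assumes "u \<in> lp_space q" "B \<subseteq> C"
  shows "lp_sum q (cutoff B u) \<le> lp_sum q (cutoff C u)"
proof -
  have "C = B \<union> (C - B)" "B \<inter> (C - B) = {}" using assms(2) by auto
  then show ?thesis
    using lp_sum_cutoff_Un[OF assms(1), of B "C - B"] lp_sum_nonneg[OF lp_space_cutoff[OF assms(1), of "C - B"]]
    by simp
qed

lemma lp_norm_cutoff_mono: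
  assumes "u \<in> lp_space q" "0 < q" "B \<subseteq> C"
  shows "lp_norm q (cutoff B u) \<le> lp_norm q (cutoff C u)"
  unfolding lp_norm_eq
  by (rule powr_mono2)
     (use assms in \<open>auto intro: lp_sum_cutoff_mono lp_sum_nonneg lp_space_cutoff\<close>)

lemma lp_norm_cutoff_le:
  assumes "u \<in> lp_space q" "0 < q"
  shows "lp_norm q (cutoff B u) \<le> lp_norm q u"
  using lp_norm_cutoff_mono[OF assms, of B UNIV] by simp

lemma lp_sum_cutoff_UNION:
  assumes "u \<in> lp_space q" "finite K" "disjoint_family_on B K"
  shows "(\<Sum>k\<in>K. lp_sum q (cutoff (B k) u)) = lp_sum q (cutoff (\<Union>k\<in>K. B k) u)"
  using assms(2,3)
proof (induction K)
  case (insert k K)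
  then have "B k \<inter> (\<Union>k\<in>K. B k) = {}" "disjoint_family_on B K"
    by (auto simp: disjoint_family_on_def)
  with insert show ?case by (simp add: lp_sum_cutoff_Un[OF assms(1)])
qed simp

lemma lp_sum_disjoint_le:
  assumes "u \<in> lp_space q" "finite K" "disjoint_family_on B K"
  shows "(\<Sum>k\<in>K. lp_sum q (cutoff (B k) u)) \<le> lp_sum q u"
  using lp_sum_cutoff_UNION[OF assms] lp_sum_cutoff_mono[OF assms(1), of _ UNIV] by simp

lemma lp_space_add:
  assumes "u \<in> lp_space q" "v \<in> lp_space q" "0 < q"
  shows "(\<lambda>n. u n + v n) \<in> lp_space q"
proof -
  have *: "norm (u n + v n) powr q \<le> 2 powr q * (norm (u n) powr q + norm (v n) powr q)" for n
  proof -
    have "norm (u n + v n) \<le> 2 * max (norm (u n)) (norm (v n))"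
      using norm_triangle_ineq[of "u n" "v n"] by linarith
    then have "norm (u n + v n) powr q \<le> (2 * max (norm (u n)) (norm (v n))) powr q"
      using assms(3) by (intro powr_mono2) auto
    also have "\<dots> = 2 powr q * (max (norm (u n)) (norm (v n))) powr q"
      by (simp add: powr_mult)
    also have "\<dots> \<le> 2 powr q * (norm (u n) powr q + norm (v n) powr q)"
      by (auto simp: max_def)
    finally show ?thesis .
  qed
  show ?thesis
    unfolding lp_space_def mem_Collect_eq
    by (rule summable_comparison_test'[of "\<lambda>n. 2 powr q * (norm (u n) powr q + norm (v n) powr q)" 0])
       (use * in \<open>auto intro!: summable_mult summable_add lp_summable assms\<close>)
qed

lemma
  fixes u :: "nat \<Rightarrow> 'k::real_normed_field"
  assumes "u \<in> lp_space q"
  shows lp_space_scale: "(\<lambda>n. c * u n) \<in> lp_space q"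
    and lp_sum_scale: "lp_sum q (\<lambda>n. c * u n) = norm c powr q * lp_sum q u"
proof -
  show "(\<lambda>n. c * u n) \<in> lp_space q"
    using lp_summable[OF assms] by (simp add: lp_space_def norm_mult powr_mult summable_mult)
  show "lp_sum q (\<lambda>n. c * u n) = norm c powr q * lp_sum q u"
    using lp_summable[OF assms] by (simp add: lp_sum_def norm_mult powr_mult suminf_mult)
qed

lemma lp_norm_scale:
  fixes u :: "nat \<Rightarrow> 'k::real_normed_field"
  assumes "u \<in> lp_space q" "0 < q"
  shows "lp_norm q (\<lambda>n. c * u n) = norm c * lp_norm q u"
  using assms by (simp add: lp_norm_eq lp_sum_scale powr_mult powr_powr lp_sum_nonneg)

lemma
  fixes q :: real
  shows lp_space_unit: "(unit_seq m :: nat \<Rightarrow> 'k::real_normed_field) \<in> lp_space q"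
    and lp_norm_unit: "lp_norm q (unit_seq m :: nat \<Rightarrow> 'k) = 1"
proof -
  have "(\<lambda>n. norm (unit_seq m n :: 'k) powr q) = (\<lambda>n. if n = m then 1 else 0)"
    by (auto simp: unit_seq_def)
  moreover have "(\<lambda>n. if n = m then (1::real) else 0) sums 1"
    using sums_single[of m "\<lambda>_. 1::real"] by simp
  ultimately have "(\<lambda>n. norm (unit_seq m n :: 'k) powr q) sums 1" by simp
  then show "(unit_seq m :: nat \<Rightarrow> 'k) \<in> lp_space q"
    and "lp_norm q (unit_seq m :: nat \<Rightarrow> 'k) = 1"
    by (auto simp: lp_space_def lp_norm_def sums_iff)
qed

lemma lp_norm_coord_le:
  assumes "u \<in> lp_space q" "0 < q"
  shows "norm (u m) \<le> lp_norm q u"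
proof -
  have "norm (u m) powr q \<le> lp_sum q u"
    unfolding lp_sum_def using lp_summable[OF assms(1)] sum_le_suminf[of _ "{m}"] by fastforce
  then have "(norm (u m) powr q) powr (1 / q) \<le> lp_sum q u powr (1 / q)"
    using assms by (intro powr_mono2) auto
  then show ?thesis using assms by (simp add: lp_norm_eq powr_powr)
qed

lemma lp_tail_tendsto:
  assumes "u \<in> lp_space q" "0 < q"
  shows "(\<lambda>M. lp_norm q (cutoff {M..} u)) \<longlonglongrightarrow> 0"
proof -
  have s: "lp_sum q (cutoff {M..} u) = (\<Sum>n. norm (u (n + M)) powr q)" for M
  proof -
    have "lp_sum q (cutoff {M..} u) = (\<Sum>n. norm (cutoff {M..} u (n + M)) powr q)
        + (\<Sum>n<M. norm (cutoff {M..} u n) powr q)"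
      unfolding lp_sum_def
      by (rule suminf_split_initial_segment) (simp add: lp_summable lp_space_cutoff assms)
    then show ?thesis by (simp add: cutoff_def)
  qed
  have "(\<lambda>M. lp_sum q (cutoff {M..} u)) \<longlonglongrightarrow> 0"
    unfolding s using suminf_exist_split2[OF lp_summable[OF assms(1)]] by simp
  from tendsto_powr'[OF this tendsto_const[of "1 / q"]]
  show ?thesis
    using assms by (simp add: lp_norm_eq lp_sum_nonneg lp_space_cutoff)
qed

lemma lp_space_sum:
  assumes "\<And>k. k \<in> K \<Longrightarrow> u k \<in> lp_space q" "0 < q"
  shows "(\<lambda>n. \<Sum>k\<in>K. u k n) \<in> lp_space q"
  using assms(1)
  by (induction K rule: infinite_finite_induct) (auto simp: lp_space_zero intro: lp_space_add assms(2))

lemma lp_sum_le_1: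
  assumes "u \<in> lp_space q" "0 < q" "lp_norm q u \<le> 1"
  shows "lp_sum q u \<le> 1"
  using powr_mono2[of q "lp_norm q u" 1] assms by (simp add: lp_norm_powr lp_norm_nonneg)

section \<open>Convexity inequalities for powers\<close>

lemma weighted_geometric_le:
  fixes w y :: "'i \<Rightarrow> real"
  assumes "finite A" "\<And>l. l \<in> A \<Longrightarrow> 0 < w l" "(\<Sum>l\<in>A. w l) = 1" "\<And>l. l \<in> A \<Longrightarrow> 0 \<le> y l"
  shows "(\<Prod>l\<in>A. y l powr w l) \<le> (\<Sum>l\<in>A. w l * y l)"
proof (cases "\<exists>l\<in>A. y l = 0")
  case True
  then have "(\<Prod>l\<in>A. y l powr w l) = 0" using assms(1) by (auto simp: prod_zero_iff)
  moreover have "0 \<le> (\<Sum>l\<in>A. w l * y l)"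
    by (intro sum_nonneg mult_nonneg_nonneg) (use assms in \<open>auto simp: less_imp_le\<close>)
  ultimately show ?thesis by simp
next
  case False
  then have pos: "0 < y l" "y l \<noteq> 0" if "l \<in> A" for l using assms(4) that by fastforce+
  have "(\<Prod>l\<in>A. y l powr w l) = exp (\<Sum>l\<in>A. w l *\<^sub>R ln (y l))"
    using pos assms(1) by (auto simp: exp_sum powr_def intro: prod.cong)
  also have "\<dots> \<le> (\<Sum>l\<in>A. w l * exp (ln (y l)))"
    by (rule convex_on_sum[OF assms(1) _ exp_convex])
       (use assms(1,2,3) in \<open>auto simp: less_imp_le\<close>)
  also have "\<dots> = (\<Sum>l\<in>A. w l * y l)" using pos by (intro sum.cong) auto
  finally show ?thesis .
qed

text \<open>Lower the exponents to total weight \<open>1\<close> and apply the weighted inequality between geometric and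
  arithmetic means to each summand.\<close>

lemma sum_prod_powr_le_1:
  fixes a :: "'k \<Rightarrow> 'i \<Rightarrow> real"
  assumes "finite A" "\<And>l. l \<in> A \<Longrightarrow> 0 < \<theta> l" "1 \<le> (\<Sum>l\<in>A. \<theta> l)"
    and "\<And>k l. k \<in> K \<Longrightarrow> l \<in> A \<Longrightarrow> 0 \<le> a k l" "finite K"
    and "\<And>l. l \<in> A \<Longrightarrow> (\<Sum>k\<in>K. a k l) \<le> 1"
  shows "(\<Sum>k\<in>K. \<Prod>l\<in>A. a k l powr \<theta> l) \<le> 1"
proof -
  define s where "s = (\<Sum>l\<in>A. \<theta> l)"
  have s: "s \<ge> 1" using assms(3) by (simp add: s_def)
  define w where "w l = \<theta> l / s" for l
  have w: "0 < w l" "w l \<le> \<theta> l" if "l \<in> A" for l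
    using assms(2)[OF that] s mult_left_mono[of 1 s "\<theta> l"] by (auto simp: w_def divide_le_eq)
  have w1: "(\<Sum>l\<in>A. w l) = 1"
    using s by (simp add: w_def sum_divide_distrib[symmetric] flip: s_def)
  have a1: "a k l \<le> 1" if "k \<in> K" "l \<in> A" for k l
    using member_le_sum[of k K "\<lambda>k. a k l"] that assms by force
  have "(\<Sum>k\<in>K. \<Prod>l\<in>A. a k l powr \<theta> l) \<le> (\<Sum>k\<in>K. \<Sum>l\<in>A. w l * a k l)"
  proof (rule sum_mono)
    fix k assume k: "k \<in> K"
    have "(\<Prod>l\<in>A. a k l powr \<theta> l) \<le> (\<Prod>l\<in>A. a k l powr w l)"
      by (rule prod_mono) (use a1 k assms w in \<open>auto intro: powr_mono'\<close>)
    also have "\<dots> \<le> (\<Sum>l\<in>A. w l * a k l)"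
      by (rule weighted_geometric_le) (use w w1 assms k in auto)
    finally show "(\<Prod>l\<in>A. a k l powr \<theta> l) \<le> (\<Sum>l\<in>A. w l * a k l)" .
  qed
  also have "\<dots> = (\<Sum>l\<in>A. w l * (\<Sum>k\<in>K. a k l))"
    by (subst sum.swap) (simp add: sum_distrib_left)
  also have "\<dots> \<le> (\<Sum>l\<in>A. w l * 1)"
    by (intro sum_mono mult_left_mono) (use w assms in \<open>auto simp: less_imp_le\<close>)
  finally show ?thesis using w1 by simp
qed

text \<open>Convexity on the open half-line extends to the end point: when one argument is 0, only
  \<open>w powr r \<le> w\<close> for w between 0 and 1 is at stake.\<close>

lemma convex_powr_nonneg:
  fixes r :: real
  assumes "1 \<le> r" "0 \<le> x" "0 \<le> y" "0 \<le> u" "0 \<le> v" "u + v = 1"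
  shows "(u * x + v * y) powr r \<le> u * x powr r + v * y powr r"
proof (cases "x = 0 \<or> y = 0")
  case True
  have *: "(w * z) powr r \<le> w * z powr r" if "0 \<le> w" "w \<le> 1" "0 \<le> z" for w z :: real
  proof -
    have "w powr r \<le> w" using powr_mono'[of 1 r w] that assms(1) by simp
    then show ?thesis using that by (simp add: powr_mult mult_right_mono)
  qed
  show ?thesis using True *[of u x] *[of v y] assms by auto
next
  case False
  then have "x \<in> {0<..}" "y \<in> {0<..}" using assms by auto
  then show ?thesis
    using convex_onD[OF powr_convex[OF assms(1)], of v x y] assms
    by (simp add: eq_diff_eq[symmetric] add.commute)
qed

section \<open>Normed spaces over the scalar field\<close>

context normed_space_over
begin

text \<open>The function \<open>g r = smul (of_real r) x - r *\<^sub>R x\<close> is additive, of linear growth and zero on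
  the integers, so \<open>g r = g (frac (n * r)) / n\<close> is arbitrarily small.\<close>

lemma smul_of_real: "smul (of_real r) x = r *\<^sub>R x"
proof -
  define g where "g r = smul (of_real r) x - r *\<^sub>R x" for r
  have add: "g (a + b) = g a + g b" for a b
    by (simp add: g_def scale_left_distrib scaleR_left_distrib algebra_simps)
  have g1: "g 1 = 0" by (simp add: g_def)
  have g0: "g 0 = 0" by (simp add: g_def)
  have nat: "g (real n * a) = real n *\<^sub>R g a" for n a
    by (induction n) (simp_all add: g0 add algebra_simps)
  have g_neg: "g (- a) = - g a" for a
    using add[of a "- a"] g0 by (simp add: eq_neg_iff_add_eq_0 add.commute)
  have int: "g (real_of_int k) = 0" for k
  proof (cases k)
    case (nonneg n)
    then show ?thesis using nat[of n 1] g1 by simp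
  next
    case (neg n)
    then show ?thesis using nat[of "Suc n" 1] g1 g_neg[of "real (Suc n)"] by simp
  qed
  have bound: "norm (g a) \<le> 2 * norm x" if "0 \<le> a" "a \<le> 1" for a
  proof -
    have "norm (g a) \<le> norm (smul (of_real a) x) + norm (a *\<^sub>R x)"
      unfolding g_def by (rule norm_triangle_ineq4)
    also have "\<dots> = 2 * (a * norm x)" using that by (simp add: norm_smul)
    also have "\<dots> \<le> 2 * norm x" using that by (simp add: mult_left_le_one_le)
    finally show ?thesis .
  qed
  have small: "real n * norm (g r) \<le> 2 * norm x" for n
  proof -
    have "real n * norm (g r) = norm (g (real n * r))" by (simp add: nat)
    also have "g (real n * r) = g (frac (real n * r))"
      using add[of "real_of_int \<lfloor>real n * r\<rfloor>" "frac (real n * r)"] int[of "\<lfloor>real n * r\<rfloor>"]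
      by (simp add: frac_def)
    also have "norm (g (frac (real n * r))) \<le> 2 * norm x"
      by (rule bound) (simp_all add: frac_lt_1 less_imp_le)
    finally show ?thesis .
  qed
  have "norm (g r) = 0"
  proof (rule ccontr)
    assume "norm (g r) \<noteq> 0"
    then obtain n where "2 * norm x < real n * norm (g r)"
      using ex_less_of_nat_mult[of "norm (g r)" "2 * norm x"] by auto
    with small[of n] show False by simp
  qed
  then show ?thesis by (simp add: g_def)
qed

lemma smul_minus_1: "smul (- 1) x = - x"
  using smul_of_real[of "- 1" x] by simp

lemma tendsto_smul: "(f \<longlongrightarrow> l) F \<Longrightarrow> ((\<lambda>n. smul c (f n)) \<longlongrightarrow> smul c l) F"
proof -
  have "bounded_linear (smul c)"
  proof (rule bounded_linear_intro[where K = "norm c"])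
    show "smul c (r *\<^sub>R x) = r *\<^sub>R smul c x" for r x
      by (simp add: smul_of_real[symmetric] mult.commute)
  qed (simp_all add: scale_right_distrib norm_smul mult.commute)
  then show "(f \<longlongrightarrow> l) F \<Longrightarrow> ((\<lambda>n. smul c (f n)) \<longlongrightarrow> smul c l) F"
    by (rule bounded_linear.tendsto)
qed

lemma subspace_scaleR: "subspace V \<Longrightarrow> x \<in> V \<Longrightarrow> r *\<^sub>R x \<in> V"
  using subspace_scale[of V x "of_real r"] by (simp add: smul_of_real)

lemma subspace_closure:
  assumes "subspace V"
  shows "subspace (closure V)"
proof (rule subspaceI)
  show "0 \<in> closure V" using assms subspace_0 closure_subset by blast
  show "x + y \<in> closure V" if xy: "x \<in> closure V" "y \<in> closure V" for x y
  proof -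
    obtain f g where "\<And>n. f n \<in> V" "f \<longlonglongrightarrow> x" "\<And>n. g n \<in> V" "g \<longlonglongrightarrow> y"
      using xy unfolding closure_sequential by blast
    then show ?thesis
      unfolding closure_sequential
      by (intro exI[of _ "\<lambda>n. f n + g n"]) (auto intro: tendsto_add subspace_add[OF assms])
  qed
  show "smul c x \<in> closure V" if x: "x \<in> closure V" for c x
  proof -
    obtain f where "\<And>n. f n \<in> V" "f \<longlonglongrightarrow> x"
      using x unfolding closure_sequential by blast
    then show ?thesis
      unfolding closure_sequential
      by (intro exI[of _ "\<lambda>n. smul c (f n)"]) (auto intro: tendsto_smul subspace_scale[OF assms])
  qed
qed

text \<open>Operators are total functions whose values off V are arbitrary. Invariance of V is part
  of the notion, so that operators can be composed.\<close>

definition bounded_op :: "'x set \<Rightarrow> ('x \<Rightarrow> 'x) \<Rightarrow> bool" where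
  "bounded_op V G \<longleftrightarrow> linear_on smul V G \<and> G ` V \<subseteq> V \<and> (\<exists>c. \<forall>x\<in>V. norm (G x) \<le> c * norm x)"

lemma bounded_opI:
  assumes "\<And>x y. x \<in> V \<Longrightarrow> y \<in> V \<Longrightarrow> G (x + y) = G x + G y"
    and "\<And>c x. x \<in> V \<Longrightarrow> G (smul c x) = smul c (G x)"
    and "\<And>x. x \<in> V \<Longrightarrow> G x \<in> V" and "\<And>x. x \<in> V \<Longrightarrow> norm (G x) \<le> c * norm x"
  shows "bounded_op V G"
  unfolding bounded_op_def linear_on_def using assms by blast

lemma bounded_op_add: "bounded_op V G \<Longrightarrow> x \<in> V \<Longrightarrow> y \<in> V \<Longrightarrow> G (x + y) = G x + G y"
  by (simp add: bounded_op_def linear_on_def)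

lemma bounded_op_smul: "bounded_op V G \<Longrightarrow> x \<in> V \<Longrightarrow> G (smul c x) = smul c (G x)"
  by (simp add: bounded_op_def linear_on_def)

lemma bounded_op_in: "bounded_op V G \<Longrightarrow> x \<in> V \<Longrightarrow> G x \<in> V"
  by (auto simp: bounded_op_def)

lemma bounded_op_scaleR: "bounded_op V G \<Longrightarrow> x \<in> V \<Longrightarrow> G (r *\<^sub>R x) = r *\<^sub>R G x"
  by (metis smul_of_real bounded_op_smul)

lemma bounded_op_bound:
  assumes "bounded_op V G"
  obtains c where "0 < c" "\<And>x. x \<in> V \<Longrightarrow> norm (G x) \<le> c * norm x"
proof -
  obtain c where c: "\<forall>x\<in>V. norm (G x) \<le> c * norm x" using assms by (auto simp: bounded_op_def)
  have "norm (G x) \<le> max c 1 * norm x" if "x \<in> V" for x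
    using c that by (meson max.cobounded1 mult_right_mono norm_ge_zero order_trans)
  then show ?thesis by (intro that[of "max c 1"]) auto
qed

lemma bounded_op_0: "bounded_op V G \<Longrightarrow> x \<in> V \<Longrightarrow> G 0 = 0"
  using bounded_op_smul[of V G x 0] by simp

lemma bounded_op_minus: "bounded_op V G \<Longrightarrow> x \<in> V \<Longrightarrow> G (- x) = - G x"
  using bounded_op_smul[of V G x "- 1"] by (simp add: smul_minus_1)

lemma bounded_op_diff:
  assumes "subspace V" "bounded_op V G" "x \<in> V" "y \<in> V"
  shows "G (x - y) = G x - G y"
  using bounded_op_add[OF assms(2,3) subspace_neg[OF assms(1,4)]] bounded_op_minus[OF assms(2,4)]
  by simp

lemma bounded_op_sum:
  assumes "subspace V" "bounded_op V G" "\<And>k. k \<in> K \<Longrightarrow> f k \<in> V"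
  shows "G (\<Sum>k\<in>K. f k) = (\<Sum>k\<in>K. G (f k))"
  using assms(3) bounded_op_0[OF assms(2) subspace_0[OF assms(1)]]
proof (induction K rule: infinite_finite_induct)
  case (insert k K)
  then show ?case
    by (simp add: bounded_op_add[OF assms(2)] subspace_sum[OF assms(1)])
qed auto

lemma bounded_op_id: "bounded_op V (\<lambda>x. x)"
  by (rule bounded_opI[where c = 1]) auto

lemma bounded_op_compose:
  assumes "bounded_op V G" "bounded_op V H"
  shows "bounded_op V (\<lambda>x. G (H x))"
proof -
  obtain c where c: "0 < c" "\<And>x. x \<in> V \<Longrightarrow> norm (G x) \<le> c * norm x"
    using bounded_op_bound[OF assms(1)] by blast
  obtain d where d: "0 < d" "\<And>x. x \<in> V \<Longrightarrow> norm (H x) \<le> d * norm x"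
    using bounded_op_bound[OF assms(2)] by blast
  show ?thesis
  proof (rule bounded_opI[where c = "c * d"])
    fix x assume x: "x \<in> V"
    have "norm (G (H x)) \<le> c * norm (H x)" by (rule c) (use x assms bounded_op_in in auto)
    also have "\<dots> \<le> c * (d * norm x)" using c d x by simp
    finally show "norm (G (H x)) \<le> c * d * norm x" by simp
  qed (use assms in \<open>auto simp: bounded_op_in bounded_op_add bounded_op_smul\<close>)
qed

lemma bounded_op_plus:
  assumes "subspace V" "bounded_op V G" "bounded_op V H"
  shows "bounded_op V (\<lambda>x. G x + H x)"
proof -
  obtain c where c: "0 < c" "\<And>x. x \<in> V \<Longrightarrow> norm (G x) \<le> c * norm x"
    using bounded_op_bound[OF assms(2)] by blast
  obtain d where d: "0 < d" "\<And>x. x \<in> V \<Longrightarrow> norm (H x) \<le> d * norm x"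
    using bounded_op_bound[OF assms(3)] by blast
  show ?thesis
  proof (rule bounded_opI[where c = "c + d"])
    fix x assume x: "x \<in> V"
    show "norm (G x + H x) \<le> (c + d) * norm x"
      using c(2)[OF x] d(2)[OF x] norm_triangle_ineq[of "G x" "H x"] by (simp add: algebra_simps)
  qed (use assms in \<open>auto simp: bounded_op_in bounded_op_add bounded_op_smul scale_right_distrib
    intro: subspace_add\<close>)
qed

lemma bounded_op_zero: "subspace V \<Longrightarrow> bounded_op V (\<lambda>x. 0)"
  by (rule bounded_opI[where c = 0]) (auto intro: subspace_0)

lemma bounded_op_uminus: "subspace V \<Longrightarrow> bounded_op V G \<Longrightarrow> bounded_op V (\<lambda>x. - G x)"
  by (auto simp: bounded_op_def linear_on_def image_subset_iff subspace_neg)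

lemma bounded_op_minus_op:
  "subspace V \<Longrightarrow> bounded_op V G \<Longrightarrow> bounded_op V H \<Longrightarrow> bounded_op V (\<lambda>x. G x - H x)"
  using bounded_op_plus[OF _ _ bounded_op_uminus] by simp

lemma bounded_op_sum_op:
  assumes "subspace V" "\<And>k. k \<in> K \<Longrightarrow> bounded_op V (G k)"
  shows "bounded_op V (\<lambda>x. \<Sum>k\<in>K. G k x)"
  using assms(2)
  by (induction K rule: infinite_finite_induct)
     (auto intro: bounded_op_zero[OF assms(1)] bounded_op_plus[OF assms(1)])

lemma bounded_op_continuous:
  assumes "subspace V" "bounded_op V G"
  shows "continuous_on V G"
proof -
  obtain c where c: "0 < c" "\<And>x. x \<in> V \<Longrightarrow> norm (G x) \<le> c * norm x"
    using bounded_op_bound[OF assms(2)] by blast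
  have "c-lipschitz_on V G"
  proof (rule lipschitz_onI)
    fix x y assume "x \<in> V" "y \<in> V"
    then show "dist (G x) (G y) \<le> c * dist x y"
      using c(2)[of "x - y"] bounded_op_diff[OF assms] by (simp add: dist_norm subspace_diff[OF assms(1)])
  qed (use c in simp)
  then show ?thesis by (rule lipschitz_on_continuous_on)
qed

lemma bounded_op_tendsto:
  assumes "subspace V" "bounded_op V G" "\<And>n. f n \<in> V" "x \<in> V" "f \<longlonglongrightarrow> x"
  shows "(\<lambda>n. G (f n)) \<longlonglongrightarrow> G x"
  using continuous_on_tendsto_compose[OF bounded_op_continuous[OF assms(1,2)] assms(5,4)] assms(3)
  by simp

text \<open>Extension by density from V to its closure. Completeness is an explicit hypothesis
  because the ambient space is merely normed here; invariance of V passes to the closure.\<close>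

lemma bounded_op_extend:
  fixes f :: "'x \<Rightarrow> 'x"
  assumes V: "subspace V" and c: "0 \<le> c" and complete: "complete (UNIV :: 'x set)"
    and add: "\<And>x y. x \<in> V \<Longrightarrow> y \<in> V \<Longrightarrow> f (x + y) = f x + f y"
    and scale: "\<And>a x. x \<in> V \<Longrightarrow> f (smul a x) = smul a (f x)"
    and closed: "\<And>x. x \<in> V \<Longrightarrow> f x \<in> V"
    and bound: "\<And>x. x \<in> V \<Longrightarrow> norm (f x) \<le> c * norm x"
  obtains g where "bounded_op (closure V) g" "\<And>x. x \<in> V \<Longrightarrow> g x = f x"
    "\<And>x. x \<in> closure V \<Longrightarrow> norm (g x) \<le> c * norm x"
proof -
  have "bounded_op V f" using assms by (intro bounded_opI) auto
  have "\<exists>l. (\<lambda>n. f (s n)) \<longlonglongrightarrow> l" if "\<And>n. s n \<in> V" "s \<longlonglongrightarrow> x" for s x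
  proof -
    have "Cauchy (\<lambda>n. f (s n))"
    proof (rule CauchyI)
      fix e :: real assume e: "0 < e"
      have "Cauchy s" using that LIMSEQ_imp_Cauchy by blast
      then obtain M where M: "\<And>m n. m \<ge> M \<Longrightarrow> n \<ge> M \<Longrightarrow> norm (s m - s n) < e / (c + 1)"
        using CauchyD[of s "e / (c + 1)"] e c by auto
      show "\<exists>M. \<forall>m\<ge>M. \<forall>n\<ge>M. norm (f (s m) - f (s n)) < e"
      proof (intro exI allI impI)
        fix m n assume mn: "m \<ge> M" "n \<ge> M"
        have "norm (f (s m) - f (s n)) = norm (f (s m - s n))"
          using bounded_op_diff[OF V \<open>bounded_op V f\<close>] that by simp
        also have "\<dots> \<le> c * norm (s m - s n)" using that V by (intro bound subspace_diff) auto
        also have "\<dots> \<le> c * (e / (c + 1))" using M[OF mn] c by (intro mult_left_mono) auto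
        also have "\<dots> < e" using e c by (simp add: field_simps)
        finally show "norm (f (s m) - f (s n)) < e" .
      qed
    qed
    then show ?thesis using complete unfolding complete_def by blast
  qed note lim_ex = this
  have "\<exists>l. \<exists>s. (\<forall>n. s n \<in> V) \<and> s \<longlonglongrightarrow> x \<and> (\<lambda>n. f (s n)) \<longlonglongrightarrow> l" if "x \<in> closure V" for x
    using that lim_ex unfolding closure_sequential by meson
  then obtain g where g: "\<And>x. x \<in> closure V \<Longrightarrow> \<exists>s. (\<forall>n. s n \<in> V) \<and> s \<longlonglongrightarrow> x \<and> (\<lambda>n. f (s n)) \<longlonglongrightarrow> g x"
    by metis
  \<comment> \<open>\<open>g x\<close> was obtained from one approximating sequence. Any other one
    gives the same limit, because f sends the differences, which tend to 0, to a null
    sequence.\<close>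
  have gl: "(\<lambda>n. f (s n)) \<longlonglongrightarrow> g x" if s: "\<And>n. s n \<in> V" "s \<longlonglongrightarrow> x" for s x
  proof -
    have "x \<in> closure V" using s unfolding closure_sequential by blast
    then obtain t where t: "\<And>n. t n \<in> V" "t \<longlonglongrightarrow> x" "(\<lambda>n. f (t n)) \<longlonglongrightarrow> g x" using g by blast
    have "(\<lambda>n. s n - t n) \<longlonglongrightarrow> 0" using tendsto_diff[OF s(2) t(2)] by simp
    then have "(\<lambda>n. c * norm (s n - t n)) \<longlonglongrightarrow> 0"
      by (intro tendsto_mult_right_zero tendsto_norm_zero)
    then have "(\<lambda>n. f (s n) - f (t n)) \<longlonglongrightarrow> 0"
    proof (rule Lim_null_comparison[rotated])
      show "\<forall>\<^sub>F n in sequentially. norm (f (s n) - f (t n)) \<le> c * norm (s n - t n)"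
        using bound[OF subspace_diff[OF V s(1) t(1)]] bounded_op_diff[OF V \<open>bounded_op V f\<close> s(1) t(1)]
        by simp
    qed
    from tendsto_add[OF this t(3)] show ?thesis by simp
  qed
  show ?thesis
  proof (rule that)
    show eq: "g x = f x" if "x \<in> V" for x
      using gl[of "\<lambda>n. x" x] that LIMSEQ_unique tendsto_const by blast
    show norm: "norm (g x) \<le> c * norm x" if x: "x \<in> closure V" for x
    proof -
      obtain s where s: "\<And>n. s n \<in> V" "s \<longlonglongrightarrow> x" using x unfolding closure_sequential by blast
      show ?thesis
        by (rule LIMSEQ_le[OF tendsto_norm[OF gl[OF s]] tendsto_mult_left[OF tendsto_norm[OF s(2)]]])
           (use bound s in blast)
    qed
    show "bounded_op (closure V) g"
    proof (rule bounded_opI[OF _ _ _ norm])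
      fix x y assume x: "x \<in> closure V" and y: "y \<in> closure V"
      obtain s where s: "\<And>n. s n \<in> V" "s \<longlonglongrightarrow> x" using x unfolding closure_sequential by blast
      obtain t where t: "\<And>n. t n \<in> V" "t \<longlonglongrightarrow> y" using y unfolding closure_sequential by blast
      have "(\<lambda>n. f (s n + t n)) \<longlonglongrightarrow> g (x + y)"
        by (rule gl) (use s t V in \<open>auto intro: subspace_add tendsto_add\<close>)
      moreover have "(\<lambda>n. f (s n + t n)) \<longlonglongrightarrow> g x + g y"
        using tendsto_add[OF gl[OF s] gl[OF t]] by (simp add: add s t)
      ultimately show "g (x + y) = g x + g y" by (rule LIMSEQ_unique)
    next
      fix a x assume x: "x \<in> closure V"
      obtain s where s: "\<And>n. s n \<in> V" "s \<longlonglongrightarrow> x" using x unfolding closure_sequential by blast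
      have "(\<lambda>n. f (smul a (s n))) \<longlonglongrightarrow> g (smul a x)"
        by (rule gl) (use s V in \<open>auto intro: subspace_scale tendsto_smul\<close>)
      moreover have "(\<lambda>n. f (smul a (s n))) \<longlonglongrightarrow> smul a (g x)"
        using tendsto_smul[OF gl[OF s]] by (simp add: scale s)
      ultimately show "g (smul a x) = smul a (g x)" by (rule LIMSEQ_unique)
    next
      fix x assume x: "x \<in> closure V"
      obtain s where s: "\<And>n. s n \<in> V" "s \<longlonglongrightarrow> x" using x unfolding closure_sequential by blast
      show "g x \<in> closure V"
        unfolding closure_sequential
        by (intro exI[of _ "\<lambda>n. f (s n)"] conjI allI closed s gl)
    qed
  qed
qed

end

section \<open>The projective tensor product\<close>

locale lp_tensor = normed_space_over smul
  for smul :: "'k::real_normed_field \<Rightarrow> 'x::banach \<Rightarrow> 'x" +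
  fixes I :: "'i set" and p :: "'i \<Rightarrow> real" and X :: "'x set"
    and J :: "((('i \<Rightarrow> nat \<Rightarrow> 'k) \<Rightarrow> 'k) \<Rightarrow> 'k) \<Rightarrow> 'x"
  assumes finite_I: "finite I" and I_nonempty: "I \<noteq> {}"
    and p_gt_1: "\<And>l. l \<in> I \<Longrightarrow> 1 < p l"
    and J_add: "\<And>s t. s \<in> algebraic_tensor_product I (\<lambda>l. lp_space (p l)) \<Longrightarrow>
      t \<in> algebraic_tensor_product I (\<lambda>l. lp_space (p l)) \<Longrightarrow> J (\<lambda>\<phi>. s \<phi> + t \<phi>) = J s + J t"
    and J_scale: "\<And>c t. t \<in> algebraic_tensor_product I (\<lambda>l. lp_space (p l)) \<Longrightarrow>
      J (\<lambda>\<phi>. c * t \<phi>) = smul c (J t)"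
    and J_norm: "\<And>t. t \<in> algebraic_tensor_product I (\<lambda>l. lp_space (p l)) \<Longrightarrow>
      norm (J t) = projective_norm I (\<lambda>l. lp_space (p l)) (\<lambda>l. lp_norm (p l)) t"
    and J_dense: "closure (J ` algebraic_tensor_product I (\<lambda>l. lp_space (p l))) = X"
begin

abbreviation E :: "'i \<Rightarrow> (nat \<Rightarrow> 'k) set" where
  "E \<equiv> \<lambda>l. lp_space (p l)"

abbreviation tuples :: "('i \<Rightarrow> nat \<Rightarrow> 'k) set" where
  "tuples \<equiv> Pi\<^sub>E I E"

abbreviation alg :: "((('i \<Rightarrow> nat \<Rightarrow> 'k) \<Rightarrow> 'k) \<Rightarrow> 'k) set" where
  "alg \<equiv> algebraic_tensor_product I E"

definition tens :: "('i \<Rightarrow> nat \<Rightarrow> 'k) \<Rightarrow> 'x" where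
  "tens x = J (elementary_tensor I E x)"

definition tnorm :: "('i \<Rightarrow> nat \<Rightarrow> 'k) \<Rightarrow> real" where
  "tnorm x = (\<Prod>l\<in>I. lp_norm (p l) (x l))"

lemma p_pos: "l \<in> I \<Longrightarrow> 0 < p l"
  using p_gt_1 by fastforce

lemma tuples_upd: "x \<in> tuples \<Longrightarrow> l \<in> I \<Longrightarrow> u \<in> E l \<Longrightarrow> x(l := u) \<in> tuples"
  by (auto simp: PiE_def extensional_def)

lemma tuplesD: "x \<in> tuples \<Longrightarrow> l \<in> I \<Longrightarrow> x l \<in> E l"
  by (auto simp: PiE_def)

lemma tnorm_nonneg: "0 \<le> tnorm x"
  by (simp add: tnorm_def prod_nonneg lp_norm_nonneg)

lemma tensor_of_in_alg: "set xs \<subseteq> tuples \<Longrightarrow> tensor_of I E xs \<in> alg"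
  by (auto simp: algebraic_tensor_product_def)

lemma algE:
  assumes "t \<in> alg" obtains xs where "set xs \<subseteq> tuples" "t = tensor_of I E xs"
  using assms by (auto simp: algebraic_tensor_product_def)

lemma tensor_of_append:
  "tensor_of I E (xs @ ys) = (\<lambda>\<phi>. tensor_of I E xs \<phi> + tensor_of I E ys \<phi>)"
  by (simp add: tensor_of_def)

lemma elementary_in_alg: "x \<in> tuples \<Longrightarrow> elementary_tensor I E x \<in> alg"
  using tensor_of_in_alg[of "[x]"] by (simp add: tensor_of_def)

lemma zero_in_alg: "(\<lambda>\<phi>. 0) \<in> alg"
  using tensor_of_in_alg[of "[]"] by (simp add: tensor_of_def)

lemma alg_add: "s \<in> alg \<Longrightarrow> t \<in> alg \<Longrightarrow> (\<lambda>\<phi>. s \<phi> + t \<phi>) \<in> alg"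
  by (elim algE, simp only: tensor_of_append[symmetric]) (intro tensor_of_in_alg, simp)

lemma elementary_scale:
  assumes "x \<in> tuples" "l \<in> I" "u \<in> E l"
  shows "elementary_tensor I E (x(l := (\<lambda>n. c * u n))) = (\<lambda>\<phi>. c * elementary_tensor I E (x(l := u)) \<phi>)"
  using assms by (auto simp: elementary_tensor_def multilinear_form_def)

lemma elementary_add:
  assumes "x \<in> tuples" "l \<in> I" "u \<in> E l" "v \<in> E l"
  shows "elementary_tensor I E (x(l := (\<lambda>n. u n + v n))) =
    (\<lambda>\<phi>. elementary_tensor I E (x(l := u)) \<phi> + elementary_tensor I E (x(l := v)) \<phi>)"
  using assms by (auto simp: elementary_tensor_def multilinear_form_def)

lemma alg_scale:
  assumes "t \<in> alg" shows "(\<lambda>\<phi>. c * t \<phi>) \<in> alg"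
proof -
  obtain a where a: "a \<in> I" using I_nonempty by blast
  obtain xs where xs: "set xs \<subseteq> tuples" "t = tensor_of I E xs" using assms by (rule algE)
  \<comment> \<open>The scalar is absorbed into one fixed factor a, which exists because I is
    non-empty.\<close>
  define h where "h x = x(a := (\<lambda>n. c * x a n))" for x :: "'i \<Rightarrow> nat \<Rightarrow> 'k"
  have h: "h x \<in> tuples" "elementary_tensor I E (h x) \<phi> = c * elementary_tensor I E x \<phi>"
    if "x \<in> tuples" for x \<phi>
  proof -
    show "h x \<in> tuples"
      unfolding h_def by (rule tuples_upd[OF that a lp_space_scale[OF tuplesD[OF that a]]])
    show "elementary_tensor I E (h x) \<phi> = c * elementary_tensor I E x \<phi>"
      unfolding h_def elementary_scale[OF that a tuplesD[OF that a]] by simp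
  qed
  have "(\<Sum>x\<leftarrow>xs. elementary_tensor I E (h x) \<phi>) = c * (\<Sum>x\<leftarrow>xs. elementary_tensor I E x \<phi>)" for \<phi>
    using xs(1) by (induction xs) (auto simp: h distrib_left)
  then have "tensor_of I E (map h xs) = (\<lambda>\<phi>. c * t \<phi>)"
    by (simp add: xs(2) tensor_of_def o_def)
  moreover have "set (map h xs) \<subseteq> tuples" unfolding set_map using xs(1) by (intro image_subsetI h(1)) (rule subsetD)
  ultimately show ?thesis using tensor_of_in_alg[of "map h xs"] by simp
qed

lemma J_zero: "J (\<lambda>\<phi>. 0) = 0"
  using J_add[OF zero_in_alg zero_in_alg] by simp

lemma J_tensor_of: "set xs \<subseteq> tuples \<Longrightarrow> J (tensor_of I E xs) = (\<Sum>x\<leftarrow>xs. tens x)"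
proof (induction xs)
  case Nil
  then show ?case by (simp add: tensor_of_def J_zero)
next
  case (Cons x xs)
  have "tensor_of I E (x # xs) = (\<lambda>\<phi>. elementary_tensor I E x \<phi> + tensor_of I E xs \<phi>)"
    by (simp add: tensor_of_def)
  then show ?case
    using Cons J_add[OF elementary_in_alg tensor_of_in_alg, of x xs] by (simp add: tens_def)
qed

lemma tens_scale:
  "x \<in> tuples \<Longrightarrow> l \<in> I \<Longrightarrow> u \<in> E l \<Longrightarrow> tens (x(l := (\<lambda>n. c * u n))) = smul c (tens (x(l := u)))"
  by (simp add: tens_def elementary_scale J_scale elementary_in_alg tuples_upd)

lemma tens_add:
  "x \<in> tuples \<Longrightarrow> l \<in> I \<Longrightarrow> u \<in> E l \<Longrightarrow> v \<in> E l \<Longrightarrow>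
    tens (x(l := (\<lambda>n. u n + v n))) = tens (x(l := u)) + tens (x(l := v))"
  by (simp add: tens_def elementary_add J_add elementary_in_alg tuples_upd)

lemma tens_scale_prod:
  assumes "x \<in> tuples" "B \<subseteq> I"
  shows "tens (\<lambda>l. if l \<in> B then (\<lambda>n. c l * x l n) else x l) = smul (\<Prod>l\<in>B. c l) (tens x)"
proof -
  have "finite B" using assms(2) finite_I by (rule finite_subset)
  then show ?thesis using assms(2)
  proof (induction B)
    case (insert a B)
    define y where "y = (\<lambda>l. if l \<in> B then (\<lambda>n. c l * x l n) else x l)"
    have y: "y \<in> tuples"
      using tuplesD[OF assms(1)] assms(1) insert.prems
      by (intro PiE_I) (auto simp: y_def PiE_def extensional_def intro: lp_space_scale)
    have a: "a \<in> I" "y a = x a" using insert by (auto simp: y_def)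
    have "tens (\<lambda>l. if l \<in> insert a B then (\<lambda>n. c l * x l n) else x l) = tens (y(a := (\<lambda>n. c a * x a n)))"
      using insert.hyps by (intro arg_cong[where f = tens]) (auto simp: y_def fun_eq_iff)
    also have "\<dots> = smul (c a) (tens (y(a := x a)))"
      by (rule tens_scale) (use y a assms tuplesD in auto)
    also have "y(a := x a) = y" using a by (metis fun_upd_triv)
    also have "tens y = smul (\<Prod>l\<in>B. c l) (tens x)"
      unfolding y_def by (rule insert.IH) (use insert in auto)
    finally show ?case using insert by simp
  qed simp
qed

lemma tens_norm_le:
  assumes "x \<in> tuples" shows "norm (tens x) \<le> tnorm x"
proof -
  have "norm (tens x) = projective_norm I E (\<lambda>l. lp_norm (p l)) (elementary_tensor I E x)"
    by (simp add: tens_def J_norm elementary_in_alg assms)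
  also have "\<dots> \<le> tnorm x"
    unfolding projective_norm_def
  proof (rule cInf_lower)
    show "bdd_below {(\<Sum>x\<leftarrow>xs. \<Prod>i\<in>I. lp_norm (p i) (x i)) |xs.
        xs \<in> lists tuples \<and> tensor_of I E xs = elementary_tensor I E x}"
      by (rule bdd_belowI[of _ 0]) (auto intro!: sum_list_nonneg prod_nonneg lp_norm_nonneg)
    show "tnorm x \<in> {(\<Sum>x\<leftarrow>xs. \<Prod>i\<in>I. lp_norm (p i) (x i)) |xs.
        xs \<in> lists tuples \<and> tensor_of I E xs = elementary_tensor I E x}"
      using assms by (auto simp: tnorm_def tensor_of_def intro!: exI[of _ "[x]"])
  qed
  finally show ?thesis .
qed

lemma alg_representation:
  assumes "t \<in> alg" "norm (J t) < c"
  obtains xs where "set xs \<subseteq> tuples" "t = tensor_of I E xs" "(\<Sum>x\<leftarrow>xs. tnorm x) < c"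
proof -
  let ?S = "{(\<Sum>x\<leftarrow>xs. \<Prod>i\<in>I. lp_norm (p i) (x i)) |xs. xs \<in> lists tuples \<and> tensor_of I E xs = t}"
  have "?S \<noteq> {}" using assms(1) by (auto simp: algebraic_tensor_product_def)
  moreover have "Inf ?S < c" using assms by (simp add: J_norm projective_norm_def)
  ultimately have "\<exists>s\<in>?S. s < c" by (rule cInf_lessD)
  then obtain s where "s \<in> ?S" "s < c" by (rule bexE)
  then show ?thesis using that unfolding tnorm_def by blast
qed

lemma alg_norm_le:
  assumes "t \<in> alg" "\<And>xs. set xs \<subseteq> tuples \<Longrightarrow> t = tensor_of I E xs \<Longrightarrow> c \<le> (\<Sum>x\<leftarrow>xs. tnorm x)"
  shows "c \<le> norm (J t)"
proof (rule ccontr)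
  assume "\<not> c \<le> norm (J t)"
  then obtain xs where "set xs \<subseteq> tuples" "t = tensor_of I E xs" "(\<Sum>x\<leftarrow>xs. tnorm x) < c"
    using alg_representation[OF assms(1), of c] by auto
  with assms(2) show False by fastforce
qed

section \<open>X as the closed span of the elementary tensors\<close>

lemma subspace_J_alg: "subspace (J ` alg)"
proof (rule subspaceI)
  show "0 \<in> J ` alg" unfolding J_zero[symmetric] by (rule imageI[OF zero_in_alg])
  show "x + y \<in> J ` alg" if xy: "x \<in> J ` alg" "y \<in> J ` alg" for x y
  proof -
    obtain s t where "s \<in> alg" "t \<in> alg" "x = J s" "y = J t" using xy by blast
    then show ?thesis by (auto simp: J_add[symmetric] intro!: imageI alg_add)
  qed
  show "smul c x \<in> J ` alg" if x: "x \<in> J ` alg" for c x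
  proof -
    obtain t where "t \<in> alg" "x = J t" using x by blast
    then show ?thesis by (auto simp: J_scale[symmetric] intro!: imageI alg_scale)
  qed
qed

lemma subspace_X: "subspace X"
  using subspace_closure[OF subspace_J_alg] J_dense by simp

lemma closed_X: "closed X"
  using J_dense closed_closure by blast

lemma tens_in_X: "x \<in> tuples \<Longrightarrow> tens x \<in> X"
  unfolding tens_def J_dense[symmetric]
  by (intro subsetD[OF closure_subset] imageI elementary_in_alg)

text \<open>The induction principle for closed linear properties; its counterpart for closed convex
  ones is \<open>unit_ball_induct\<close>.\<close>

lemma X_least:
  assumes "closed S" "subspace S" "\<And>x. x \<in> tuples \<Longrightarrow> tens x \<in> S"
  shows "X \<subseteq> S"
proof -
  have "J t \<in> S" if t: "t \<in> alg" for t
  proof -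
    obtain xs where xs: "set xs \<subseteq> tuples" "t = tensor_of I E xs" using t by (rule algE)
    have "(\<Sum>x\<leftarrow>xs. tens x) \<in> S" using xs(1)
      by (induction xs) (auto intro: subspace_0 subspace_add assms)
    then show ?thesis using xs by (simp add: J_tensor_of)
  qed
  then show ?thesis unfolding J_dense[symmetric] by (intro closure_minimal assms) auto
qed

lemma bounded_op_eqI:
  assumes "bounded_op X G" "bounded_op X H" "\<And>x. x \<in> tuples \<Longrightarrow> G (tens x) = H (tens x)" "y \<in> X"
  shows "G y = H y"
proof -
  let ?D = "\<lambda>x. G x - H x"
  let ?S = "{x \<in> X. ?D x = 0}"
  have D: "bounded_op X ?D" by (intro bounded_op_minus_op assms subspace_X)
  have "closed ?S"
    using continuous_closed_preimage_constant[OF bounded_op_continuous[OF subspace_X D] closed_X, of 0]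
    by simp
  moreover have "subspace ?S"
    using bounded_op_add[OF assms(1)] bounded_op_smul[OF assms(1)] bounded_op_0[OF assms(1) subspace_0[OF subspace_X]]
      bounded_op_add[OF assms(2)] bounded_op_smul[OF assms(2)] bounded_op_0[OF assms(2) subspace_0[OF subspace_X]]
    by (intro subspaceI) (auto simp: subspace_0 subspace_add subspace_scale subspace_X)
  ultimately have "X \<subseteq> ?S" using assms(3) tens_in_X by (intro X_least) auto
  then show ?thesis using assms(4) by auto
qed

text \<open>An element of norm less than \<open>1\<close> is, up to a small error, a finite sum of elementary
  tensors \<open>\<Sum>k. tens (x k)\<close> with \<open>\<Sum>k. tnorm (x k) < 1\<close>, that is, a convex combination of normalised
  elementary tensors and \<open>0\<close>.\<close>

lemma unit_ball_induct:
  assumes S: "closed S" "convex S"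
    and tens_S: "\<And>x. x \<in> tuples \<Longrightarrow> (\<And>l. l \<in> I \<Longrightarrow> lp_norm (p l) (x l) \<le> 1) \<Longrightarrow> tens x \<in> S"
    and y: "y \<in> X" "norm y \<le> 1"
  shows "y \<in> S"
proof -
  obtain a where a: "a \<in> I" using I_nonempty by blast
  have "(\<lambda>l\<in>I. (\<lambda>n. 0)) \<in> tuples" by (auto simp: lp_space_zero)
  moreover have "tnorm (\<lambda>l\<in>I. (\<lambda>n. 0)) = 0"
    unfolding tnorm_def using a finite_I by (intro prod_zero bexI[of _ a]) auto
  ultimately have S0: "0 \<in> S"
    using tens_S[of "\<lambda>l\<in>I. (\<lambda>n. 0)"] tens_norm_le[of "\<lambda>l\<in>I. (\<lambda>n. 0)"] by simp
  have tens1: "\<exists>s\<in>S. tens x = tnorm x *\<^sub>R s" if x: "x \<in> tuples" for x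
  proof (cases "tnorm x = 0")
    case True
    then show ?thesis using tens_norm_le[OF x] S0 by auto
  next
    case False
    then have nz: "lp_norm (p l) (x l) \<noteq> 0" if "l \<in> I" for l
      using that finite_I by (auto simp: tnorm_def prod_zero_iff)
    define c :: "'i \<Rightarrow> 'k" where "c l = of_real (1 / lp_norm (p l) (x l))" for l
    define x' where "x' = (\<lambda>l. if l \<in> I then (\<lambda>n. c l * x l n) else x l)"
    have x': "x' \<in> tuples"
      using tuplesD[OF x] x
      by (intro PiE_I) (auto simp: x'_def PiE_def extensional_def intro: lp_space_scale)
    have "lp_norm (p l) (x' l) = 1" if "l \<in> I" for l
      using nz[OF that] that lp_norm_scale[OF tuplesD[OF x that] p_pos[OF that], of "c l"]
      by (simp add: x'_def c_def lp_norm_nonneg norm_divide)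
    then have "tens x' \<in> S" by (intro tens_S x') simp
    moreover have "tens x' = (\<Prod>l\<in>I. 1 / lp_norm (p l) (x l)) *\<^sub>R tens x"
    proof -
      have "(\<Prod>l\<in>I. c l) = of_real (\<Prod>l\<in>I. 1 / lp_norm (p l) (x l))" by (simp add: c_def)
      then show ?thesis
        unfolding x'_def using tens_scale_prod[OF x, of I c] by (simp only: smul_of_real)
    qed
    then have "tens x = tnorm x *\<^sub>R tens x'"
      using False by (simp add: tnorm_def prod_dividef)
    ultimately show ?thesis by blast
  qed
  have list: "\<exists>s\<in>S. (\<Sum>x\<leftarrow>xs. tens x) = (\<Sum>x\<leftarrow>xs. tnorm x) *\<^sub>R s" if "set xs \<subseteq> tuples" for xs
    using that
  proof (induction xs)
    case Nil
    then show ?case using S0 by auto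
  next
    case (Cons x xs)
    let ?c = "\<Sum>x\<leftarrow>xs. tnorm x"
    obtain s where s: "s \<in> S" "(\<Sum>x\<leftarrow>xs. tens x) = ?c *\<^sub>R s" using Cons by auto
    obtain r where r: "r \<in> S" "tens x = tnorm x *\<^sub>R r" using tens1[of x] Cons.prems by auto
    have c: "0 \<le> ?c" by (rule sum_list_nonneg) (auto simp: tnorm_nonneg)
    show ?case
    proof (cases "tnorm x + ?c = 0")
      case True
      then have "tnorm x = 0" "?c = 0" using c tnorm_nonneg[of x] by linarith+
      then show ?thesis using r s by auto
    next
      case False
      then have pos: "0 < tnorm x + ?c" using c tnorm_nonneg[of x] by linarith
      let ?t = "(tnorm x / (tnorm x + ?c)) *\<^sub>R r + (?c / (tnorm x + ?c)) *\<^sub>R s"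
      have "?t \<in> S" using pos c tnorm_nonneg[of x]
        by (intro convexD[OF S(2) r(1) s(1)]) (auto simp: add_divide_distrib[symmetric])
      moreover have "(\<Sum>x\<leftarrow>x # xs. tens x) = (\<Sum>x\<leftarrow>x # xs. tnorm x) *\<^sub>R ?t"
        using r s pos by (simp add: scaleR_add_right)
      ultimately show ?thesis by blast
    qed
  qed
  have "y \<in> closure S"
    unfolding closure_approachable
  proof (intro allI impI)
    fix e :: real assume e: "0 < e"
    \<comment> \<open>Shrinking y by the factor \<open>1 - d\<close> leaves room for an
      approximation error below d, so that the approximating algebraic tensor still has norm
      strictly less than 1 and hence a representation of total size less than 1.\<close>
    define d where "d = min e 1 / 2"
    have d: "0 < d" "d \<le> e / 2" "d < 1" using e by (auto simp: d_def)
    define w where "w = (1 - d) *\<^sub>R y"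
    have w: "w \<in> X" by (simp add: w_def subspace_scaleR subspace_X y)
    have "norm w \<le> 1 - d" using y d mult_left_mono[of "norm y" 1 "1 - d"] by (simp add: w_def)
    have "dist w y \<le> d" using y d mult_left_mono[of "norm y" 1 d]
      by (simp add: w_def dist_norm scaleR_left_diff_distrib)
    obtain t where t: "t \<in> alg" "dist (J t) w < d"
      using w unfolding J_dense[symmetric] closure_approachable using d by auto
    have "norm (J t) \<le> norm w + dist (J t) w"
      using norm_triangle_ineq2[of "J t" w] by (simp add: dist_norm)
    then have "norm (J t) < 1" using t \<open>norm w \<le> 1 - d\<close> by linarith
    then obtain xs where xs: "set xs \<subseteq> tuples" "t = tensor_of I E xs" "(\<Sum>x\<leftarrow>xs. tnorm x) < 1"
      using alg_representation t(1) by blast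
    let ?c = "\<Sum>x\<leftarrow>xs. tnorm x"
    obtain s where s: "s \<in> S" "J t = ?c *\<^sub>R s" using list[OF xs(1)] xs by (auto simp: J_tensor_of)
    have "0 \<le> ?c" by (rule sum_list_nonneg) (auto simp: tnorm_nonneg)
    then have "J t \<in> S" using convexD[OF S(2) s(1) S0, of ?c "1 - ?c"] xs(3) s(2) by simp
    moreover have "dist (J t) y < e"
      using dist_triangle[of "J t" y w] t(2) \<open>dist w y \<le> d\<close> d by linarith
    ultimately show "\<exists>s\<in>S. dist s y < e" by blast
  qed
  then show ?thesis using S(1) by simp
qed

section \<open>Coordinate projections\<close>

definition restr :: "('i \<Rightarrow> nat set) \<Rightarrow> ('i \<Rightarrow> nat \<Rightarrow> 'k) \<Rightarrow> 'i \<Rightarrow> nat \<Rightarrow> 'k" where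
  "restr S x = (\<lambda>l\<in>I. cutoff (S l) (x l))"

lemma restr_in: "x \<in> tuples \<Longrightarrow> restr S x \<in> tuples"
  unfolding restr_def by (intro restrict_PiE_iff[THEN iffD2] ballI lp_space_cutoff) (rule tuplesD)

lemma restr_restr: "restr S (restr R x) = restr (\<lambda>l. S l \<inter> R l) x"
  by (auto simp: restr_def cutoff_cutoff)

lemma restr_upd: "l \<in> I \<Longrightarrow> restr S (x(l := u)) = (restr S x)(l := cutoff (S l) u)"
  by (auto simp: restr_def)

lemma multilinear_restr:
  assumes "multilinear_form I E \<phi>" shows "multilinear_form I E (\<lambda>x. \<phi> (restr S x))"
  using assms restr_in[of _ S] unfolding multilinear_form_def
  by (simp add: restr_upd cutoff_add cutoff_scale lp_space_cutoff)

lemma restr_tnorm_le: "x \<in> tuples \<Longrightarrow> tnorm (restr S x) \<le> tnorm x"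
  unfolding tnorm_def restr_def
  by (intro prod_mono) (auto simp: lp_norm_cutoff_le tuplesD p_pos lp_norm_nonneg)

text \<open>Algebraic tensors are functionals on forms, so restriction acts on them by pulling the
  forms back along \<open>restr S\<close>; no representation has to be chosen. The value 0 off the
  multilinear forms matches \<open>elementary_tensor\<close>.\<close>

definition res_alg ::
    "('i \<Rightarrow> nat set) \<Rightarrow> ((('i \<Rightarrow> nat \<Rightarrow> 'k) \<Rightarrow> 'k) \<Rightarrow> 'k) \<Rightarrow> (('i \<Rightarrow> nat \<Rightarrow> 'k) \<Rightarrow> 'k) \<Rightarrow> 'k" where
  "res_alg S t = (\<lambda>\<phi>. if multilinear_form I E \<phi> then t (\<lambda>x. \<phi> (restr S x)) else 0)"

lemma res_alg_tensor_of: "res_alg S (tensor_of I E xs) = tensor_of I E (map (restr S) xs)"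
  by (auto simp: res_alg_def tensor_of_def elementary_tensor_def multilinear_restr o_def
      intro!: arg_cong[where f = sum_list])

lemma res_alg_in: "t \<in> alg \<Longrightarrow> res_alg S t \<in> alg"
proof (elim algE)
  fix xs assume xs: "set xs \<subseteq> tuples" "t = tensor_of I E xs"
  show "res_alg S t \<in> alg"
    unfolding xs(2) res_alg_tensor_of
    by (rule tensor_of_in_alg) (unfold set_map, intro image_subsetI restr_in, rule subsetD[OF xs(1)])
qed

lemma res_alg_norm:
  assumes "t \<in> alg" shows "norm (J (res_alg S t)) \<le> norm (J t)"
proof (rule alg_norm_le[OF assms])
  fix xs assume xs: "set xs \<subseteq> tuples" "t = tensor_of I E xs"
  have "norm (J (res_alg S t)) = norm (\<Sum>x\<leftarrow>map (restr S) xs. tens x)"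
    unfolding xs(2) res_alg_tensor_of set_map
    by (subst J_tensor_of) (unfold set_map, intro image_subsetI restr_in, rule subsetD[OF xs(1)], simp_all)
  also have "\<dots> \<le> (\<Sum>x\<leftarrow>xs. tnorm x)"
    using xs(1)
  proof (induction xs)
    case (Cons x xs)
    have "norm (tens (restr S x)) \<le> tnorm x"
      using Cons.prems tens_norm_le[OF restr_in] restr_tnorm_le by (meson list.set_intros(1) order_trans subset_code(1))
    then show ?case using Cons norm_triangle_ineq[of "tens (restr S x)"]
      by (auto simp: o_def) (smt (verit))
  qed simp
  finally show "norm (J (res_alg S t)) \<le> (\<Sum>x\<leftarrow>xs. tnorm x)" .
qed

lemma proj_exists:
  "\<exists>G. bounded_op X G \<and> (\<forall>y\<in>X. norm (G y) \<le> norm y) \<and> (\<forall>x\<in>tuples. G (tens x) = tens (restr S x))"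
proof -
  define f where "f y = J (res_alg S (SOME t. t \<in> alg \<and> J t = y))" for y
  \<comment> \<open>Two preimages of the same vector differ by an algebraic tensor of norm 0, and
    restriction is contractive, so the choice in f does not affect its value.\<close>
  have f: "f (J t) = J (res_alg S t)" if t: "t \<in> alg" for t
  proof -
    define s where "s = (SOME s. s \<in> alg \<and> J s = J t)"
    have s: "s \<in> alg" "J s = J t"
      using someI[of "\<lambda>s. s \<in> alg \<and> J s = J t" t] t by (auto simp: s_def)
    let ?d = "\<lambda>\<phi>. s \<phi> + (- 1) * t \<phi>"
    have d: "?d \<in> alg" using s t alg_add alg_scale by blast
    have "J ?d = 0"
      unfolding J_add[OF s(1) alg_scale[OF t]] J_scale[OF t] s(2) smul_minus_1 by simp
    moreover have "res_alg S ?d = (\<lambda>\<phi>. res_alg S s \<phi> + (- 1) * res_alg S t \<phi>)"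
      by (auto simp: res_alg_def)
    then have "J (res_alg S ?d) = J (res_alg S s) - J (res_alg S t)"
      unfolding J_add[OF res_alg_in[OF s(1)] alg_scale[OF res_alg_in[OF t]]]
        J_scale[OF res_alg_in[OF t]] smul_minus_1
      by (simp only: diff_conv_add_uminus J_add[OF res_alg_in[OF s(1)] alg_scale[OF res_alg_in[OF t]]]
        J_scale[OF res_alg_in[OF t]] smul_minus_1)
    ultimately have "J (res_alg S s) = J (res_alg S t)" using res_alg_norm[OF d, of S] by simp
    then show ?thesis by (simp add: f_def s_def)
  qed
  obtain g where g: "bounded_op (closure (J ` alg)) g" "\<And>x. x \<in> J ` alg \<Longrightarrow> g x = f x"
    "\<And>x. x \<in> closure (J ` alg) \<Longrightarrow> norm (g x) \<le> 1 * norm x"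
  proof (rule bounded_op_extend[of "J ` alg" 1 f])
    show "f (x + y) = f x + f y" if "x \<in> J ` alg" "y \<in> J ` alg" for x y
    proof -
      obtain s t where st: "s \<in> alg" "t \<in> alg" "x = J s" "y = J t" using \<open>x \<in> J ` alg\<close> \<open>y \<in> J ` alg\<close> by auto
      have "res_alg S (\<lambda>\<phi>. s \<phi> + t \<phi>) = (\<lambda>\<phi>. res_alg S s \<phi> + res_alg S t \<phi>)"
        by (auto simp: res_alg_def)
      then show ?thesis using st by (simp add: f alg_add res_alg_in flip: J_add)
    qed
    show "f (smul a x) = smul a (f x)" if "x \<in> J ` alg" for a x
    proof -
      obtain t where t: "t \<in> alg" "x = J t" using \<open>x \<in> J ` alg\<close> by auto
      have "res_alg S (\<lambda>\<phi>. a * t \<phi>) = (\<lambda>\<phi>. a * res_alg S t \<phi>)"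
        by (auto simp: res_alg_def)
      then show ?thesis using t by (simp add: f alg_scale res_alg_in flip: J_scale)
    qed
  qed (use subspace_J_alg f res_alg_in res_alg_norm complete_UNIV in auto)
  have "g (tens x) = tens (restr S x)" if "x \<in> tuples" for x
  proof -
    have "g (tens x) = J (res_alg S (elementary_tensor I E x))"
      using that g(2)[of "tens x"] f[OF elementary_in_alg] elementary_in_alg by (simp add: tens_def)
    also have "res_alg S (elementary_tensor I E x) = elementary_tensor I E (restr S x)"
      using res_alg_tensor_of[of S "[x]"] by (simp add: tensor_of_def)
    finally show ?thesis by (simp add: tens_def)
  qed
  then show ?thesis using g J_dense by auto
qed

definition proj :: "('i \<Rightarrow> nat set) \<Rightarrow> 'x \<Rightarrow> 'x" where
  "proj S = (SOME G. bounded_op X G \<and> (\<forall>y\<in>X. norm (G y) \<le> norm y) \<and>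
    (\<forall>x\<in>tuples. G (tens x) = tens (restr S x)))"

lemma proj_op: "bounded_op X (proj S)"
  and proj_norm_le: "y \<in> X \<Longrightarrow> norm (proj S y) \<le> norm y"
  and proj_tens: "x \<in> tuples \<Longrightarrow> proj S (tens x) = tens (restr S x)"
  using someI_ex[OF proj_exists[of S]] by (auto simp: proj_def)

lemma proj_in: "y \<in> X \<Longrightarrow> proj S y \<in> X"
  by (rule bounded_op_in[OF proj_op])

text \<open>Coordinate projections form a commuting family indexed by sets of indices; with
  \<open>proj_cong\<close>, most later operator identities reduce to comparing such sets.\<close>

lemma proj_proj: "y \<in> X \<Longrightarrow> proj S (proj R y) = proj (\<lambda>l. S l \<inter> R l) y"
  by (rule bounded_op_eqI[OF bounded_op_compose[OF proj_op proj_op] proj_op])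
     (simp_all add: proj_tens restr_in restr_restr)

lemma proj_cong: "(\<And>l. l \<in> I \<Longrightarrow> S l = R l) \<Longrightarrow> y \<in> X \<Longrightarrow> proj S y = proj R y"
  by (rule bounded_op_eqI[OF proj_op proj_op])
     (auto simp: proj_tens restr_def intro!: arg_cong[where f = tens])

lemma proj_UNIV: "y \<in> X \<Longrightarrow> (\<And>l. l \<in> I \<Longrightarrow> S l = UNIV) \<Longrightarrow> proj S y = y"
proof (rule bounded_op_eqI[OF proj_op bounded_op_id])
  show "proj S (tens x) = tens x" if "x \<in> tuples" and "\<And>l. l \<in> I \<Longrightarrow> S l = UNIV" for x
  proof -
    have "restr S x = x" using that by (auto simp: restr_def PiE_def extensional_def fun_eq_iff)
    then show ?thesis by (simp add: proj_tens that)
  qed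
qed

lemma proj_empty:
  assumes "y \<in> X" "l \<in> I" "S l = {}"
  shows "proj S y = 0"
proof (rule bounded_op_eqI[OF proj_op bounded_op_zero[OF subspace_X] _ assms(1)])
  fix x assume "x \<in> tuples"
  have "tnorm (restr S x) = 0"
    unfolding tnorm_def using assms finite_I
    by (intro prod_zero bexI[of _ l]) (auto simp: restr_def cutoff_empty)
  then show "proj S (tens x) = 0"
    using tens_norm_le[OF restr_in[OF \<open>x \<in> tuples\<close>], of S] by (simp add: proj_tens \<open>x \<in> tuples\<close>)
qed

lemma proj_Un:
  assumes "y \<in> X" "l \<in> I" "B \<inter> C = {}"
  shows "proj (S(l := B \<union> C)) y = proj (S(l := B)) y + proj (S(l := C)) y"
proof (rule bounded_op_eqI[OF proj_op bounded_op_plus[OF subspace_X proj_op proj_op] _ assms(1)])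
  fix x assume x: "x \<in> tuples"
  have *: "restr (S(l := D)) x = (restr S x)(l := cutoff D (x l))" for D
    using assms(2) by (auto simp: restr_def fun_eq_iff)
  show "proj (S(l := B \<union> C)) (tens x) = proj (S(l := B)) (tens x) + proj (S(l := C)) (tens x)"
    by (simp add: proj_tens x * cutoff_Un[OF assms(3)] tens_add restr_in lp_space_cutoff tuplesD assms)
qed

section \<open>Norm bounds and strong limits of operators on X\<close>

lemma
  assumes G: "bounded_op X G"
  shows closed_preimage_op: "closed C \<Longrightarrow> closed {y \<in> X. G y \<in> C}"
    and convex_preimage_op: "convex C \<Longrightarrow> convex {y \<in> X. G y \<in> C}"
proof -
  show "closed {y \<in> X. G y \<in> C}" if "closed C"
    using continuous_closed_preimage[OF bounded_op_continuous[OF subspace_X G] closed_X that]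
    by (simp add: vimage_def Int_def)
  show "convex {y \<in> X. G y \<in> C}" if C: "convex C"
  proof (rule convexI)
    fix a b :: 'x and u v :: real
    assume "a \<in> {y \<in> X. G y \<in> C}" "b \<in> {y \<in> X. G y \<in> C}" "0 \<le> u" "0 \<le> v" "u + v = 1"
    then show "u *\<^sub>R a + v *\<^sub>R b \<in> {y \<in> X. G y \<in> C}"
      using convexD[OF C, of "G a" "G b" u v]
      by (simp add: bounded_op_add[OF G] bounded_op_scaleR[OF G] subspace_scaleR[OF subspace_X]
          subspace_add[OF subspace_X])
  qed
qed

text \<open>The vectors z with \<open>norm (G z) \<le> K\<close> form a closed convex set, so
  \<open>unit_ball_induct\<close> reduces the bound to normalised elementary tensors.\<close>

lemma bounded_op_norm_le:
  assumes G: "bounded_op X G" and K: "0 \<le> K"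
    and tens: "\<And>x. x \<in> tuples \<Longrightarrow> (\<And>l. l \<in> I \<Longrightarrow> lp_norm (p l) (x l) \<le> 1) \<Longrightarrow> norm (G (tens x)) \<le> K"
    and y: "y \<in> X"
  shows "norm (G y) \<le> K * norm y"
proof (cases "y = 0")
  case True
  then show ?thesis using bounded_op_0[OF G y] by simp
next
  case False
  let ?S = "{z \<in> X. norm (G z) \<le> K}"
  have "(1 / norm y) *\<^sub>R y \<in> ?S"
  proof (rule unit_ball_induct)
    have "?S = {z \<in> X. G z \<in> cball 0 K}" by auto
    then show "closed ?S" "convex ?S"
      using closed_preimage_op[OF G closed_cball, of 0 K] convex_preimage_op[OF G convex_cball, of 0 K]
      by simp_all
  qed (use tens y False in \<open>auto simp: tens_in_X subspace_scaleR subspace_X\<close>)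
  then show ?thesis using False by (simp add: bounded_op_scaleR[OF G y] field_simps)
qed

text \<open>The uniform bound makes the set of all y with \<open>G n y\<close> Cauchy a closed
  subspace, so convergence has to be checked on elementary tensors only.\<close>

lemma strong_limit:
  assumes G: "\<And>n. bounded_op X (G n)" and K: "0 \<le> K"
    and bound: "\<And>n y. y \<in> X \<Longrightarrow> norm (G n y) \<le> K * norm y"
    and tens: "\<And>x. x \<in> tuples \<Longrightarrow> Cauchy (\<lambda>n. G n (tens x))"
  obtains L where "bounded_op X L" "\<And>y. y \<in> X \<Longrightarrow> (\<lambda>n. G n y) \<longlonglongrightarrow> L y"
proof -
  let ?S = "{y \<in> X. Cauchy (\<lambda>n. G n y)}"
  have "X \<subseteq> ?S"
  proof (rule X_least)
    show "subspace ?S"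
    proof (rule subspaceI)
      have "G n 0 = 0" for n using bounded_op_0[OF G subspace_0[OF subspace_X]] .
      then show "0 \<in> ?S" by (simp add: subspace_0 subspace_X convergent_Cauchy convergent_const)
      show "y + z \<in> ?S" if yz: "y \<in> ?S" "z \<in> ?S" for y z
      proof -
        obtain l where l: "(\<lambda>n. G n y) \<longlonglongrightarrow> l" using yz Cauchy_convergent convergent_def by blast
        obtain k where k: "(\<lambda>n. G n z) \<longlonglongrightarrow> k" using yz Cauchy_convergent convergent_def by blast
        have "(\<lambda>n. G n (y + z)) \<longlonglongrightarrow> l + k"
          using tendsto_add[OF l k] yz by (simp add: bounded_op_add[OF G])
        then show ?thesis using yz by (simp add: LIMSEQ_imp_Cauchy subspace_add[OF subspace_X])
      qed
      show "smul c y \<in> ?S" if y: "y \<in> ?S" for c y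
      proof -
        obtain l where "(\<lambda>n. G n y) \<longlonglongrightarrow> l" using y Cauchy_convergent convergent_def by blast
        then have "(\<lambda>n. G n (smul c y)) \<longlonglongrightarrow> smul c l"
          using y by (simp add: bounded_op_smul[OF G] tendsto_smul)
        then show ?thesis using y by (simp add: LIMSEQ_imp_Cauchy subspace_scale[OF subspace_X])
      qed
    qed
    have "y \<in> ?S" if y: "y \<in> closure ?S" for y
    proof -
      have yX: "y \<in> X" using y closure_minimal[of ?S X] closed_X by auto
      have "Cauchy (\<lambda>n. G n y)"
      proof (rule CauchyI)
        fix e :: real assume e: "0 < e"
        have "0 < e / (3 * (K + 1))" using e K by simp
        then obtain z where z: "z \<in> ?S" "dist z y < e / (3 * (K + 1))"
          using y unfolding closure_approachable by blast
        have near: "norm (G n y - G n z) < e / 3" for n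
        proof -
          have "norm (G n y - G n z) = norm (G n (y - z))"
            using bounded_op_diff[OF subspace_X G yX] z by simp
          also have "\<dots> \<le> K * norm (y - z)" using z yX by (intro bound subspace_diff[OF subspace_X]) auto
          also have "\<dots> \<le> K * (e / (3 * (K + 1)))"
            using z K by (intro mult_left_mono) (auto simp: dist_norm norm_minus_commute)
          also have "\<dots> < e / 3" using e K by (simp add: field_simps)
          finally show ?thesis .
        qed
        obtain M where M: "\<And>m n. m \<ge> M \<Longrightarrow> n \<ge> M \<Longrightarrow> norm (G m z - G n z) < e / 3"
          using CauchyD[of "\<lambda>n. G n z" "e / 3"] z e by auto
        show "\<exists>M. \<forall>m\<ge>M. \<forall>n\<ge>M. norm (G m y - G n y) < e"
        proof (intro exI allI impI)
          fix m n assume mn: "m \<ge> M" "n \<ge> M"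
          have "norm (G m y - G n y) = norm ((G m y - G m z) + (G m z - G n z) - (G n y - G n z))"
            by (rule arg_cong) simp
          then show "norm (G m y - G n y) < e"
            using near[of m] near[of n] M[OF mn]
              norm_triangle_ineq4[of "(G m y - G m z) + (G m z - G n z)" "G n y - G n z"]
              norm_triangle_ineq[of "G m y - G m z" "G m z - G n z"] by linarith
        qed
      qed
      then show ?thesis using yX by simp
    qed
    then show "closed ?S" using closure_subset_eq by blast
  qed (use tens tens_in_X in auto)
  then have "\<exists>l. (\<lambda>n. G n y) \<longlonglongrightarrow> l" if "y \<in> X" for y
    using that Cauchy_convergent convergent_def by blast
  then obtain L where L: "\<And>y. y \<in> X \<Longrightarrow> (\<lambda>n. G n y) \<longlonglongrightarrow> L y" by metis
  have "bounded_op X L"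
  proof (rule bounded_opI)
    show "L (y + z) = L y + L z" if "y \<in> X" "z \<in> X" for y z
    proof (rule LIMSEQ_unique)
      show "(\<lambda>n. G n (y + z)) \<longlonglongrightarrow> L (y + z)" by (intro L subspace_add[OF subspace_X] that)
      show "(\<lambda>n. G n (y + z)) \<longlonglongrightarrow> L y + L z"
        using tendsto_add[OF L[of y] L[of z]] that by (simp add: bounded_op_add[OF G])
    qed
    show "L (smul c y) = smul c (L y)" if "y \<in> X" for c y
    proof (rule LIMSEQ_unique)
      show "(\<lambda>n. G n (smul c y)) \<longlonglongrightarrow> L (smul c y)" by (intro L subspace_scale[OF subspace_X] that)
      show "(\<lambda>n. G n (smul c y)) \<longlonglongrightarrow> smul c (L y)"
        using tendsto_smul[OF L[of y], of c] that by (simp add: bounded_op_smul[OF G])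
    qed
    show "L y \<in> X" if "y \<in> X" for y
      by (rule closed_sequentially[OF closed_X _ L[OF that]]) (simp add: bounded_op_in[OF G that])
    show "norm (L y) \<le> K * norm y" if "y \<in> X" for y
      by (rule LIMSEQ_le_const2[OF tendsto_norm[OF L[OF that]]]) (use bound that in auto)
  qed
  with L show ?thesis using that by blast
qed

definition along :: "'i set \<Rightarrow> nat set \<Rightarrow> 'i \<Rightarrow> nat set" where
  "along A B = (\<lambda>l. if l \<in> A then B else UNIV)"

lemma proj_along_tens_tendsto:
  assumes x: "x \<in> tuples" and a: "a \<in> I"
  shows "(\<lambda>M. norm (proj (along {a} {M..}) (tens x))) \<longlonglongrightarrow> 0"
proof (rule Lim_null_comparison)
  let ?R = "\<Prod>l\<in>I - {a}. lp_norm (p l) (x l)"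
  have "norm (proj (along {a} {M..}) (tens x)) \<le> lp_norm (p a) (cutoff {M..} (x a)) * ?R" for M
  proof -
    have "norm (proj (along {a} {M..}) (tens x)) \<le> tnorm (restr (along {a} {M..}) x)"
      by (simp add: proj_tens x tens_norm_le restr_in)
    also have "\<dots> = lp_norm (p a) (cutoff {M..} (x a)) * ?R"
      unfolding tnorm_def using a finite_I
      by (subst prod.remove[OF finite_I a]) (auto simp: restr_def along_def intro!: prod.cong)
    finally show ?thesis .
  qed
  then show "\<forall>\<^sub>F M in sequentially. norm (norm (proj (along {a} {M..}) (tens x)))
      \<le> lp_norm (p a) (cutoff {M..} (x a)) * ?R" by simp
  show "(\<lambda>M. lp_norm (p a) (cutoff {M..} (x a)) * ?R) \<longlonglongrightarrow> 0"
    using tendsto_mult_right[OF lp_tail_tendsto[OF tuplesD[OF x a] p_pos[OF a]], of ?R] by simp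
qed

lemma proj_along_split:
  assumes "y \<in> X" "a \<in> I"
  shows "y = proj (along {a} B) y + proj (along {a} (- B)) y"
proof -
  have "along {a} C = (\<lambda>_. UNIV)(a := C)" for C by (auto simp: along_def)
  moreover have "(\<lambda>_. UNIV)(a := B \<union> - B) = (\<lambda>_. UNIV)" by auto
  ultimately show ?thesis
    using proj_Un[OF assms, of B "- B" "\<lambda>_. UNIV"] by (simp add: proj_UNIV assms(1))
qed

text \<open>The contractions have a strong limit by \<open>strong_limit\<close>; it agrees with the
  identity on elementary tensors, whose tails vanish, and therefore everywhere.\<close>

lemma proj_along_tendsto_single:
  assumes a: "a \<in> I" and y: "y \<in> X"
  shows "(\<lambda>M. proj (along {a} {..<M}) y) \<longlonglongrightarrow> y"
proof -
  let ?G = "\<lambda>M. proj (along {a} {..<M})"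
  have t: "(\<lambda>M. ?G M (tens x)) \<longlonglongrightarrow> tens x" if x: "x \<in> tuples" for x
  proof -
    have "- {..<M} = {M..}" for M :: nat by auto
    then have "?G M (tens x) = tens x - proj (along {a} {M..}) (tens x)" for M
      using proj_along_split[OF tens_in_X[OF x] a, of "{..<M}"] by (simp add: algebra_simps)
    moreover have "(\<lambda>M. tens x - proj (along {a} {M..}) (tens x)) \<longlonglongrightarrow> tens x - 0"
      by (intro tendsto_diff tendsto_const tendsto_norm_zero_cancel[OF proj_along_tens_tendsto[OF x a]])
    ultimately show ?thesis by simp
  qed
  obtain L where L: "bounded_op X L" "\<And>y. y \<in> X \<Longrightarrow> (\<lambda>M. ?G M y) \<longlonglongrightarrow> L y"
    by (rule strong_limit[of ?G 1]) (use t in \<open>auto simp: proj_op proj_norm_le intro: LIMSEQ_imp_Cauchy\<close>)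
  have "L y = y"
  proof (rule bounded_op_eqI[OF L(1) bounded_op_id _ y])
    show "L (tens x) = tens x" if x: "x \<in> tuples" for x
      using LIMSEQ_unique[OF L(2)[OF tens_in_X[OF x]] t[OF x]] .
  qed
  then show ?thesis using L(2)[OF y] by simp
qed

lemma proj_along_insert: "y \<in> X \<Longrightarrow> proj (along (insert a A) B) y = proj (along A B) (proj (along {a} B) y)"
  unfolding proj_proj by (rule proj_cong) (auto simp: along_def)

lemma proj_along_tendsto:
  assumes "A \<subseteq> I" and y: "y \<in> X"
  shows "(\<lambda>M. proj (along A {..<M}) y) \<longlonglongrightarrow> y"
proof -
  have "finite A" using assms(1) finite_I by (rule finite_subset)
  then show ?thesis using assms(1)
  proof (induction A)
    case empty
    then show ?case by (simp add: along_def proj_UNIV y)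
  next
    case (insert a A)
    have a: "a \<in> I" using insert by simp
    let ?P = "\<lambda>M. proj (along A {..<M})"
    let ?z = "\<lambda>M. proj (along {a} {..<M}) y - y"
    have "(\<lambda>M. norm (?z M)) \<longlonglongrightarrow> 0"
      using tendsto_diff[OF proj_along_tendsto_single[OF a y] tendsto_const[of y]]
      by (intro tendsto_norm_zero) simp
    \<comment> \<open>The projections \<open>?P M\<close> change with M, but they are contractions
      and keep null sequences null.\<close>
    then have "(\<lambda>M. ?P M (?z M)) \<longlonglongrightarrow> 0"
      by (rule Lim_null_comparison[rotated])
         (simp add: proj_norm_le subspace_diff[OF subspace_X] proj_in y)
    then have "(\<lambda>M. ?P M (?z M) + ?P M y) \<longlonglongrightarrow> 0 + y"
      using insert by (intro tendsto_add) auto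
    then show ?case
      by (simp add: proj_along_insert[OF y, of a A] y bounded_op_diff[OF subspace_X proj_op] proj_in)
  qed
qed

end

section \<open>The triangular projection\<close>

locale triangular = lp_tensor smul I p X J
  for smul :: "'k::real_normed_field \<Rightarrow> 'x::banach \<Rightarrow> 'x" and I :: "'i set" and p X J +
  fixes i j :: 'i
  assumes i: "i \<in> I" and j: "j \<in> I" and ij: "i \<noteq> j" and exponents: "1 < 1 / p i + 1 / p j"
begin

definition rect :: "nat set \<Rightarrow> nat set \<Rightarrow> 'x \<Rightarrow> 'x" where
  "rect B C = proj ((\<lambda>_. UNIV)(i := B, j := C))"

text \<open>With i as row index and j as column index, this keeps the entries on and above the
  diagonal of the square over \<open>{a..<b}\<close>, one column at a time.\<close>

definition tri :: "nat \<Rightarrow> nat \<Rightarrow> 'x \<Rightarrow> 'x" where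
  "tri a b y = (\<Sum>n\<in>{a..<b}. rect {a..n} {n} y)"

lemma rect_op: "bounded_op X (rect B C)"
  by (simp add: rect_def proj_op)

lemma rect_in: "y \<in> X \<Longrightarrow> rect B C y \<in> X"
  by (simp add: rect_def proj_in)

lemma rect_rect: "y \<in> X \<Longrightarrow> rect B C (rect B' C' y) = rect (B \<inter> B') (C \<inter> C') y"
  unfolding rect_def proj_proj by (rule proj_cong) auto

lemma rect_proj_commute: "y \<in> X \<Longrightarrow> rect B C (proj S y) = proj S (rect B C y)"
  unfolding rect_def proj_proj by (rule proj_cong) auto

lemma rect_Un2: "y \<in> X \<Longrightarrow> C \<inter> D = {} \<Longrightarrow> rect B (C \<union> D) y = rect B C y + rect B D y"
  unfolding rect_def by (rule proj_Un[OF _ j])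

lemma rect_Un1: "y \<in> X \<Longrightarrow> C \<inter> D = {} \<Longrightarrow> rect (C \<union> D) B y = rect C B y + rect D B y"
  unfolding rect_def fun_upd_twist[OF ij] by (rule proj_Un[OF _ i])

lemma rect_empty1: "y \<in> X \<Longrightarrow> rect {} C y = 0"
  unfolding rect_def by (rule proj_empty[OF _ i]) (use ij in auto)

lemma rect_empty2: "y \<in> X \<Longrightarrow> rect B {} y = 0"
  unfolding rect_def by (rule proj_empty[OF _ j]) auto

lemma rect_sum: "y \<in> X \<Longrightarrow> a \<le> b \<Longrightarrow> (\<Sum>n\<in>{a..<b}. rect B {n} y) = rect B {a..<b} y"
proof (induction b)
  case (Suc b)
  show ?case
  proof (cases "a \<le> b")
    case True
    then have "{a..<Suc b} = {a..<b} \<union> {b}" by auto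
    then show ?thesis using Suc True rect_Un2[of y "{a..<b}" "{b}" B] by (simp add: add.commute)
  qed (use Suc in \<open>simp add: rect_empty2\<close>)
qed (simp add: rect_empty2)

text \<open>Row m and column m go to the rectangle, so neither smaller triangle contains the index
  m. This lets both triangles carry at most half of the mass when m is a median.\<close>

lemma tri_split:
  assumes y: "y \<in> X" and m: "a \<le> m" "m < b"
  shows "tri a b y = tri a m y + tri (Suc m) b y + rect {a..m} {m..<b} y"
proof -
  have "tri a b y = tri a m y + (\<Sum>n\<in>{m..<b}. rect {a..n} {n} y)"
    unfolding tri_def using m by (subst sum.atLeastLessThan_concat) auto
  also have "(\<Sum>n\<in>{m..<b}. rect {a..n} {n} y) = (\<Sum>n\<in>{m..<b}. rect {a..m} {n} y + rect {Suc m..n} {n} y)"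
  proof (rule sum.cong)
    fix n assume n: "n \<in> {m..<b}"
    then have "{a..n} = {a..m} \<union> {Suc m..n}" using m by auto
    then show "rect {a..n} {n} y = rect {a..m} {n} y + rect {Suc m..n} {n} y"
      by (simp only:) (rule rect_Un1[OF y], auto)
  qed simp
  also have "\<dots> = rect {a..m} {m..<b} y + (\<Sum>n\<in>{m..<b}. rect {Suc m..n} {n} y)"
    using m by (simp add: sum.distrib rect_sum y)
  \<comment> \<open>The term with \<open>n = m\<close> vanishes, since its set of rows is
    empty.\<close>
  also have "(\<Sum>n\<in>{m..<b}. rect {Suc m..n} {n} y) = tri (Suc m) b y"
    unfolding tri_def using m by (simp add: sum.atLeast_Suc_lessThan rect_empty1 y)
  finally show ?thesis by (simp add: algebra_simps)
qed

definition rest :: "('i \<Rightarrow> nat \<Rightarrow> 'k) \<Rightarrow> real" where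
  "rest x = (\<Prod>l\<in>I - {i, j}. lp_norm (p l) (x l))"

lemma rest_nonneg: "0 \<le> rest x"
  by (simp add: rest_def prod_nonneg lp_norm_nonneg)

lemma rect_tens_le:
  assumes x: "x \<in> tuples"
  shows "norm (rect B C (tens x)) \<le>
    lp_norm (p i) (cutoff B (x i)) * lp_norm (p j) (cutoff C (x j)) * rest x"
proof -
  let ?S = "(\<lambda>_. UNIV)(i := B, j := C)"
  have "norm (rect B C (tens x)) \<le> tnorm (restr ?S x)"
    by (simp add: rect_def proj_tens x tens_norm_le restr_in)
  also have "\<dots> = lp_norm (p i) (cutoff B (x i)) * (lp_norm (p j) (cutoff C (x j)) *
      (\<Prod>l\<in>I - {i} - {j}. lp_norm (p l) (restr ?S x l)))"
    unfolding tnorm_def using i j ij finite_I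
    by (simp add: prod.remove[OF finite_I i] prod.remove[of "I - {i}" j] restr_def)
  also have "(\<Prod>l\<in>I - {i} - {j}. lp_norm (p l) (restr ?S x l)) = rest x"
    unfolding rest_def by (rule prod.cong) (auto simp: restr_def)
  finally show ?thesis by (simp add: mult.assoc)
qed

definition \<sigma> :: real where "\<sigma> = 1 / p i + 1 / p j"

text \<open>The fixed point of the recursion \<open>C = 2 * C * (1 / 2) powr \<sigma> + 1\<close>
  that bisection produces, that is, the sum of the geometric series with ratio
  \<open>2 powr (1 - \<sigma>)\<close>. The ratio is below 1 because \<sigma> exceeds 1.\<close>

definition tri_const :: real where "tri_const = 1 / (1 - 2 powr (1 - \<sigma>))"

lemma tri_const: "0 < tri_const" "2 * tri_const * (1 / 2) powr \<sigma> + 1 = tri_const"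
proof -
  have \<sigma>: "1 < \<sigma>" using exponents by (simp add: \<sigma>_def)
  then have *: "2 powr (1 - \<sigma>) < 1" by (simp add: powr_less_one)
  then show "0 < tri_const" by (simp add: tri_const_def)
  have "2 * (1 / 2 :: real) powr \<sigma> = 2 powr (1 - \<sigma>)"
    by (simp add: powr_diff powr_divide)
  then have "2 * tri_const * (1 / 2) powr \<sigma> = tri_const * 2 powr (1 - \<sigma>)" by simp
  also have "\<dots> + 1 = tri_const"
  proof -
    define d :: real where "d = 2 powr (1 - \<sigma>)"
    have "1 - d \<noteq> 0" using * unfolding d_def by linarith
    then show ?thesis unfolding tri_const_def d_def[symmetric] by (simp add: divide_simps)
  qed
  finally show "2 * tri_const * (1 / 2) powr \<sigma> + 1 = tri_const" .
qed

text \<open>Powers of the norms, unlike the norms, add over disjoint sets and can be bisected.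
  Adding both coordinates lets one cut serve rows and columns at once.\<close>

definition mass :: "('i \<Rightarrow> nat \<Rightarrow> 'k) \<Rightarrow> nat set \<Rightarrow> real" where
  "mass x B = lp_sum (p i) (cutoff B (x i)) + lp_sum (p j) (cutoff B (x j))"

lemma mass_Un: "x \<in> tuples \<Longrightarrow> B \<inter> C = {} \<Longrightarrow> mass x (B \<union> C) = mass x B + mass x C"
  by (simp add: mass_def lp_sum_cutoff_Un tuplesD i j)

lemma mass_nonneg: "x \<in> tuples \<Longrightarrow> 0 \<le> mass x B"
  by (simp add: mass_def lp_sum_nonneg lp_space_cutoff tuplesD i j)

lemma mass_empty: "mass x {} = 0"
  by (simp add: mass_def)

text \<open>Bisect the total mass: the two triangles on either side of the median carry at most half of the
  mass each, and by homogeneity of degree \<open>\<sigma> > 1\<close> they contribute a geometric series.\<close>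

lemma tri_tens_le:
  assumes x: "x \<in> tuples" and "a \<le> b"
  shows "norm (tri a b (tens x)) \<le> tri_const * mass x {a..<b} powr \<sigma> * rest x"
  using assms(2)
proof (induction "b - a" arbitrary: a b rule: less_induct)
  case less
  show ?case
  proof (cases "a = b")
    case True
    then show ?thesis by (simp add: tri_def mass_empty)
  next
    case False
    then have ab: "a < b" using less.prems by simp
    let ?\<mu> = "mass x {a..<b}"
    let ?Q = "{n \<in> {a..<b}. mass x {a..<n} \<le> ?\<mu> / 2}"
    \<comment> \<open>The median: at most half of the mass lies strictly before m and, by
      maximality, at most half strictly after it. The mass at m itself may be large, and it is left
      to the rectangle.\<close>
    define m where "m = Max ?Q"
    have "a \<in> ?Q" using ab mass_nonneg[OF x] by (simp add: mass_empty)
    then have "m \<in> ?Q" unfolding m_def by (intro Max_in) auto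
    then have m: "a \<le> m" "m < b" "mass x {a..<m} \<le> ?\<mu> / 2" by auto
    have right: "mass x {Suc m..<b} \<le> ?\<mu> / 2"
    proof (cases "Suc m = b")
      case True
      then show ?thesis using mass_nonneg[OF x] by (simp add: mass_empty)
    next
      case False
      then have "Suc m \<in> {a..<b}" using m by auto
      moreover have "Suc m \<notin> ?Q"
      proof
        assume "Suc m \<in> ?Q"
        then have "Suc m \<le> m" unfolding m_def by (intro Max_ge) auto
        then show False by simp
      qed
      ultimately have "?\<mu> / 2 < mass x {a..<Suc m}" by simp
      moreover have "{a..<b} = {a..<Suc m} \<union> {Suc m..<b}" using m by auto
      then have "?\<mu> = mass x {a..<Suc m} + mass x {Suc m..<b}"
        by (simp only:) (rule mass_Un[OF x], auto)
      ultimately show ?thesis by simp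
    qed
    have \<sigma>: "0 < \<sigma>" using exponents by (simp add: \<sigma>_def)
    have half: "norm (tri c d (tens x)) \<le> tri_const * ((1 / 2) powr \<sigma> * ?\<mu> powr \<sigma>) * rest x"
      if "c \<le> d" "d - c < b - a" "mass x {c..<d} \<le> ?\<mu> / 2" for c d
    proof -
      have "norm (tri c d (tens x)) \<le> tri_const * mass x {c..<d} powr \<sigma> * rest x"
        by (rule less.hyps[OF that(2,1)])
      also have "\<dots> \<le> tri_const * (1 / 2 * ?\<mu>) powr \<sigma> * rest x"
        using that(3) \<sigma> tri_const(1) mass_nonneg[OF x]
        by (intro mult_right_mono mult_left_mono powr_mono2 rest_nonneg) auto
      finally show ?thesis by (simp only: powr_mult)
    qed
    have side: "lp_norm (p k) (cutoff B (x k)) \<le> ?\<mu> powr (1 / p k)"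
      if "k = i \<or> k = j" "B \<subseteq> {a..<b}" for B k
    proof -
      have k: "k \<in> I" using that i j by auto
      have "lp_sum (p k) (cutoff B (x k)) \<le> lp_sum (p k) (cutoff {a..<b} (x k))"
        by (rule lp_sum_cutoff_mono[OF tuplesD[OF x k] that(2)])
      also have "\<dots> \<le> ?\<mu>"
        using that(1) by (auto simp: mass_def lp_sum_nonneg lp_space_cutoff tuplesD x i j)
      finally show ?thesis
        unfolding lp_norm_eq using p_pos[OF k]
        by (intro powr_mono2 lp_sum_nonneg lp_space_cutoff tuplesD[OF x k]) auto
    qed
    have "norm (rect {a..m} {m..<b} (tens x)) \<le>
        lp_norm (p i) (cutoff {a..m} (x i)) * lp_norm (p j) (cutoff {m..<b} (x j)) * rest x"
      by (rule rect_tens_le[OF x])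
    also have "\<dots> \<le> ?\<mu> powr (1 / p i) * ?\<mu> powr (1 / p j) * rest x"
      using m by (intro mult_mono side rest_nonneg mult_nonneg_nonneg lp_norm_nonneg) auto
    also have "\<dots> = ?\<mu> powr \<sigma> * rest x" by (simp add: \<sigma>_def powr_add)
    finally have corner: "norm (rect {a..m} {m..<b} (tens x)) \<le> ?\<mu> powr \<sigma> * rest x" .
    have "norm (tri a b (tens x)) \<le>
        norm (tri a m (tens x)) + norm (tri (Suc m) b (tens x)) + norm (rect {a..m} {m..<b} (tens x))"
      unfolding tri_split[OF tens_in_X[OF x] m(1,2)]
      by (rule order_trans[OF norm_triangle_ineq add_right_mono[OF norm_triangle_ineq]])
    also have "\<dots> \<le> tri_const * ((1 / 2) powr \<sigma> * ?\<mu> powr \<sigma>) * rest x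
        + tri_const * ((1 / 2) powr \<sigma> * ?\<mu> powr \<sigma>) * rest x + ?\<mu> powr \<sigma> * rest x"
      using m right corner by (intro add_mono half) auto
    also have "\<dots> = (2 * tri_const * (1 / 2) powr \<sigma> + 1) * (?\<mu> powr \<sigma> * rest x)"
      by (simp add: algebra_simps)
    finally show ?thesis unfolding tri_const(2) by (simp add: mult.assoc)
  qed
qed

section \<open>The limit of the finite triangular truncations\<close>

lemma tri_op: "bounded_op X (tri a b)"
  unfolding tri_def by (intro bounded_op_sum_op subspace_X rect_op)

text \<open>The factor \<open>2 powr \<sigma>\<close> arises because a normalised tuple has mass at
  most 1 in each of the coordinates i and j. The bound is uniform in M, as
  \<open>strong_limit\<close> requires.\<close>

lemma tri_norm_le:
  assumes "y \<in> X" shows "norm (tri 0 M y) \<le> (tri_const * 2 powr \<sigma>) * norm y"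
proof (rule bounded_op_norm_le[OF tri_op _ _ assms])
  show "0 \<le> tri_const * 2 powr \<sigma>" using tri_const(1) by simp
  fix x assume x: "x \<in> tuples" "\<And>l. l \<in> I \<Longrightarrow> lp_norm (p l) (x l) \<le> 1"
  have le1: "lp_sum (p l) (cutoff {0..<M} (x l)) \<le> 1" if l: "l \<in> I" for l
  proof -
    have "lp_sum (p l) (cutoff {0..<M} (x l)) \<le> lp_sum (p l) (x l)"
      using lp_sum_cutoff_mono[OF tuplesD[OF x(1) l], of "{0..<M}" UNIV] by simp
    also have "\<dots> = lp_norm (p l) (x l) powr p l"
      by (simp add: lp_norm_powr p_pos l tuplesD x(1))
    also have "\<dots> \<le> 1"
      using powr_mono2[of "p l" "lp_norm (p l) (x l)" 1] x(2)[OF l] p_pos[OF l] by (simp add: lp_norm_nonneg)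
    finally show ?thesis .
  qed
  have "rest x \<le> 1" unfolding rest_def by (rule prod_le_1) (auto simp: lp_norm_nonneg x)
  moreover have "mass x {0..<M} powr \<sigma> \<le> 2 powr \<sigma>"
    using le1[OF i] le1[OF j] mass_nonneg[OF x(1), of "{0..<M}"] exponents
    by (intro powr_mono2) (auto simp: mass_def \<sigma>_def)
  ultimately have "tri_const * mass x {0..<M} powr \<sigma> * rest x \<le> tri_const * 2 powr \<sigma> * 1"
    using tri_const(1) by (intro mult_mono rest_nonneg mult_left_mono) auto
  then show "norm (tri 0 M (tens x)) \<le> tri_const * 2 powr \<sigma>"
    using tri_tens_le[OF x(1), of 0 M] by simp
qed

lemma tri_tri_min: "y \<in> X \<Longrightarrow> tri 0 M (tri 0 M' y) = tri 0 (min M M') y"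
proof -
  assume y: "y \<in> X"
  have "tri 0 M (tri 0 M' y) = (\<Sum>n\<in>{0..<M}. \<Sum>n'\<in>{0..<M'}. rect {0..n} {n} (rect {0..n'} {n'} y))"
    unfolding tri_def by (intro sum.cong refl bounded_op_sum[OF subspace_X rect_op] rect_in y)
  also have "\<dots> = (\<Sum>n\<in>{0..<M}. \<Sum>n'\<in>{0..<M'}. if n = n' then rect {0..n} {n} y else 0)"
    by (intro sum.cong refl) (simp add: rect_rect y rect_empty2)
  also have "\<dots> = (\<Sum>n\<in>{0..<M}. if n < M' then rect {0..n} {n} y else 0)"
    by (simp add: sum.delta')
  also have "\<dots> = (\<Sum>n\<in>{0..<M} \<inter> {n. n < M'}. rect {0..n} {n} y)"
    by (simp add: sum.If_cases)
  also have "{0..<M} \<inter> {n. n < M'} = {0..<min M M'}" by auto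
  finally show ?thesis by (simp add: tri_def)
qed

text \<open>The longer truncation only adds columns from M on. Together with the uniform bound and
  the vanishing tails along j, this yields the Cauchy property on elementary tensors.\<close>

lemma tri_tail:
  assumes y: "y \<in> X" and M: "M \<le> M'"
  shows "tri 0 M' y - tri 0 M y = tri 0 M' (proj (along {j} {M..}) y)"
proof -
  have r: "rect B {n} (proj (along {j} {M..}) y) = (if M \<le> n then rect B {n} y else 0)" for B n
  proof -
    have "proj (along {j} {M..}) y = rect UNIV {M..} y"
      unfolding rect_def by (rule proj_cong) (auto simp: along_def y)
    then show ?thesis by (simp add: rect_rect y rect_empty2)
  qed
  have "tri 0 M' y = tri 0 M y + (\<Sum>n\<in>{M..<M'}. rect {0..n} {n} y)"
    unfolding tri_def using M by (subst sum.atLeastLessThan_concat) auto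
  moreover have "tri 0 M' (proj (along {j} {M..}) y) = (\<Sum>n\<in>{0..<M'} \<inter> {n. M \<le> n}. rect {0..n} {n} y)"
    unfolding tri_def r by (simp add: sum.If_cases)
  moreover have "{0..<M'} \<inter> {n. M \<le> n} = {M..<M'}" by auto
  ultimately show ?thesis by simp
qed

lemma tri_limit_exists:
  "\<exists>U. bounded_op X U \<and> (\<forall>y\<in>X. (\<lambda>M. tri 0 M y) \<longlonglongrightarrow> U y)"
proof -
  let ?K = "tri_const * 2 powr \<sigma>"
  have K: "0 < ?K" using tri_const(1) by simp
  have C: "Cauchy (\<lambda>M. tri 0 M (tens x))" if x: "x \<in> tuples" for x
  proof (rule metric_CauchyI)
    fix e :: real assume "0 < e"
    then have "0 < e / ?K" using K by simp
    then obtain M0 where M0: "\<And>M. M \<ge> M0 \<Longrightarrow> norm (proj (along {j} {M..}) (tens x)) < e / ?K"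
      using LIMSEQ_D[OF proj_along_tens_tendsto[OF x j]] by fastforce
    have le: "dist (tri 0 M' (tens x)) (tri 0 M (tens x)) < e" if "M \<ge> M0" "M \<le> M'" for M M'
    proof -
      have "dist (tri 0 M' (tens x)) (tri 0 M (tens x)) \<le> ?K * norm (proj (along {j} {M..}) (tens x))"
        by (simp only: dist_norm tri_tail[OF tens_in_X[OF x] that(2)])
           (rule tri_norm_le[OF proj_in[OF tens_in_X[OF x]]])
      also have "\<dots> < ?K * (e / ?K)" using M0[OF that(1)] K by (intro mult_strict_left_mono)
      also have "\<dots> = e" using less_imp_neq[OF K] by simp
      finally show ?thesis .
    qed
    show "\<exists>N. \<forall>m\<ge>N. \<forall>n\<ge>N. dist (tri 0 m (tens x)) (tri 0 n (tens x)) < e"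
    proof (intro exI allI impI)
      fix m n assume "M0 \<le> m" "M0 \<le> n"
      then show "dist (tri 0 m (tens x)) (tri 0 n (tens x)) < e"
        using le[of n m] le[of m n] by (cases "m \<le> n") (auto simp: dist_commute)
    qed
  qed
  obtain L where "bounded_op X L" "\<And>y. y \<in> X \<Longrightarrow> (\<lambda>M. tri 0 M y) \<longlonglongrightarrow> L y"
    using strong_limit[of "tri 0" ?K] tri_op tri_norm_le C K by (metis less_imp_le)
  then show ?thesis by blast
qed

definition upper :: "'x \<Rightarrow> 'x" where
  "upper = (SOME U. bounded_op X U \<and> (\<forall>y\<in>X. (\<lambda>M. tri 0 M y) \<longlonglongrightarrow> U y))"

lemma upper_op: "bounded_op X upper"
  and tri_tendsto_upper: "y \<in> X \<Longrightarrow> (\<lambda>M. tri 0 M y) \<longlonglongrightarrow> upper y"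
  using someI_ex[OF tri_limit_exists] by (auto simp: upper_def)

lemma upper_in: "y \<in> X \<Longrightarrow> upper y \<in> X"
  by (rule bounded_op_in[OF upper_op])

lemma upper_eqI: "y \<in> X \<Longrightarrow> (\<And>M. M \<ge> M0 \<Longrightarrow> tri 0 M y = z) \<Longrightarrow> upper y = z"
  by (rule LIMSEQ_unique[OF tri_tendsto_upper tendsto_eventually])
     (auto simp: eventually_sequentially)

lemma upper_idem:
  assumes y: "y \<in> X" shows "upper (upper y) = upper y"
proof -
  have "upper (tri 0 M y) = tri 0 M y" for M
    by (rule upper_eqI[of _ M]) (simp_all add: bounded_op_in[OF tri_op] y tri_tri_min min_absorb2)
  moreover have "(\<lambda>M. upper (tri 0 M y)) \<longlonglongrightarrow> upper (upper y)"
    by (rule bounded_op_tendsto[OF subspace_X upper_op bounded_op_in[OF tri_op y] upper_in[OF y]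
          tri_tendsto_upper[OF y]])
  ultimately have "(\<lambda>M. tri 0 M y) \<longlonglongrightarrow> upper (upper y)" by (simp only:)
  then show ?thesis using tri_tendsto_upper[OF y] by (rule LIMSEQ_unique)
qed

lemma upper_proj_commute:
  assumes y: "y \<in> X" shows "upper (proj S y) = proj S (upper y)"
proof -
  have "tri 0 M (proj S y) = proj S (tri 0 M y)" for M
    unfolding tri_def using y
    by (subst bounded_op_sum[OF subspace_X proj_op]) (auto simp: rect_in rect_proj_commute)
  moreover have "(\<lambda>M. proj S (tri 0 M y)) \<longlonglongrightarrow> proj S (upper y)"
    by (rule bounded_op_tendsto[OF subspace_X proj_op bounded_op_in[OF tri_op y] upper_in[OF y]
          tri_tendsto_upper[OF y]])
  ultimately have "(\<lambda>M. tri 0 M (proj S y)) \<longlonglongrightarrow> proj S (upper y)" by (simp only:)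
  with tri_tendsto_upper[OF proj_in[OF y]] show ?thesis by (rule LIMSEQ_unique)
qed

text \<open>Only the summand \<open>n = m\<close> of a truncation meets column m, and it stops at
  row m. Elements of the range are fixed by \<open>upper\<close>, so their columns are
  finite.\<close>

lemma upper_column:
  assumes y: "y \<in> X"
  shows "upper (proj (along {j} {m}) y) = proj (along {i} {..m}) (proj (along {j} {m}) y)"
proof (rule upper_eqI[of _ "Suc m"])
  have a: "proj (along {j} {m}) y = rect UNIV {m} y"
    unfolding rect_def by (rule proj_cong) (auto simp: along_def y)
  have "proj (along {i} {..m}) (rect UNIV {m} y) = rect {..m} {m} y"
    unfolding rect_def proj_proj[OF y]
    by (rule proj_cong) (use ij y in \<open>auto simp: along_def\<close>)
  then show "tri 0 M (proj (along {j} {m}) y) = proj (along {i} {..m}) (proj (along {j} {m}) y)"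
    if "M \<ge> Suc m" for M
  proof -
    have "tri 0 M (rect UNIV {m} y) = (\<Sum>n\<in>{0..<M}. if n = m then rect {0..n} {n} y else 0)"
      unfolding tri_def by (intro sum.cong refl) (auto simp: rect_rect y rect_empty2)
    also have "\<dots> = rect {..m} {m} y" using that by (simp add: sum.delta atLeast0AtMost)
    finally show ?thesis using \<open>proj (along {i} {..m}) (rect UNIV {m} y) = rect {..m} {m} y\<close> a by simp
  qed
qed (simp add: proj_in y)

text \<open>A row retains its entries from the diagonal on, so in the kernel only those before the
  diagonal survive. The truncations of a row need not become constant; their limit comes from
  convergence along j.\<close>

lemma upper_row:
  assumes y: "y \<in> X"
  shows "upper (proj (along {i} {m}) y) = proj (along {j} {m..}) (proj (along {i} {m}) y)"
proof -
  let ?z = "proj (along {i} {m}) y"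
  have z: "?z \<in> X" by (rule proj_in[OF y])
  have zr: "?z = rect {m} UNIV y"
    unfolding rect_def by (rule proj_cong) (use ij y in \<open>auto simp: along_def\<close>)
  have "tri 0 M ?z = proj (along {j} {m..}) (proj (along {j} {..<M}) ?z)" for M
  proof -
    have "tri 0 M ?z = (\<Sum>n\<in>{0..<M}. if m \<le> n then rect {m} {n} y else 0)"
      unfolding tri_def zr by (intro sum.cong refl) (auto simp: rect_rect y rect_empty1)
    also have "\<dots> = (\<Sum>n\<in>{0..<M} \<inter> {n. m \<le> n}. rect {m} {n} y)" by (simp add: sum.If_cases)
    also have "{0..<M} \<inter> {n. m \<le> n} = {m..<M}" by auto
    also have "(\<Sum>n\<in>{m..<M}. rect {m} {n} y) = rect {m} {m..<M} y"
      by (cases "m \<le> M") (simp_all add: rect_sum y rect_empty2)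
    also have "\<dots> = proj (along {j} {m..}) (proj (along {j} {..<M}) ?z)"
      unfolding zr rect_def
      by (simp add: proj_proj y proj_in) (rule proj_cong, use ij in \<open>auto simp: along_def y\<close>)
    finally show ?thesis .
  qed
  moreover have "(\<lambda>M. proj (along {j} {m..}) (proj (along {j} {..<M}) ?z)) \<longlonglongrightarrow> proj (along {j} {m..}) ?z"
    by (rule bounded_op_tendsto[OF subspace_X proj_op proj_in[OF z] z proj_along_tendsto_single[OF j z]])
  ultimately have "(\<lambda>M. tri 0 M ?z) \<longlonglongrightarrow> proj (along {j} {m..}) ?z" by (simp only:)
  with tri_tendsto_upper[OF z] show ?thesis by (rule LIMSEQ_unique)
qed

end

section \<open>Block diagonal sequences\<close>

context lp_tensor
begin

section \<open>Sign flips and contractive block diagonal parts\<close>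

lemma proj_along_along: "y \<in> X \<Longrightarrow> proj (along A B) (proj (along A C) y) = proj (along A (B \<inter> C)) y"
  unfolding proj_proj by (rule proj_cong) (auto simp: along_def)

lemma proj_along_empty: "y \<in> X \<Longrightarrow> A \<subseteq> I \<Longrightarrow> A \<noteq> {} \<Longrightarrow> proj (along A {}) y = 0"
  by (metis proj_empty along_def ex_in_conv subsetD)

text \<open>On an elementary tensor, changing the sign of the entries outside B is an isometry of
  the single factor a.\<close>

lemma flip_norm_le:
  assumes a: "a \<in> I" and y: "y \<in> X"
  shows "norm (proj (along {a} B) y - proj (along {a} (- B)) y) \<le> norm y"
proof -
  let ?F = "\<lambda>y. proj (along {a} B) y - proj (along {a} (- B)) y"
  have "norm (?F y) \<le> 1 * norm y"
  proof (rule bounded_op_norm_le[OF bounded_op_minus_op[OF subspace_X proj_op proj_op] _ _ y])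
    fix x assume x: "x \<in> tuples" "\<And>l. l \<in> I \<Longrightarrow> lp_norm (p l) (x l) \<le> 1"
    define v where "v = (\<lambda>n. cutoff B (x a) n + (- 1) * cutoff (- B) (x a) n)"
    have cut: "cutoff C (x a) \<in> E a" for C by (rule lp_space_cutoff[OF tuplesD[OF x(1) a]])
    have "lp_norm (p a) v = lp_norm (p a) (x a)"
      unfolding lp_norm_def v_def by (rule arg_cong[where f = "\<lambda>f. suminf f powr (1 / p a)"])
        (auto simp: cutoff_def)
    then have v: "lp_norm (p a) v \<le> 1" using x(2)[OF a] by simp
    have vE: "v \<in> E a" unfolding v_def by (intro lp_space_add lp_space_scale cut p_pos a)
    have r: "restr (along {a} C) x = x(a := cutoff C (x a))" for C
      using x(1) a by (auto simp: restr_def along_def fun_eq_iff PiE_def extensional_def)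
    have "?F (tens x) = tens (x(a := v))"
      unfolding v_def tens_add[OF x(1) a cut lp_space_scale[OF cut]] tens_scale[OF x(1) a cut]
      by (simp add: proj_tens x(1) r smul_minus_1)
    also have "norm \<dots> \<le> tnorm (x(a := v))"
      by (rule tens_norm_le[OF tuples_upd[OF x(1) a vE]])
    also have "\<dots> \<le> 1" unfolding tnorm_def using v x(2) by (intro prod_le_1) (auto simp: lp_norm_nonneg)
    finally show "norm (?F (tens x)) \<le> 1" .
  qed simp
  then show ?thesis by simp
qed

text \<open>The average of the identity and the composed sign flips in a and b: parts with both
  coordinates in B, or both outside B, keep their sign, and the mixed parts cancel.\<close>

lemma pair_diagonal_norm_le:
  assumes ab: "a \<in> I" "b \<in> I" and y: "y \<in> X"
  shows "norm (proj (along {a, b} B) y + proj (along {a, b} (- B)) y) \<le> norm y"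
proof -
  define P where "P c = proj (along {c} B)" for c
  define Q where "Q c = proj (along {c} (- B))" for c
  let ?F = "\<lambda>c y. P c y - Q c y"
  have in_X: "P c z \<in> X" "Q c z \<in> X" if "z \<in> X" for c z using that by (auto simp: P_def Q_def proj_in)
  have op: "bounded_op X (P c)" "bounded_op X (Q c)" for c by (auto simp: P_def Q_def proj_op)
  have split: "z = P c z + Q c z" if "z \<in> X" "c \<in> I" for z c
    unfolding P_def Q_def by (rule proj_along_split[OF that])
  have F: "norm (?F c z) \<le> norm z" if "z \<in> X" "c \<in> I" for z c
    unfolding P_def Q_def by (rule flip_norm_le[OF that(2,1)])
  define w s t q where "w = P a (P b y)" "s = P a (Q b y)" "t = Q a (P b y)" "q = Q a (Q b y)"
  have "P b y = w + t" "Q b y = s + q"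
    unfolding w_s_t_q_def using split[OF in_X(1)[OF y] ab(1)] split[OF in_X(2)[OF y] ab(1)] by blast+
  then have "y = w + t + (s + q)" using split[OF y ab(2)] by simp
  moreover have "?F a (?F b y) = w - s - (t - q)"
    unfolding w_s_t_q_def
    using bounded_op_diff[OF subspace_X op(1) in_X[OF y], of a b b]
      bounded_op_diff[OF subspace_X op(2) in_X[OF y], of a b b] by simp
  ultimately have "y + ?F a (?F b y) = w + t + (s + q) + (w - s - (t - q))" by (rule arg_cong2)
  also have "\<dots> = 2 *\<^sub>R (w + q)" by (simp add: scaleR_2)
  finally have "(1 / 2) *\<^sub>R (y + ?F a (?F b y)) = P a (P b y) + Q a (Q b y)"
    by (simp add: w_s_t_q_def)
  also have "P a (P b y) = proj (along {a, b} B) y"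
    unfolding P_def proj_proj[OF y] by (rule proj_cong[OF _ y]) (auto simp: along_def)
  also have "Q a (Q b y) = proj (along {a, b} (- B)) y"
    unfolding Q_def proj_proj[OF y] by (rule proj_cong[OF _ y]) (auto simp: along_def)
  finally have "norm (proj (along {a, b} B) y + proj (along {a, b} (- B)) y) =
      norm ((1 / 2) *\<^sub>R (y + ?F a (?F b y)))" by simp
  also have "\<dots> = norm (y + ?F a (?F b y)) / 2" by simp
  also have "norm (y + ?F a (?F b y)) \<le> norm y + norm y"
    using norm_triangle_ineq[of y "?F a (?F b y)"]
      F[OF subspace_diff[OF subspace_X in_X[OF y]] ab(1), of b b] F[OF y ab(2)] by linarith
  finally show ?thesis by simp
qed

text \<open>For b in A, the diagonal part with respect to \<open>{a, b}\<close> followed by the one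
  with respect to A is the one with respect to \<open>insert a A\<close>; so the case of two
  coordinates suffices.\<close>

lemma diagonal_norm_le:
  assumes "finite A" "A \<noteq> {}" "A \<subseteq> I" and y: "y \<in> X"
  shows "norm (proj (along A B) y + proj (along A (- B)) y) \<le> norm y"
  using assms(1,2,3) y
proof (induction A arbitrary: y rule: finite_ne_induct)
  case (singleton a)
  then show ?case using proj_along_split[of y a B] by simp
next
  case (insert a A)
  obtain b where b: "b \<in> A" using insert.hyps by blast
  let ?D = "proj (along {a, b} B) y + proj (along {a, b} (- B)) y"
  have y: "y \<in> X" by (rule insert.prems)
  have D: "?D \<in> X" by (intro subspace_add subspace_X proj_in y)
  have "b \<in> I" using b insert.prems by auto
  have eq: "proj (along A C) ?D = proj (along (insert a A) C) y" if C: "C = B \<or> C = - B" for C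
  proof -
    have 1: "proj (along A C) (proj (along {a, b} C) y) = proj (along (insert a A) C) y"
      unfolding proj_proj[OF y] by (rule proj_cong[OF _ y]) (use b in \<open>auto simp: along_def\<close>)
    have 2: "proj (along A C) (proj (along {a, b} (- C)) y) = 0"
      unfolding proj_proj[OF y] by (rule proj_empty[OF y \<open>b \<in> I\<close>]) (use b in \<open>auto simp: along_def\<close>)
    show ?thesis using C
    proof
      assume "C = B"
      then show ?thesis using 1 2 by (simp add: bounded_op_add[OF proj_op] proj_in y)
    next
      assume "C = - B"
      then show ?thesis using 1 2 by (simp add: bounded_op_add[OF proj_op] proj_in y)
    qed
  qed
  have "norm (proj (along (insert a A) B) y + proj (along (insert a A) (- B)) y)
      = norm (proj (along A B) ?D + proj (along A (- B)) ?D)" using eq by simp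
  also have "\<dots> \<le> norm ?D" by (rule insert.IH[OF _ D]) (use insert.prems in auto)
  also have "\<dots> \<le> norm y" by (rule pair_diagonal_norm_le) (use insert.prems \<open>b \<in> I\<close> in auto)
  finally show ?case .
qed

text \<open>The remainder is carried along for the induction: cutting with \<open>B L\<close> and
  its complement splits the remainder of the first L blocks into block L and the new remainder, and
  leaves the earlier blocks unchanged.\<close>

lemma blocks_with_remainder_norm_le:
  fixes L :: nat
  assumes A: "A \<subseteq> I" "A \<noteq> {}" and y: "y \<in> X" and "disjoint_family_on B {..<L}"
  shows "norm ((\<Sum>k<L. proj (along A (B k)) y) + proj (along A (- (\<Union>k<L. B k))) y) \<le> norm y"
  using y assms(4)
proof (induction L arbitrary: y)
  case 0
  then show ?case by (simp add: proj_norm_le)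
next
  case (Suc L)
  have fA: "finite A" using A(1) finite_I by (rule finite_subset)
  have y: "y \<in> X" by (rule Suc.prems)
  have dis: "B k \<inter> B L = {}" if "k < L" for k
    using Suc.prems(2) that by (auto simp: disjoint_family_on_def)
  let ?D = "proj (along A (B L)) y + proj (along A (- B L)) y"
  let ?R = "- (\<Union>k<L. B k)"
  have D: "?D \<in> X" by (intro subspace_add subspace_X proj_in y)
  have PD: "proj (along A C) ?D = proj (along A (C \<inter> B L)) y + proj (along A (C \<inter> - B L)) y" for C
    by (simp add: bounded_op_add[OF proj_op] proj_in y proj_along_along)
  have k: "proj (along A (B k)) ?D = proj (along A (B k)) y" if "k < L" for k
  proof -
    have "B k \<inter> - B L = B k" using dis[OF that] by auto
    then show ?thesis unfolding PD dis[OF that] by (simp add: proj_along_empty[OF y A])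
  qed
  have "?R \<inter> B L = B L" using dis by auto
  moreover have "?R \<inter> - B L = - (\<Union>k<Suc L. B k)" by (auto simp: less_Suc_eq)
  ultimately have R: "proj (along A ?R) ?D = proj (along A (B L)) y + proj (along A (- (\<Union>k<Suc L. B k))) y"
    using PD[of ?R] by (simp only:)
  have "norm ((\<Sum>k<Suc L. proj (along A (B k)) y) + proj (along A (- (\<Union>k<Suc L. B k))) y)
      = norm ((\<Sum>k<L. proj (along A (B k)) ?D) + proj (along A ?R) ?D)"
    unfolding R by (simp add: k add.assoc)
  also have "\<dots> \<le> norm ?D"
    by (rule Suc.IH[OF D]) (use Suc.prems in \<open>auto simp: disjoint_family_on_def\<close>)
  also have "\<dots> \<le> norm y" by (rule diagonal_norm_le[OF fA A(2,1) y])
  finally show ?case .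
qed

text \<open>Projecting first onto the union of the blocks removes the remainder and does not change
  the blocks.\<close>

lemma blocks_norm_le:
  fixes L :: nat
  assumes A: "A \<subseteq> I" "A \<noteq> {}" and y: "y \<in> X" and B: "disjoint_family_on B {..<L}"
  shows "norm (\<Sum>k<L. proj (along A (B k)) y) \<le> norm y"
proof -
  let ?U = "\<Union>k<L. B k"
  let ?z = "proj (along A ?U) y"
  have "proj (along A (B k)) ?z = proj (along A (B k)) y" if "k < L" for k
  proof -
    have "B k \<inter> ?U = B k" using that by auto
    then show ?thesis by (simp only: proj_along_along[OF y])
  qed
  moreover have "proj (along A (- ?U)) ?z = 0"
    by (simp only: proj_along_along[OF y] Compl_disjoint2 proj_along_empty[OF y A])
  ultimately have "norm (\<Sum>k<L. proj (along A (B k)) y) \<le> norm ?z"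
    using blocks_with_remainder_norm_le[OF A proj_in[OF y] B, of "along A ?U"] by simp
  also have "\<dots> \<le> norm y" by (rule proj_norm_le[OF y])
  finally show ?thesis .
qed

definition slot :: "('i \<Rightarrow> nat) \<Rightarrow> 'i set \<Rightarrow> nat set \<Rightarrow> 'i \<Rightarrow> nat set" where
  "slot f A B = (\<lambda>l. if l \<in> A then B else {f l})"

text \<open>The sum is the block diagonal part of a single elementary tensor, whose factor \<open>l \<in> A\<close> is the
  sum over \<open>k\<close> of the \<open>k\<close>-th blocks; the scalars coming from the coordinates outside \<open>A\<close> are moved
  into one of these factors.\<close>

lemma upper_estimate_tens:
  assumes A: "A \<subseteq> I" "A \<noteq> {}" and B: "disjoint_family_on B {..<L}"
    and x: "\<And>k. k < L \<Longrightarrow> x k \<in> tuples"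
      "\<And>k l. k < L \<Longrightarrow> l \<in> I \<Longrightarrow> lp_norm (p l) (x k l) \<le> 1"
  shows "norm (\<Sum>k<L. proj (slot f A (B k)) (tens (x k))) \<le> real L powr (\<Sum>l\<in>A. 1 / p l)"
proof -
  obtain a where a: "a \<in> A" using A by blast
  then have aI: "a \<in> I" using A by blast
  have fA: "finite A" using A(1) finite_I by (rule finite_subset)
  define u where "u k = (\<lambda>l\<in>I. if l \<in> A then cutoff (B k) (x k l) else unit_seq (f l))" for k
  define c where "c k l = (if l \<in> A then 1 else x k l (f l))" for k l
  define w where "w k = (\<Prod>l\<in>I. c k l)" for k
  define d where "d k l = (if l = a then w k else 1)" for k l
  define v where "v = (\<lambda>l\<in>I. if l \<in> A then (\<lambda>n. \<Sum>k<L. d k l * cutoff (B k) (x k l) n) else unit_seq (f l))"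
  have xE: "x k l \<in> E l" if "k < L" "l \<in> I" for k l by (rule tuplesD[OF x(1)[OF that(1)] that(2)])
  have u: "u k \<in> tuples" if "k < L" for k
    unfolding u_def using xE[OF that] by (auto simp: lp_space_cutoff lp_space_unit)
  have v: "v \<in> tuples"
  proof -
    have "(\<lambda>n. \<Sum>k<L. d k l * cutoff (B k) (x k l) n) \<in> E l" if "l \<in> I" for l
      using xE that by (intro lp_space_sum lp_space_scale lp_space_cutoff p_pos) auto
    then show ?thesis unfolding v_def by (auto simp: lp_space_unit)
  qed
  have w: "norm (w k) \<le> 1" if "k < L" for k
    unfolding w_def prod_norm[symmetric]
    using lp_norm_coord_le[OF xE[OF that] p_pos] x(2)[OF that]
    by (intro prod_le_1) (auto simp: c_def intro: order_trans)
  have cutv: "cutoff (B k) (v l) = (\<lambda>n. d k l * cutoff (B k) (x k l) n)" if "k < L" "l \<in> A" for k l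
  proof
    fix n
    show "cutoff (B k) (v l) n = d k l * cutoff (B k) (x k l) n"
    proof (cases "n \<in> B k")
      case True
      have "cutoff (B k') (x k' l) n = 0" if "k' < L" "k' \<noteq> k" for k'
        using B \<open>k < L\<close> True that by (auto simp: disjoint_family_on_def cutoff_def)
      then have "(\<Sum>k'<L. d k' l * cutoff (B k') (x k' l) n) = (\<Sum>k'<L. if k' = k then d k l * x k l n else 0)"
        using True by (intro sum.cong refl) (auto simp: cutoff_def)
      then have "v l n = d k l * x k l n"
        using \<open>k < L\<close> \<open>l \<in> A\<close> A by (auto simp: v_def)
      then show ?thesis using True by (simp add: cutoff_def)
    qed (simp add: cutoff_def)
  qed
  have 1: "proj (slot f A (B k)) (tens (x k)) = smul (w k) (tens (u k))" if k: "k < L" for k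
  proof -
    have "restr (slot f A (B k)) (x k) = (\<lambda>l. if l \<in> I then (\<lambda>n. c k l * u k l n) else u k l)"
      by (auto simp: restr_def slot_def u_def c_def cutoff_singleton fun_eq_iff)
    then show ?thesis
      using tens_scale_prod[OF u[OF k] order_refl, of "c k"] by (simp add: proj_tens x(1)[OF k] w_def)
  qed
  have 2: "proj (along A (B k)) (tens v) = smul (w k) (tens (u k))" if k: "k < L" for k
  proof -
    have "restr (along A (B k)) v = (\<lambda>l. if l \<in> I then (\<lambda>n. d k l * u k l n) else u k l)"
    proof
      fix l
      show "restr (along A (B k)) v l = (if l \<in> I then (\<lambda>n. d k l * u k l n) else u k l)"
        using cutv[OF k, of l] a by (auto simp: restr_def along_def u_def d_def v_def)
    qed
    moreover have "(\<Prod>l\<in>I. d k l) = w k"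
      unfolding d_def using aI finite_I by (simp add: prod.delta)
    ultimately show ?thesis
      using tens_scale_prod[OF u[OF k] order_refl, of "d k"] by (simp add: proj_tens v)
  qed
  \<comment> \<open>Each factor of v consists of L disjoint pieces of norm at most 1; in the factor
    a this relies on \<open>norm (w k) \<le> 1\<close>.\<close>
  have nv: "lp_norm (p l) (v l) \<le> real L powr (1 / p l)" if l: "l \<in> A" for l
  proof -
    have lI: "l \<in> I" using l A by blast
    have "v l = cutoff (\<Union>k<L. B k) (v l)"
    proof
      fix n show "v l n = cutoff (\<Union>k<L. B k) (v l) n"
        using l lI by (auto simp: v_def cutoff_def intro!: sum.neutral)
    qed
    then have "lp_sum (p l) (v l) = (\<Sum>k<L. lp_sum (p l) (cutoff (B k) (v l)))"
      using lp_sum_cutoff_UNION[OF tuplesD[OF v lI] _ B] by simp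
    also have "\<dots> \<le> (\<Sum>k<L. 1)"
    proof (rule sum_mono)
      fix k assume "k \<in> {..<L}"
      then have k: "k < L" by simp
      have "lp_norm (p l) (cutoff (B k) (v l)) = norm (d k l) * lp_norm (p l) (cutoff (B k) (x k l))"
        unfolding cutv[OF k l] by (rule lp_norm_scale[OF lp_space_cutoff[OF xE[OF k lI]] p_pos[OF lI]])
      also have "\<dots> \<le> 1 * 1"
        using w[OF k] lp_norm_cutoff_le[OF xE[OF k lI] p_pos[OF lI], of "B k"] x(2)[OF k lI]
        by (intro mult_mono lp_norm_nonneg) (auto simp: d_def)
      finally show "lp_sum (p l) (cutoff (B k) (v l)) \<le> 1"
        by (intro lp_sum_le_1 lp_space_cutoff tuplesD[OF v lI] p_pos[OF lI]) simp
    qed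
    finally show ?thesis
      unfolding lp_norm_eq using p_pos[OF lI]
      by (intro powr_mono2 lp_sum_nonneg tuplesD[OF v lI]) auto
  qed
  have nv': "lp_norm (p l) (v l) \<le> (if l \<in> A then real L powr (1 / p l) else 1)" if "l \<in> I" for l
    using nv[of l] that by (cases "l \<in> A") (simp_all add: v_def lp_norm_unit)
  have "norm (\<Sum>k<L. proj (slot f A (B k)) (tens (x k))) = norm (\<Sum>k<L. proj (along A (B k)) (tens v))"
    by (simp add: 1 2)
  also have "\<dots> \<le> norm (tens v)" by (rule blocks_norm_le[OF A tens_in_X[OF v] B])
  also have "\<dots> \<le> tnorm v" by (rule tens_norm_le[OF v])
  also have "\<dots> \<le> (\<Prod>l\<in>I. if l \<in> A then real L powr (1 / p l) else 1)"
    unfolding tnorm_def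
    by (intro prod_mono conjI lp_norm_nonneg nv')
  also have "\<dots> = (\<Prod>l\<in>A. real L powr (1 / p l))"
    using finite_I A(1) by (simp add: prod.If_cases Int_absorb1 Int_absorb2)
  \<comment> \<open>For \<open>L = 0\<close> both sides are 0, since 0 to any power is 0 for
    \<open>powr\<close> and A is non-empty.\<close>
  also have "\<dots> = real L powr (\<Sum>l\<in>A. 1 / p l)"
    using fA a by (cases "L = 0") (auto simp: powr_sum card_gt_0_iff)
  finally show ?thesis .
qed

text \<open>With all but one of the vectors fixed, the inequality confines the remaining one to a
  closed convex set. So elementary tensors are replaced by arbitrary vectors of the unit ball one at
  a time; m counts the replaced ones.\<close>

lemma sum_op_norm_le:
  fixes L :: nat
  assumes G: "\<And>k. k < L \<Longrightarrow> bounded_op X (G k)"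
    and tens: "\<And>x. (\<And>k. k < L \<Longrightarrow> x k \<in> tuples) \<Longrightarrow>
      (\<And>k l. k < L \<Longrightarrow> l \<in> I \<Longrightarrow> lp_norm (p l) (x k l) \<le> 1) \<Longrightarrow> norm (\<Sum>k<L. G k (tens (x k))) \<le> M"
    and z: "\<And>k. k < L \<Longrightarrow> z k \<in> X" "\<And>k. k < L \<Longrightarrow> norm (z k) \<le> 1"
  shows "norm (\<Sum>k<L. G k (z k)) \<le> M"
proof -
  have dist: "dist (- c) g = norm (g + c)" for c g :: 'x
    unfolding dist_norm norm_minus_cancel[of "g + c", symmetric] by (rule arg_cong[where f = norm]) simp
  define T where "T = {tens x |x. x \<in> tuples \<and> (\<forall>l\<in>I. lp_norm (p l) (x l) \<le> 1)}"
  have "norm (\<Sum>k<L. G k (z k)) \<le> M"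
    if "m \<le> L" "\<And>k. k < m \<Longrightarrow> z k \<in> X \<and> norm (z k) \<le> 1" "\<And>k. m \<le> k \<Longrightarrow> k < L \<Longrightarrow> z k \<in> T" for m z
    using that
  proof (induction m arbitrary: z)
    case 0
    then have "\<forall>k. k < L \<longrightarrow> (\<exists>x. z k = tens x \<and> x \<in> tuples \<and> (\<forall>l\<in>I. lp_norm (p l) (x l) \<le> 1))"
      by (auto simp: T_def)
    then obtain x where x: "\<And>k. k < L \<Longrightarrow> z k = tens (x k) \<and> x k \<in> tuples \<and> (\<forall>l\<in>I. lp_norm (p l) (x k l) \<le> 1)"
      by metis
    have "norm (\<Sum>k<L. G k (tens (x k))) \<le> M" by (rule tens) (use x in auto)
    then show ?case using x by simp
  next
    case (Suc m)
    let ?c = "\<Sum>k\<in>{..<L} - {m}. G k (z k)"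
    have m: "m < L" using Suc.prems by simp
    have eq: "(\<Sum>k<L. G k ((z(m := y)) k)) = G m y + ?c" for y
      using m by (subst sum.remove[of _ m]) (auto intro!: sum.cong)
    let ?S = "{y \<in> X. G m y \<in> cball (- ?c) M}"
    have "z m \<in> ?S"
    proof (rule unit_ball_induct)
      fix x assume x: "x \<in> tuples" "\<And>l. l \<in> I \<Longrightarrow> lp_norm (p l) (x l) \<le> 1"
      have "norm (\<Sum>k<L. G k ((z(m := tens x)) k)) \<le> M"
      proof (rule Suc.IH)
        show "(z(m := tens x)) k \<in> T" if "m \<le> k" "k < L" for k
          using Suc.prems(3)[of k] that x by (auto simp: T_def)
      qed (use Suc.prems in auto)
      then show "tens x \<in> ?S"
        unfolding eq using tens_in_X[OF x(1)] by (simp add: dist)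
    next
      show "closed ?S" by (rule closed_preimage_op[OF G[OF m] closed_cball])
      show "convex ?S" by (rule convex_preimage_op[OF G[OF m] convex_cball])
    qed (use Suc.prems m in auto)
    then have "norm (G m (z m) + ?c) \<le> M" by (simp add: dist)
    then show ?case using eq[of "z m"] by simp
  qed
  from this[of L z] z show ?thesis by auto
qed

text \<open>This is \<open>1 / r\<^sub>A\<close> in the notation of the paper.\<close>

definition \<kappa> :: "'i set \<Rightarrow> real" where
  "\<kappa> A = min 1 (\<Sum>l\<in>A. 1 / p l)"

lemma \<kappa>_pos: "A \<subseteq> I \<Longrightarrow> A \<noteq> {} \<Longrightarrow> 0 < \<kappa> A"
  unfolding \<kappa>_def using p_pos finite_subset[OF _ finite_I] by (auto intro!: sum_pos)

text \<open>The two arguments of the minimum in \<open>\<kappa> A\<close> are the two available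
  bounds: the one for elementary tensors, extended by \<open>sum_op_norm_le\<close>, and the
  triangle inequality.\<close>

lemma upper_estimate:
  assumes A: "A \<subseteq> I" "A \<noteq> {}" and B: "disjoint_family_on B {..<L}"
    and z: "\<And>k. k < L \<Longrightarrow> z k \<in> X" "\<And>k. k < L \<Longrightarrow> proj (slot f A (B k)) (z k) = z k"
      "\<And>k. k < L \<Longrightarrow> norm (z k) \<le> D" and D: "0 < D"
  shows "norm (\<Sum>k<L. z k) \<le> D * real L powr \<kappa> A"
proof (cases "(\<Sum>l\<in>A. 1 / p l) < 1")
  case True
  have "norm (\<Sum>k<L. proj (slot f A (B k)) ((1 / D) *\<^sub>R z k)) \<le> real L powr (\<Sum>l\<in>A. 1 / p l)"
  proof (rule sum_op_norm_le[where G = "\<lambda>k. proj (slot f A (B k))" and z = "\<lambda>k. (1 / D) *\<^sub>R z k"])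
    show "(1 / D) *\<^sub>R z k \<in> X" if "k < L" for k by (rule subspace_scaleR[OF subspace_X z(1)[OF that]])
    show "norm ((1 / D) *\<^sub>R z k) \<le> 1" if "k < L" for k using z(3)[OF that] D by simp
  qed (use proj_op upper_estimate_tens[OF A B] in auto)
  also have "(\<Sum>k<L. proj (slot f A (B k)) ((1 / D) *\<^sub>R z k)) = (\<Sum>k<L. (1 / D) *\<^sub>R z k)"
    by (intro sum.cong refl) (auto simp: bounded_op_scaleR[OF proj_op] z)
  also have "norm \<dots> = norm (\<Sum>k<L. z k) / D" using D by (simp flip: scaleR_sum_right)
  finally show ?thesis using True D by (simp add: \<kappa>_def field_simps)
next
  case False
  have "norm (\<Sum>k<L. z k) \<le> (\<Sum>k<L. norm (z k))" by (rule norm_sum)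
  also have "\<dots> \<le> (\<Sum>k<L. D)" using z by (intro sum_mono) auto
  finally show ?thesis using False by (simp add: \<kappa>_def mult.commute)
qed

text \<open>The exponent \<open>1 / \<kappa> A\<close> is at least 1, so the left side is a
  continuous convex function of y and \<open>unit_ball_induct\<close> applies. On elementary tensors
  the claim is a generalised Hoelder inequality, \<open>sum_prod_powr_le_1\<close>.\<close>

lemma lower_estimate_unit:
  fixes L :: nat
  assumes A: "A \<subseteq> I" "A \<noteq> {}" and B: "disjoint_family_on B {..<L}" and y: "y \<in> X" "norm y \<le> 1"
  shows "(\<Sum>k<L. norm (proj (along A (B k)) y) powr (1 / \<kappa> A)) \<le> 1"
proof -
  define r where "r = 1 / \<kappa> A"
  have r: "1 \<le> r" using \<kappa>_pos[OF A] by (simp add: r_def \<kappa>_def)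
  have fA: "finite A" using A(1) finite_I by (rule finite_subset)
  let ?f = "\<lambda>y. \<Sum>k<L. norm (proj (along A (B k)) y) powr r"
  let ?S = "{y \<in> X. ?f y \<le> 1}"
  have "y \<in> ?S"
  proof (rule unit_ball_induct[OF _ _ _ y])
    have "continuous_on X ?f"
      using r by (intro continuous_intros continuous_on_powr' bounded_op_continuous[OF subspace_X proj_op]) auto
    from continuous_closed_preimage[OF this closed_X closed_atMost, of 1]
    show "closed ?S" by (simp add: vimage_def Int_def)
    show "convex ?S"
    proof (rule convexI)
      fix a b :: 'x and u v :: real
      assume ab: "a \<in> ?S" "b \<in> ?S" and uv: "0 \<le> u" "0 \<le> v" "u + v = 1"
      have "?f (u *\<^sub>R a + v *\<^sub>R b) \<le> (\<Sum>k<L. u * norm (proj (along A (B k)) a) powr r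
          + v * norm (proj (along A (B k)) b) powr r)"
      proof (rule sum_mono)
        fix k
        let ?P = "proj (along A (B k))"
        have "norm (?P (u *\<^sub>R a + v *\<^sub>R b)) \<le> u * norm (?P a) + v * norm (?P b)"
          using ab uv norm_triangle_ineq[of "u *\<^sub>R ?P a" "v *\<^sub>R ?P b"]
          by (simp add: bounded_op_add[OF proj_op] bounded_op_scaleR[OF proj_op] subspace_scaleR[OF subspace_X])
        then have "norm (?P (u *\<^sub>R a + v *\<^sub>R b)) powr r \<le> (u * norm (?P a) + v * norm (?P b)) powr r"
          using r by (intro powr_mono2) auto
        also have "\<dots> \<le> u * norm (?P a) powr r + v * norm (?P b) powr r"
          by (rule convex_powr_nonneg) (use r uv in auto)
        finally show "norm (?P (u *\<^sub>R a + v *\<^sub>R b)) powr r \<le> u * norm (?P a) powr r + v * norm (?P b) powr r" .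
      qed
      also have "\<dots> = u * ?f a + v * ?f b" by (simp add: sum.distrib sum_distrib_left)
      also have "\<dots> \<le> 1" using ab uv by (intro convex_bound_le) auto
      finally show "u *\<^sub>R a + v *\<^sub>R b \<in> ?S"
        using ab by (simp add: subspace_add subspace_X subspace_scaleR)
    qed
    fix x assume x: "x \<in> tuples" "\<And>l. l \<in> I \<Longrightarrow> lp_norm (p l) (x l) \<le> 1"
    let ?a = "\<lambda>k l. lp_sum (p l) (cutoff (B k) (x l))"
    have xE: "x l \<in> E l" if "l \<in> A" for l using tuplesD[OF x(1)] A that by blast
    have "?f (tens x) \<le> (\<Sum>k<L. \<Prod>l\<in>A. ?a k l powr (r / p l))"
    proof (rule sum_mono)
      fix k
      have "norm (proj (along A (B k)) (tens x)) \<le> tnorm (restr (along A (B k)) x)"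
        by (simp add: proj_tens x(1) tens_norm_le restr_in)
      also have "\<dots> \<le> (\<Prod>l\<in>I. if l \<in> A then lp_norm (p l) (cutoff (B k) (x l)) else 1)"
        unfolding tnorm_def
        by (intro prod_mono conjI lp_norm_nonneg) (use x(2) in \<open>auto simp: restr_def along_def\<close>)
      also have "\<dots> = (\<Prod>l\<in>A. lp_norm (p l) (cutoff (B k) (x l)))"
        using finite_I A(1) by (simp add: prod.If_cases Int_absorb1 Int_absorb2)
      finally have "norm (proj (along A (B k)) (tens x)) powr r \<le> (\<Prod>l\<in>A. lp_norm (p l) (cutoff (B k) (x l))) powr r"
        using r by (intro powr_mono2) auto
      also have "\<dots> = (\<Prod>l\<in>A. lp_norm (p l) (cutoff (B k) (x l)) powr r)"
        by (simp add: prod_powr_distrib lp_norm_nonneg)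
      also have "\<dots> = (\<Prod>l\<in>A. ?a k l powr (r / p l))"
        by (simp add: lp_norm_eq powr_powr)
      finally show "norm (proj (along A (B k)) (tens x)) powr r \<le> (\<Prod>l\<in>A. ?a k l powr (r / p l))" .
    qed
    also have "\<dots> \<le> 1"
    proof (rule sum_prod_powr_le_1[OF fA])
      show "0 < r / p l" if "l \<in> A" for l using that A p_pos r by auto
      \<comment> \<open>The weights add up to exactly 1 if the minimum in \<kappa> is the sum, and
        to at least 1 if the minimum is 1.\<close>
      have "(\<Sum>l\<in>A. r / p l) = (\<Sum>l\<in>A. 1 / p l) / \<kappa> A"
        by (simp add: r_def sum_divide_distrib mult.commute)
      also have "\<dots> \<ge> 1" using \<kappa>_pos[OF A] by (simp add: \<kappa>_def)
      finally show "1 \<le> (\<Sum>l\<in>A. r / p l)" .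
      show "(\<Sum>k<L. ?a k l) \<le> 1" if l: "l \<in> A" for l
      proof -
        have "l \<in> I" using l A by blast
        have "(\<Sum>k<L. ?a k l) \<le> lp_sum (p l) (x l)" by (rule lp_sum_disjoint_le[OF xE[OF l] _ B]) simp
        also have "\<dots> \<le> 1" by (rule lp_sum_le_1[OF xE[OF l] p_pos x(2)]) (use \<open>l \<in> I\<close> in auto)
        finally show ?thesis .
      qed
    qed (use xE in \<open>auto intro: lp_sum_nonneg lp_space_cutoff\<close>)
    finally show "tens x \<in> ?S" using tens_in_X[OF x(1)] by simp
  qed
  then show ?thesis by (simp add: r_def)
qed

lemma lower_estimate_homogeneous:
  fixes L :: nat
  assumes A: "A \<subseteq> I" "A \<noteq> {}" and B: "disjoint_family_on B {..<L}" and y: "y \<in> X"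
  shows "(\<Sum>k<L. norm (proj (along A (B k)) y) powr (1 / \<kappa> A)) \<le> norm y powr (1 / \<kappa> A)"
proof (cases "y = 0")
  case True
  then show ?thesis using bounded_op_0[OF proj_op y] by simp
next
  case False
  let ?r = "1 / \<kappa> A"
  have "(\<Sum>k<L. norm (proj (along A (B k)) ((1 / norm y) *\<^sub>R y)) powr ?r) \<le> 1"
    by (rule lower_estimate_unit[OF A B subspace_scaleR[OF subspace_X y]]) (use False in simp)
  then have "(\<Sum>k<L. norm (proj (along A (B k)) y) powr ?r / norm y powr ?r) \<le> 1"
    by (simp add: bounded_op_scaleR[OF proj_op y] powr_divide)
  then show ?thesis using False by (simp add: sum_divide_distrib[symmetric] divide_le_eq)
qed

text \<open>Projecting the sum along A onto \<open>B k\<close> recovers \<open>z k\<close>, so the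
  homogeneous estimate can be applied to the sum itself.\<close>

lemma lower_estimate:
  assumes A: "A \<subseteq> I" "A \<noteq> {}" and B: "disjoint_family_on B {..<L}"
    and z: "\<And>k. k < L \<Longrightarrow> z k \<in> X" "\<And>k. k < L \<Longrightarrow> proj (slot f A (B k)) (z k) = z k"
      "\<And>k. k < L \<Longrightarrow> \<delta> \<le> norm (z k)" and \<delta>: "0 < \<delta>"
  shows "\<delta> * real L powr \<kappa> A \<le> norm (\<Sum>k<L. z k)"
proof -
  let ?y = "\<Sum>k<L. z k"
  have y: "?y \<in> X" using z by (intro subspace_sum subspace_X) auto
  have P: "proj (along A (B k)) ?y = z k" if k: "k < L" for k
  proof -
    have "proj (along A (B k)) (z k') = (if k' = k then z k else 0)" if k': "k' < L" for k'
    proof -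
      have "proj (along A (B k)) (z k') = proj (along A (B k)) (proj (slot f A (B k')) (z k'))"
        using z(2)[OF k'] by simp
      also have "\<dots> = (if k' = k then z k else 0)"
      proof (cases "k' = k")
        case True
        have "proj (along A (B k)) (proj (slot f A (B k)) (z k)) = proj (slot f A (B k)) (z k)"
          unfolding proj_proj[OF z(1)[OF k]]
          by (rule proj_cong[OF _ z(1)[OF k]]) (auto simp: along_def slot_def)
        then show ?thesis using True z(2)[OF k] by simp
      next
        case False
        obtain a where "a \<in> A" using A by blast
        then show ?thesis
          unfolding proj_proj[OF z(1)[OF k']] using A B k k' False
          by (subst proj_empty[OF z(1)[OF k'], of a])
             (auto simp: along_def slot_def disjoint_family_on_def)
      qed
      finally show ?thesis .
    qed
    then show ?thesis
      using k z by (subst bounded_op_sum[OF subspace_X proj_op]) auto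
  qed
  let ?r = "1 / \<kappa> A"
  have \<kappa>: "0 < \<kappa> A" by (rule \<kappa>_pos[OF A])
  have "real L * \<delta> powr ?r = (\<Sum>k<L. \<delta> powr ?r)" by simp
  also have "\<dots> \<le> (\<Sum>k<L. norm (proj (along A (B k)) ?y) powr ?r)"
    using z(3) \<delta> \<kappa> by (intro sum_mono powr_mono2) (auto simp: P)
  also have "\<dots> \<le> norm ?y powr ?r" by (rule lower_estimate_homogeneous[OF A B y])
  finally have "(real L * \<delta> powr ?r) powr \<kappa> A \<le> (norm ?y powr ?r) powr \<kappa> A"
    using \<kappa> by (intro powr_mono2) auto
  then show ?thesis using \<kappa> \<delta> by (simp add: powr_mult powr_powr mult.commute)
qed

end

section \<open>Upper estimates and small blocks\<close>

text \<open>The q-th power of the norm of the coefficients on F; unlike the norm, it adds over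
  disjoint index sets.\<close>

definition coeff_sum :: "real \<Rightarrow> nat set \<Rightarrow> (nat \<Rightarrow> 'k::real_normed_field) \<Rightarrow> real" where
  "coeff_sum q F a = (\<Sum>k\<in>F. norm (a k) powr q)"

lemma coeff_sum_nonneg: "0 \<le> coeff_sum q F a"
  by (simp add: coeff_sum_def sum_nonneg)

lemma coeff_sum_scale: "coeff_sum q F (\<lambda>k. of_real r * a k) = \<bar>r\<bar> powr q * coeff_sum q F a"
  by (simp add: coeff_sum_def norm_mult powr_mult sum_distrib_left)

lemma coeff_le_1:
  assumes "finite F" "coeff_sum q F a = 1" "0 < q" "k \<in> F"
  shows "norm (a k) \<le> 1"
proof -
  have "norm (a k) powr q \<le> 1"
    using member_le_sum[of k F "\<lambda>k. norm (a k) powr q"] assms by (simp add: coeff_sum_def)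
  then show ?thesis
    using powr_less_mono2[of q 1 "norm (a k)"] assms(3) by (fastforce simp: not_le[symmetric])
qed

lemma ex_nat_powr_gt:
  fixes \<alpha> C :: real
  assumes "0 < \<alpha>"
  obtains L :: nat where "1 \<le> L" "C < real L powr \<alpha>"
proof -
  obtain L :: nat where L: "max 1 C powr (1 / \<alpha>) < real L" using reals_Archimedean2 by blast
  have "C \<le> (max 1 C powr (1 / \<alpha>)) powr \<alpha>" using assms by (simp add: powr_powr)
  also have "\<dots> < real L powr \<alpha>" using L assms by (intro powr_less_mono2) auto
  finally have "C < real L powr \<alpha>" .
  moreover have "1 \<le> L" using L by (cases "L = 0") auto
  ultimately show ?thesis by (rule that[rotated])
qed

lemma normalize_powr:
  fixes s q :: real
  assumes "0 < s" "0 < q"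
  shows "\<bar>s powr (- 1 / q)\<bar> powr q * s = 1"
proof -
  have "\<bar>s powr (- 1 / q)\<bar> powr q = s powr (- 1)" using assms(2) by (simp add: powr_powr)
  then show ?thesis using assms(1) by (simp add: powr_minus)
qed

context normed_space_over
begin

section \<open>Linear combinations, blocks and small operators\<close>

definition comb :: "nat set \<Rightarrow> (nat \<Rightarrow> 'k) \<Rightarrow> (nat \<Rightarrow> 'x) \<Rightarrow> 'x" where
  "comb F a t = (\<Sum>k\<in>F. smul (a k) (t k))"

definition upper_bounded :: "real \<Rightarrow> real \<Rightarrow> (nat \<Rightarrow> 'x) \<Rightarrow> bool" where
  "upper_bounded q c t \<longleftrightarrow>
    (\<forall>F a. finite F \<longrightarrow> norm (comb F a t) \<le> c * coeff_sum q F a powr (1 / q))"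

text \<open>If t satisfies an upper estimate, the negation says that some tail of t is equivalent to
  the unit vector basis with exponent q. Blocks are required beyond every K so that successive
  disjoint ones can be chosen.\<close>

definition small_blocks :: "real \<Rightarrow> (nat \<Rightarrow> 'x) \<Rightarrow> bool" where
  "small_blocks q t \<longleftrightarrow> (\<forall>\<epsilon>>0. \<forall>K. \<exists>F a. finite F \<and> F \<subseteq> {K..} \<and> coeff_sum q F a = 1 \<and> norm (comb F a t) < \<epsilon>)"

lemma small_blocksD:
  assumes "small_blocks q t" "0 < \<epsilon>"
  obtains F a where "finite F" "F \<subseteq> {K..}" "coeff_sum q F a = 1" "norm (comb F a t) < \<epsilon>"
proof -
  have "\<exists>F a. finite F \<and> F \<subseteq> {K..} \<and> coeff_sum q F a = 1 \<and> norm (comb F a t) < \<epsilon>"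
    using assms by (simp add: small_blocks_def)
  then show ?thesis using that by (elim exE conjE)
qed

lemma comb_in: "subspace V \<Longrightarrow> (\<And>k. k \<in> F \<Longrightarrow> t k \<in> V) \<Longrightarrow> comb F a t \<in> V"
  unfolding comb_def by (intro subspace_sum subspace_scale)

lemma comb_op:
  assumes "subspace V" "bounded_op V G" "\<And>k. k \<in> F \<Longrightarrow> t k \<in> V"
  shows "comb F a (\<lambda>k. G (t k)) = G (comb F a t)"
  unfolding comb_def using assms
  by (subst bounded_op_sum[OF assms(1,2)]) (auto intro: subspace_scale simp: bounded_op_smul)

lemma comb_scale: "comb F (\<lambda>k. of_real r * a k) t = r *\<^sub>R comb F a t"
  unfolding comb_def scaleR_sum_right by (simp add: smul_of_real[symmetric])

lemma comb_add: "comb F a (\<lambda>k. s k + t k) = comb F a s + comb F a t"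
  by (simp add: comb_def scale_right_distrib sum.distrib)

text \<open>A combination of blocks is again a combination of the original sequence. Disjointness
  assigns each index to one block, and the new coefficient is the product of the outer and the inner
  one.\<close>

lemma comb_comb:
  assumes "finite F'" "\<And>k. k \<in> F' \<Longrightarrow> finite (F k)" "disjoint_family_on F F'"
  obtains b where "\<And>t. comb F' a' (\<lambda>k. comb (F k) (a k) t) = comb (\<Union>k\<in>F'. F k) b t"
    "\<And>q. coeff_sum q (\<Union>k\<in>F'. F k) b = (\<Sum>k\<in>F'. norm (a' k) powr q * coeff_sum q (F k) (a k))"
proof -
  define \<iota> where "\<iota> n = (SOME k. k \<in> F' \<and> n \<in> F k)" for n
  have \<iota>: "\<iota> n = k" if "k \<in> F'" "n \<in> F k" for n k
  proof -
    have "\<iota> n \<in> F' \<and> n \<in> F (\<iota> n)" unfolding \<iota>_def by (rule someI[of _ k]) (use that in auto)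
    then show ?thesis using that assms(3) by (auto simp: disjoint_family_on_def)
  qed
  define b where "b n = a' (\<iota> n) * a (\<iota> n) n" for n
  have dis: "\<forall>i\<in>F'. \<forall>j\<in>F'. i \<noteq> j \<longrightarrow> F i \<inter> F j = {}"
    using assms(3) by (auto simp: disjoint_family_on_def)
  have fin: "\<forall>k\<in>F'. finite (F k)" using assms(2) by blast
  show ?thesis
  proof (rule that[of b])
    show "comb F' a' (\<lambda>k. comb (F k) (a k) t) = comb (\<Union>k\<in>F'. F k) b t" for t
      unfolding comb_def sum.UNION_disjoint[OF assms(1) fin dis]
      by (auto simp: scale_sum_right b_def \<iota> intro!: sum.cong)
    show "coeff_sum q (\<Union>k\<in>F'. F k) b = (\<Sum>k\<in>F'. norm (a' k) powr q * coeff_sum q (F k) (a k))" for q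
      unfolding coeff_sum_def sum.UNION_disjoint[OF assms(1) fin dis]
      by (auto simp: sum_distrib_left b_def \<iota> norm_mult powr_mult intro!: sum.cong)
  qed
qed

text \<open>Flattening normalised disjoint blocks preserves the coefficient sum, so even the
  constant c is inherited.\<close>

lemma upper_bounded_blocks:
  assumes t: "upper_bounded q c t" and F: "\<And>k. finite (F k)" "disjoint_family F"
    "\<And>k. coeff_sum q (F k) (a k) = 1"
  shows "upper_bounded q c (\<lambda>k. comb (F k) (a k) t)"
  unfolding upper_bounded_def
proof (intro allI impI)
  fix F' :: "nat set" and a' :: "nat \<Rightarrow> 'k" assume F': "finite F'"
  have "disjoint_family_on F F'" using F(2) by (auto simp: disjoint_family_on_def)
  then obtain b where b: "\<And>t. comb F' a' (\<lambda>k. comb (F k) (a k) t) = comb (\<Union>k\<in>F'. F k) b t"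
    "\<And>q. coeff_sum q (\<Union>k\<in>F'. F k) b = (\<Sum>k\<in>F'. norm (a' k) powr q * coeff_sum q (F k) (a k))"
    by (rule comb_comb[where a = a and a' = a', OF F' F(1)]) blast
  then have "coeff_sum q (\<Union>k\<in>F'. F k) b = coeff_sum q F' a'" by (simp add: F(3)) (simp add: coeff_sum_def)
  moreover have "finite (\<Union>k\<in>F'. F k)" using F' F(1) by blast
  ultimately show "norm (comb F' a' (\<lambda>k. comb (F k) (a k) t)) \<le> c * coeff_sum q F' a' powr (1 / q)"
    using t[unfolded upper_bounded_def, rule_format, of "\<Union>k\<in>F'. F k" b] by (simp only: b(1))
qed

lemma upper_bounded_op:
  assumes "subspace V" "bounded_op V G" "\<And>k. t k \<in> V" "upper_bounded q c t"
  obtains c' where "upper_bounded q c' (\<lambda>k. G (t k))"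
proof -
  obtain d where d: "0 < d" "\<And>x. x \<in> V \<Longrightarrow> norm (G x) \<le> d * norm x"
    using bounded_op_bound[OF assms(2)] by blast
  have "norm (comb F a (\<lambda>k. G (t k))) \<le> (d * c) * coeff_sum q F a powr (1 / q)" if "finite F" for F a
  proof -
    have "norm (comb F a (\<lambda>k. G (t k))) \<le> d * norm (comb F a t)"
      by (subst comb_op[OF assms(1,2,3)]) (intro d comb_in assms)
    also have "\<dots> \<le> d * (c * coeff_sum q F a powr (1 / q))"
      using d assms(4) that unfolding upper_bounded_def by (intro mult_left_mono) auto
    finally show ?thesis by simp
  qed
  then show ?thesis using that unfolding upper_bounded_def by blast
qed

lemma small_blocks_sequence:
  assumes "small_blocks q t" "\<And>k. 0 < \<eta> k"
  obtains F :: "nat \<Rightarrow> nat set" and a where "\<And>k. finite (F k)" "\<And>k. F k \<subseteq> {K..}" "disjoint_family F"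
    "\<And>k. coeff_sum q (F k) (a k) = 1" "\<And>k. norm (comb (F k) (a k) t) < \<eta> k"
proof -
  define P where "P n x = (case x of (F, a) \<Rightarrow> finite F \<and> F \<subseteq> {K..} \<and> coeff_sum q F a = 1
    \<and> norm (comb F a t) < \<eta> n)" for n and x :: "nat set \<times> (nat \<Rightarrow> 'k)"
  have ex: "\<exists>x. P n x \<and> fst x \<subseteq> {M..}" for n M
  proof -
    obtain F a where "finite F" "F \<subseteq> {max K M..}" "coeff_sum q F a = 1" "norm (comb F a t) < \<eta> n"
      using small_blocksD[OF assms(1) assms(2)] by metis
    then show ?thesis by (intro exI[of _ "(F, a)"]) (auto simp: P_def)
  qed
  have "\<exists>f. \<forall>n. (P n (fst (f n)) \<and> (\<forall>k\<in>fst (fst (f n)). k < snd (f n))) \<and>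
      (\<forall>k\<in>fst (fst (f (Suc n))). snd (f n) \<le> k) \<and> snd (f n) \<le> snd (f (Suc n))"
  proof -
    \<comment> \<open>A state pairs a block with a strict upper bound of its indices; the next block
      starts at or after this bound.\<close>
    define P' where "P' n z = (P n (fst z) \<and> (\<forall>k\<in>fst (fst z). k < snd z))" for n and z :: "(nat set \<times> (nat \<Rightarrow> 'k)) \<times> nat"
    define Q where "Q n z z' = ((\<forall>k\<in>fst (fst z'). snd z \<le> k) \<and> snd z \<le> snd z')"
      for n :: nat and z z' :: "(nat set \<times> (nat \<Rightarrow> 'k)) \<times> nat"
    have step: "\<exists>z'. P' n z' \<and> (\<forall>k\<in>fst (fst z'). M \<le> k) \<and> M \<le> snd z'" for n M
    proof -
      obtain x where x: "P n x" "fst x \<subseteq> {M..}" using ex by blast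
      then have "finite (fst x)" by (auto simp: P_def split: prod.splits)
      then show ?thesis using x
        by (intro exI[of _ "(x, max M (Suc (Max (insert 0 (fst x)))))"])
          (auto simp: P'_def less_Suc_eq_le less_max_iff_disj)
    qed
    have "\<exists>f. \<forall>n. P' n (f n) \<and> Q n (f n) (f (Suc n))"
    proof (rule dependent_nat_choice)
      show "\<exists>z. P' 0 z" using step[of 0 0] by blast
      show "\<exists>z'. P' (Suc n) z' \<and> Q n z z'" for z n using step[of "Suc n" "snd z"] by (auto simp: Q_def)
    qed
    then show ?thesis by (simp add: P'_def Q_def)
  qed
  then obtain f where f: "\<And>n. P n (fst (f n))" "\<And>n k. k \<in> fst (fst (f n)) \<Longrightarrow> k < snd (f n)"
    "\<And>n k. k \<in> fst (fst (f (Suc n))) \<Longrightarrow> snd (f n) \<le> k" "\<And>n. snd (f n) \<le> snd (f (Suc n))" by blast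
  define F where "F n = fst (fst (f n))" for n
  define a where "a n = snd (fst (f n))" for n
  have mono: "snd (f m) \<le> snd (f n)" if "m \<le> n" for m n by (rule lift_Suc_mono_le[where f = "\<lambda>n. snd (f n)", OF f(4) that])
  have dis: "F m \<inter> F n = {}" if mn: "m < n" for m n
  proof -
    obtain n' where n: "n = Suc n'" using mn by (cases n) auto
    have "snd (f m) \<le> snd (f n')" using mn n by (intro mono) auto
    moreover have "k < snd (f m)" if "k \<in> F m" for k using f(2) that by (auto simp: F_def)
    moreover have "snd (f n') \<le> k" if "k \<in> F n" for k using f(3) that by (auto simp: F_def n)
    ultimately show ?thesis by fastforce
  qed
  have "disjoint_family F"
    unfolding disjoint_family_on_def using dis by (metis Int_commute linorder_neqE_nat)
  then show ?thesis
    using f(1) by (intro that[of F a]) (auto simp: P_def F_def a_def case_prod_beta)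
qed

text \<open>A variant of strict singularity. It quantifies over all sequences with an upper
  estimate, so that it can be applied again to blocks of a given sequence.\<close>

definition op_small :: "real \<Rightarrow> 'x set \<Rightarrow> ('x \<Rightarrow> 'x) \<Rightarrow> bool" where
  "op_small q V G \<longleftrightarrow> (\<forall>c t. (\<forall>k. t k \<in> V) \<longrightarrow> upper_bounded q c t \<longrightarrow> small_blocks q (\<lambda>k. G (t k)))"

lemma op_small_zero: "op_small q V (\<lambda>y. 0)"
proof -
  have "small_blocks q (\<lambda>k. 0)"
    unfolding small_blocks_def
    by (intro allI impI, rule_tac x = "{K}" in exI, rule_tac x = "\<lambda>_. 1" in exI)
       (simp add: coeff_sum_def comb_def)
  then show ?thesis by (simp add: op_small_def)
qed

lemma op_small_cong: "(\<And>y. y \<in> V \<Longrightarrow> G y = H y) \<Longrightarrow> op_small q V G \<Longrightarrow> op_small q V H"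
  by (simp add: op_small_def)

text \<open>First choose blocks on which \<open>G\<close> is summably small, then a block of these blocks on which \<open>H\<close>
  is small.\<close>

lemma op_small_plus:
  assumes U: "subspace U" and V: "subspace V" "V \<subseteq> U" and q: "0 < q"
    and GH: "bounded_op U G" "bounded_op U H" and small: "op_small q V G" "op_small q V H"
  shows "op_small q V (\<lambda>y. G y + H y)"
  unfolding op_small_def small_blocks_def
proof (intro allI impI)
  fix c t \<epsilon> K assume t: "\<forall>k. t k \<in> V" "upper_bounded q c t" and \<epsilon>: "(0::real) < \<epsilon>"
  have "small_blocks q (\<lambda>k. G (t k))" using small(1) t unfolding op_small_def by blast
  \<comment> \<open>The coefficients of a normalised outer block have norm at most 1, so these
    summable bounds contribute at most \<epsilon> / 2 altogether.\<close>
  moreover have "0 < \<epsilon> / 2 * (1 / 2) ^ Suc k" for k using \<epsilon> by simp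
  ultimately obtain F :: "nat \<Rightarrow> nat set" and a where
    F: "\<And>k. finite (F k)" "\<And>k. F k \<subseteq> {K..}" "disjoint_family F"
      "\<And>k. coeff_sum q (F k) (a k) = 1"
      "\<And>k. norm (comb (F k) (a k) (\<lambda>k. G (t k))) < \<epsilon> / 2 * (1 / 2) ^ Suc k"
    by (rule small_blocks_sequence[where K = K and \<eta> = "\<lambda>k. \<epsilon> / 2 * (1 / 2) ^ Suc k"]) blast
  define s where "s k = comb (F k) (a k) t" for k
  have sV: "s k \<in> V" for k unfolding s_def using t by (intro comb_in V) auto
  have tU: "t k \<in> U" for k using t V by blast
  have sU: "s k \<in> U" for k using sV V by blast
  have "upper_bounded q c s" unfolding s_def by (rule upper_bounded_blocks[OF t(2) F(1,3,4)])
  then have "small_blocks q (\<lambda>k. H (s k))" using small(2) sV unfolding op_small_def by blast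
  then obtain F' a' where F': "finite F'" "coeff_sum q F' a' = 1" "norm (comb F' a' (\<lambda>k. H (s k))) < \<epsilon> / 2"
    using small_blocksD[of q "\<lambda>k. H (s k)" "\<epsilon> / 2" 0] \<epsilon> by auto
  have "disjoint_family_on F F'" using F(3) by (auto simp: disjoint_family_on_def)
  then obtain b where b: "\<And>t. comb F' a' (\<lambda>k. comb (F k) (a k) t) = comb (\<Union>k\<in>F'. F k) b t"
    "\<And>q. coeff_sum q (\<Union>k\<in>F'. F k) b = (\<Sum>k\<in>F'. norm (a' k) powr q * coeff_sum q (F k) (a k))"
    by (rule comb_comb[where a = a and a' = a', OF F'(1) F(1)]) blast
  have Gs: "G (s k) = comb (F k) (a k) (\<lambda>k. G (t k))" for k
    unfolding s_def using comb_op[OF U GH(1)] tU by simp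
  have Hs: "H (s k) = comb (F k) (a k) (\<lambda>k. H (t k))" for k
    unfolding s_def using comb_op[OF U GH(2)] tU by simp
  have "norm (comb F' a' (\<lambda>k. G (s k))) \<le> (\<Sum>k\<in>F'. norm (a' k) * norm (G (s k)))"
    unfolding comb_def by (rule order_trans[OF norm_sum]) (simp add: norm_smul)
  also have "\<dots> \<le> (\<Sum>k\<in>F'. 1 * (\<epsilon> / 2 * (1 / 2) ^ Suc k))"
    by (intro sum_mono mult_mono coeff_le_1[OF F'(1,2) q]) (use F(5) in \<open>auto simp: Gs less_imp_le\<close>)
  also have "\<dots> = \<epsilon> / 2 * (\<Sum>k\<in>F'. (1 / 2) ^ Suc k)" by (simp add: sum_distrib_left)
  also have "(\<Sum>k\<in>F'. (1 / 2 :: real) ^ Suc k) \<le> 1"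
    using sum_le_suminf[OF sums_summable[OF power_half_series] F'(1)] sums_unique[OF power_half_series]
    by simp
  then have "\<epsilon> / 2 * (\<Sum>k\<in>F'. (1 / 2) ^ Suc k) \<le> \<epsilon> / 2 * 1" using \<epsilon> by (intro mult_left_mono) auto
  finally have "norm (comb F' a' (\<lambda>k. G (s k)) + comb F' a' (\<lambda>k. H (s k))) < \<epsilon>"
    using F'(3) norm_triangle_ineq[of "comb F' a' (\<lambda>k. G (s k))" "comb F' a' (\<lambda>k. H (s k))"] by linarith
  also have "comb F' a' (\<lambda>k. G (s k)) + comb F' a' (\<lambda>k. H (s k)) = comb (\<Union>k\<in>F'. F k) b (\<lambda>k. G (t k) + H (t k))"
    by (simp add: Gs Hs b comb_add)
  finally show "\<exists>F a. finite F \<and> F \<subseteq> {K..} \<and> coeff_sum q F a = 1 \<and> norm (comb F a (\<lambda>k. G (t k) + H (t k))) < \<epsilon>"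
    using F'(1,2) F(1,2,4) b(2)[of q]
    by (intro exI[of _ "\<Union>k\<in>F'. F k"] exI[of _ b]) (auto simp: coeff_sum_def)
qed

lemma op_small_sum:
  assumes "subspace U" "subspace V" "V \<subseteq> U" "0 < q"
    and "\<And>n. n \<in> N \<Longrightarrow> bounded_op U (G n)" "\<And>n. n \<in> N \<Longrightarrow> op_small q V (G n)"
  shows "op_small q V (\<lambda>y. \<Sum>n\<in>N. G n y)"
  using assms(5,6)
proof (induction N rule: infinite_finite_induct)
  case (insert n N)
  then show ?case
    by (simp add: op_small_plus[OF assms(1-4)] bounded_op_sum_op[OF assms(1)])
qed (simp_all add: op_small_zero)

text \<open>Bounded operators preserve upper estimates, so an operator into a set on which the
  identity is small is itself small. The inductive hypothesis is used in this form.\<close>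

lemma op_small_into:
  assumes "subspace U" "V \<subseteq> U" "bounded_op U G" "\<And>y. y \<in> V \<Longrightarrow> G y \<in> V'"
    and "op_small q V' (\<lambda>y. y)"
  shows "op_small q V G"
  unfolding op_small_def
proof (intro allI impI)
  fix c t assume t: "\<forall>k. t k \<in> V" "upper_bounded q c t"
  have "t k \<in> U" for k using t(1) assms(2) by blast
  then obtain c' where "upper_bounded q c' (\<lambda>k. G (t k))"
    by (rule upper_bounded_op[OF assms(1,3) _ t(2)])
  moreover have "\<forall>k. G (t k) \<in> V'" using assms(4) t(1) by blast
  ultimately show "small_blocks q (\<lambda>k. G (t k))"
    using assms(5)[unfolded op_small_def, rule_format, of "\<lambda>k. G (t k)" c'] by blast
qed

lemma continuous_linear_bounded:
  assumes "subspace V" "linear_on smul V T" "continuous_on V T"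
  obtains c where "0 < c" "\<And>x. x \<in> V \<Longrightarrow> norm (T x) \<le> c * norm x"
proof -
  have 0: "0 \<in> V" by (rule subspace_0[OF assms(1)])
  have lin: "T (smul c x) = smul c (T x)" if "x \<in> V" for c x using assms(2) that by (simp add: linear_on_def)
  have T0: "T 0 = 0" using lin[OF 0, of 0] by simp
  obtain d where d: "0 < d" "\<And>x. x \<in> V \<Longrightarrow> dist x 0 < d \<Longrightarrow> dist (T x) (T 0) < 1"
    using assms(3) 0 unfolding continuous_on_iff by (metis zero_less_one)
  have "norm (T x) \<le> (2 / d) * norm x" if x: "x \<in> V" for x
  proof (cases "x = 0")
    case True
    then show ?thesis by (simp add: T0)
  next
    case False
    let ?r = "d / (2 * norm x)"
    have "norm (T (?r *\<^sub>R x)) < 1"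
      using d(2)[OF subspace_scaleR[OF assms(1) x, of ?r]] d(1) False by (simp add: T0)
    moreover have "T (?r *\<^sub>R x) = ?r *\<^sub>R T x" using lin[OF x] by (metis smul_of_real)
    ultimately have "?r * norm (T x) < 1" using d(1) by simp
    then show ?thesis using d(1) False by (simp add: field_simps)
  qed
  then show ?thesis using d(1) by (intro that[of "2 / d"]) auto
qed

end

section \<open>Subspaces without copies of a sequence space\<close>

context lp_tensor
begin

text \<open>Every representation is tested against the product \<phi> of the coordinate evaluations
  at f: it is 1 at m and satisfies \<open>norm (\<phi> x) \<le> tnorm x\<close>.\<close>

lemma norm_tens_unit:
  assumes "m \<in> tuples" "\<And>l. l \<in> I \<Longrightarrow> m l = unit_seq (f l)"
  shows "1 \<le> norm (tens m)"
  unfolding tens_def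
proof (rule alg_norm_le[OF elementary_in_alg[OF assms(1)]])
  fix xs assume xs: "set xs \<subseteq> tuples" "elementary_tensor I E m = tensor_of I E xs"
  define \<phi> where "\<phi> x = (\<Prod>l\<in>I. x l (f l))" for x :: "'i \<Rightarrow> nat \<Rightarrow> 'k"
  have split: "\<phi> (x(l := u)) = u (f l) * (\<Prod>l\<in>I - {l}. x l (f l))" if "l \<in> I" for x l u
    unfolding \<phi>_def using that finite_I by (subst prod.remove[OF finite_I that]) (auto intro!: prod.cong)
  have \<phi>: "multilinear_form I E \<phi>"
    by (simp add: multilinear_form_def split distrib_right mult.assoc)
  have "1 = \<phi> m" using assms(2) by (simp add: \<phi>_def unit_seq_def)
  also have "\<dots> = (\<Sum>x\<leftarrow>xs. \<phi> x)"
    using fun_cong[OF xs(2), of \<phi>] \<phi> by (simp add: elementary_tensor_def tensor_of_def)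
  finally have "1 = norm (\<Sum>x\<leftarrow>xs. \<phi> x)" by (metis norm_one)
  also have "\<dots> \<le> (\<Sum>x\<leftarrow>xs. tnorm x)"
    using xs(1)
  proof (induction xs)
    case (Cons x xs)
    have x: "x l \<in> E l" if "l \<in> I" for l using Cons.prems tuplesD[OF _ that, of x] by simp
    have "norm (\<phi> x) \<le> tnorm x"
      unfolding \<phi>_def tnorm_def prod_norm[symmetric]
      by (intro prod_mono conjI norm_ge_zero lp_norm_coord_le x p_pos)
    then show ?case using Cons norm_triangle_ineq[of "\<phi> x" "\<Sum>x\<leftarrow>xs. \<phi> x"] by simp
  qed simp
  finally show "1 \<le> (\<Sum>x\<leftarrow>xs. tnorm x)" .
qed

text \<open>Elementary tensors are sent into the line itself. The closure turns the property into a
  closed one, as \<open>X_least\<close> demands, and still permits approximation by multiples of one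
  vector.\<close>

lemma proj_point_in_line:
  assumes "y \<in> X"
  shows "proj (\<lambda>l. {f l}) y \<in> closure (range (\<lambda>c. smul c (tens (\<lambda>l\<in>I. unit_seq (f l)))))"
proof -
  let ?e = "\<lambda>l\<in>I. unit_seq (f l) :: nat \<Rightarrow> 'k"
  let ?R = "range (\<lambda>c. smul c (tens ?e))"
  have e: "?e \<in> tuples" by (auto simp: lp_space_unit)
  have R: "subspace ?R"
  proof (rule subspaceI)
    show "0 \<in> ?R" by (metis rangeI scale_zero_left)
    show "x + z \<in> ?R" if "x \<in> ?R" "z \<in> ?R" for x z using that by (auto simp: image_iff scale_left_distrib[symmetric])
    show "smul c x \<in> ?R" if "x \<in> ?R" for c x using that by (auto simp: image_iff)
  qed
  have cR: "subspace (closure ?R)" by (rule subspace_closure[OF R])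
  let ?S = "{y \<in> X. proj (\<lambda>l. {f l}) y \<in> closure ?R}"
  have "X \<subseteq> ?S"
  proof (rule X_least)
    show "closed ?S" by (rule closed_preimage_op[OF proj_op closed_closure])
    show "subspace ?S"
      using bounded_op_add[OF proj_op] bounded_op_smul[OF proj_op] bounded_op_0[OF proj_op subspace_0[OF subspace_X]]
      by (intro subspaceI)
         (auto simp: subspace_add[OF subspace_X] subspace_scale[OF subspace_X] subspace_0[OF subspace_X]
          subspace_add[OF cR] subspace_scale[OF cR] subspace_0[OF cR])
    fix x assume x: "x \<in> tuples"
    have "restr (\<lambda>l. {f l}) x = (\<lambda>l. if l \<in> I then (\<lambda>n. x l (f l) * ?e l n) else ?e l)"
      by (auto simp: restr_def cutoff_singleton)
    then have "proj (\<lambda>l. {f l}) (tens x) \<in> ?R"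
      using tens_scale_prod[OF e order_refl, of "\<lambda>l. x l (f l)"]
      by (intro image_eqI[where x = "\<Prod>l\<in>I. x l (f l)"]) (simp_all add: proj_tens x)
    then have "proj (\<lambda>l. {f l}) (tens x) \<in> closure ?R" by (rule subsetD[OF closure_subset])
    then show "tens x \<in> ?S" using tens_in_X[OF x] by simp
  qed
  then show ?thesis using assms by blast
qed

section \<open>The sequence space with exponent \<open>p d\<close> inside X\<close>

definition base :: "'i \<Rightarrow> nat \<Rightarrow> 'k" where
  "base = (\<lambda>l\<in>I. unit_seq 0)"

definition line :: "'i \<Rightarrow> nat \<Rightarrow> 'x" where
  "line d k = tens (base(d := unit_seq k))"

lemma base_in: "base \<in> tuples"
  by (auto simp: base_def lp_space_unit)

lemma line_in: "d \<in> I \<Longrightarrow> line d k \<in> X"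
  unfolding line_def by (intro tens_in_X tuples_upd base_in lp_space_unit)

lemma comb_line:
  assumes d: "d \<in> I" and F: "finite F"
  shows "comb F a (line d) = tens (base(d := (\<lambda>n. \<Sum>k\<in>F. a k * unit_seq k n)))"
  using F
proof (induction F)
  case empty
  have "tens (base(d := (\<lambda>n. 0 * unit_seq 0 n))) = smul 0 (tens (base(d := unit_seq 0)))"
    by (rule tens_scale[OF base_in d lp_space_unit])
  then show ?case unfolding comb_def sum.empty by (simp only: mult_zero_left scale_zero_left)
next
  case (insert k F)
  let ?v = "\<lambda>n. \<Sum>k\<in>F. a k * unit_seq k n"
  have v: "?v \<in> E d" by (intro lp_space_sum lp_space_scale lp_space_unit p_pos d)
  have "comb (insert k F) a (line d) = smul (a k) (line d k) + comb F a (line d)"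
    using insert.hyps by (simp add: comb_def)
  also have "\<dots> = tens (base(d := (\<lambda>n. a k * unit_seq k n))) + tens (base(d := ?v))"
    unfolding insert.IH line_def tens_scale[OF base_in d lp_space_unit] ..
  also have "\<dots> = tens (base(d := (\<lambda>n. a k * unit_seq k n + ?v n)))"
    by (rule tens_add[OF base_in d lp_space_scale[OF lp_space_unit] v, symmetric])
  finally show ?case by (simp only: sum.insert[OF insert.hyps])
qed

text \<open>The line is an isometric copy of the unit vector basis. The upper bound holds because a
  combination is one elementary tensor; the lower one is the block estimate for
  \<open>A = {d}\<close> with singletons as blocks, where
  \<open>1 / \<kappa> {d} = p d\<close>.\<close>

lemma
  assumes d: "d \<in> I" and F: "finite F"
  shows norm_comb_line_le: "norm (comb F a (line d)) \<le> coeff_sum (p d) F a powr (1 / p d)"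
    and norm_comb_line_ge: "coeff_sum (p d) F a powr (1 / p d) \<le> norm (comb F a (line d))"
proof -
  let ?v = "\<lambda>n. \<Sum>k\<in>F. a k * unit_seq k n"
  let ?x = "base(d := ?v)"
  have v: "?v \<in> E d" by (intro lp_space_sum lp_space_scale lp_space_unit p_pos d)
  have x: "?x \<in> tuples" by (rule tuples_upd[OF base_in d v])
  have vn: "?v n = (if n \<in> F then a n else 0)" for n
    using F by (simp add: unit_seq_def if_distrib[of "\<lambda>c. _ * c"] cong: if_cong)
  have "lp_sum (p d) ?v = (\<Sum>n. if n \<in> F then norm (a n) powr p d else 0)"
    unfolding lp_sum_def vn by (rule arg_cong[where f = suminf]) auto
  also have "\<dots> = coeff_sum (p d) F a"
    unfolding coeff_sum_def using F by (simp add: suminf_finite[of F])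
  finally have lpv: "lp_norm (p d) ?v = coeff_sum (p d) F a powr (1 / p d)" by (simp add: lp_norm_eq)
  have "norm (comb F a (line d)) \<le> tnorm ?x"
    unfolding comb_line[OF d F] by (rule tens_norm_le[OF x])
  also have "\<dots> = lp_norm (p d) ?v * (\<Prod>l\<in>I - {d}. 1)"
    unfolding tnorm_def prod.remove[OF finite_I d] using d
    by (intro arg_cong2[where f = "(*)"] prod.cong) (auto simp: lp_norm_unit base_def)
  finally show "norm (comb F a (line d)) \<le> coeff_sum (p d) F a powr (1 / p d)"
    by (simp add: lpv)
  let ?y = "comb F a (line d)"
  have y: "?y \<in> X" by (intro comb_in subspace_X line_in d)
  have \<kappa>: "1 / \<kappa> {d} = p d" using p_gt_1[OF d] by (simp add: \<kappa>_def)
  obtain L where L: "F \<subseteq> {..<L}" using finite_nat_iff_bounded F by blast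
  have P: "proj (along {d} {k}) (line d n) = (if n = k then line d k else 0)" for k n
  proof -
    let ?u = "\<lambda>n. base(d := unit_seq n)"
    have u: "?u n \<in> tuples" for n by (intro tuples_upd base_in d lp_space_unit)
    show ?thesis
    proof (cases "n = k")
      case True
      have "restr (along {d} {k}) (?u k) = ?u k"
        using d by (auto simp: restr_def along_def fun_eq_iff cutoff_unit_seq base_def)
      then have "proj (along {d} {k}) (tens (?u k)) = tens (?u k)"
        by (simp only: proj_tens[OF u])
      then show ?thesis using True by (simp only: line_def simp_thms if_True)
    next
      case False
      have "tnorm (restr (along {d} {k}) (?u n)) = 0"
        unfolding tnorm_def using False d
        by (intro prod_zero[OF finite_I] bexI[of _ d]) (auto simp: restr_def along_def cutoff_unit_seq)
      then show ?thesis
        using False tens_norm_le[OF restr_in[OF u], of "along {d} {k}" n] unfolding line_def proj_tens[OF u]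
        by simp
    qed
  qed
  have Py: "proj (along {d} {k}) ?y = smul (a k) (line d k)" if k: "k \<in> F" for k
  proof -
    have "proj (along {d} {k}) ?y = comb F a (\<lambda>n. proj (along {d} {k}) (line d n))"
      using comb_op[OF subspace_X proj_op line_in[OF d]] by simp
    also have "\<dots> = (\<Sum>n\<in>F. if n = k then smul (a k) (line d k) else 0)"
      unfolding comb_def P by (intro sum.cong) auto
    finally show ?thesis using F k by simp
  qed
  have "1 \<le> norm (line d k)" for k
    unfolding line_def
    by (rule norm_tens_unit[of _ "\<lambda>l. if l = d then k else 0"])
       (intro tuples_upd base_in d lp_space_unit, simp add: base_def)
  then have "norm (a k) powr p d \<le> norm (proj (along {d} {k}) ?y) powr p d" if "k \<in> F" for k
    unfolding Py[OF that] norm_smul using p_pos[OF d]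
    by (intro powr_mono2 mult_left_le) (auto simp: mult_le_cancel_left1)
  then have "coeff_sum (p d) F a \<le> (\<Sum>k\<in>F. norm (proj (along {d} {k}) ?y) powr p d)"
    unfolding coeff_sum_def by (rule sum_mono)
  also have "\<dots> \<le> (\<Sum>k<L. norm (proj (along {d} {k}) ?y) powr p d)"
    using L by (intro sum_mono2) auto
  also have "\<dots> \<le> norm ?y powr p d"
    using lower_estimate_homogeneous[of "{d}" "\<lambda>k. {k}" L ?y] d y
    unfolding \<kappa> by (simp add: disjoint_family_on_def)
  finally have "coeff_sum (p d) F a powr (1 / p d) \<le> (norm ?y powr p d) powr (1 / p d)"
    using p_pos[OF d] by (intro powr_mono2 coeff_sum_nonneg) auto
  then show "coeff_sum (p d) F a powr (1 / p d) \<le> norm ?y"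
    using p_pos[OF d] by (simp add: powr_powr)
qed

text \<open>The part of W whose coordinates outside A are frozen at f. It leads from a single entry,
  \<open>A = {}\<close>, to the whole of W, \<open>A = I\<close>, and the induction runs along
  it.\<close>

definition slab :: "'x set \<Rightarrow> ('i \<Rightarrow> nat) \<Rightarrow> 'i set \<Rightarrow> 'x set" where
  "slab W f A = {y \<in> W. proj (slot f A UNIV) y = y}"

lemma proj_split_sum:
  assumes "y \<in> X" "a \<in> I"
  shows "proj (along {a} {..<M}) y = (\<Sum>m<M. proj (along {a} {m}) y)"
proof (induction M)
  case 0
  have "proj (along {a} {}) y = 0" by (rule proj_along_empty) (use assms in auto)
  then show ?case by simp
next
  case (Suc M)
  have "along {a} B = (\<lambda>_. UNIV)(a := B)" for B by (auto simp: along_def)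
  then have "proj (along {a} ({..<M} \<union> {M})) y = proj (along {a} {..<M}) y + proj (along {a} {M}) y"
    using proj_Un[OF assms, of "{..<M}" "{M}" "\<lambda>_. UNIV"] by simp
  moreover have "{..<Suc M} = {..<M} \<union> {M}" by auto
  ultimately show ?case using Suc by simp
qed

end

text \<open>\<open>W\<close> will be the range or the kernel of the triangular projection. The hypothesis
  \<open>finite_line\<close> says that a line of the array of entries of an element of \<open>W\<close>, in the direction of
  the coordinate \<open>d\<close>, has only finitely many non-zero entries.\<close>

locale no_line = lp_tensor smul I p X J
  for smul :: "'k::real_normed_field \<Rightarrow> 'x::banach \<Rightarrow> 'x" and I :: "'i set" and p X J +
  fixes W :: "'x set" and d :: 'i
  assumes W_subspace: "subspace W" and W_X: "W \<subseteq> X" and W_proj: "\<And>S y. y \<in> W \<Longrightarrow> proj S y \<in> W"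
    and d: "d \<in> I"
    and finite_line: "\<And>f. \<exists>n. \<forall>y\<in>W. proj (slot f {d} UNIV) y = y \<longrightarrow> proj (along {d} {..<n}) y = y"
    and \<kappa>_neq: "\<And>A. A \<subseteq> I \<Longrightarrow> A \<noteq> {} \<Longrightarrow> A \<noteq> {d} \<Longrightarrow> \<kappa> A \<noteq> 1 / p d"
begin

lemma q_pos: "0 < p d"
  by (rule p_pos[OF d])

lemma slab_subspace: "subspace (slab W f A)"
proof -
  have "0 \<in> X" by (rule subspace_0[OF subspace_X])
  then show ?thesis
    using bounded_op_add[OF proj_op] bounded_op_smul[OF proj_op] bounded_op_0[OF proj_op \<open>0 \<in> X\<close>] W_X
    unfolding slab_def
    by (intro subspaceI)
       (auto simp: subspace_0[OF W_subspace] subspace_add[OF W_subspace] subspace_scale[OF W_subspace] subset_iff)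
qed

lemma slab_X: "slab W f A \<subseteq> X"
  using W_X by (auto simp: slab_def)

lemma slab_step:
  assumes y: "y \<in> slab W f A" and a: "a \<in> A"
  shows "proj (along {a} {m}) (proj (along A' B) y) \<in> slab W (f(a := m)) (A - {a})"
proof -
  have y: "y \<in> W" "y \<in> X" "proj (slot f A UNIV) y = y" using y W_X by (auto simp: slab_def)
  let ?P = "\<lambda>y. proj (along {a} {m}) (proj (along A' B) y)"
  have "proj (slot (f(a := m)) (A - {a}) UNIV) (?P (proj (slot f A UNIV) y)) = ?P (proj (slot f A UNIV) y)"
    unfolding proj_proj[OF y(2)] using proj_in[OF y(2)]
    by (intro proj_cong y) (use a in \<open>auto simp: along_def slot_def\<close>)
  then show ?thesis using y W_proj by (simp add: slab_def)
qed

text \<open>What is removed has some coordinate of A below M. It is a finite sum of parts with one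
  coordinate fixed at one index, each small by hypothesis; the coordinates are treated one after
  another to avoid counting a part twice.\<close>

lemma op_small_slab:
  assumes IH: "\<And>a g. a \<in> A \<Longrightarrow> op_small (p d) (slab W g (A - {a})) (\<lambda>y. y)" and A: "A \<subseteq> I"
  shows "op_small (p d) (slab W f A) (\<lambda>y. y - proj (along A {M..}) y)"
proof -
  have fin: "finite A" using A finite_I by (rule finite_subset)
  have "op_small (p d) (slab W f A) (\<lambda>y. y - proj (along A' {M..}) y)" if "finite A'" "A' \<subseteq> A" for A'
    using that
  proof (induction A')
    case empty
    have "proj (along {} {M..}) y = y" if "y \<in> slab W f A" for y
      using that slab_X by (intro proj_UNIV) (auto simp: along_def)
    then show ?case by (intro op_small_cong[OF _ op_small_zero]) simp
  next
    case (insert a A')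
    have a: "a \<in> A" "a \<in> I" using insert.prems A by auto
    let ?G = "\<lambda>y. \<Sum>m<M. proj (along {a} {m}) (proj (along A' {M..}) y)"
    have G_op: "bounded_op X ?G"
      by (rule bounded_op_sum_op[OF subspace_X bounded_op_compose[OF proj_op proj_op]])
    have "op_small (p d) (slab W f A) ?G"
    proof (rule op_small_sum[OF subspace_X slab_subspace slab_X q_pos])
      fix m
      show op: "bounded_op X (\<lambda>y. proj (along {a} {m}) (proj (along A' {M..}) y))"
        by (rule bounded_op_compose[OF proj_op proj_op])
      show "op_small (p d) (slab W f A) (\<lambda>y. proj (along {a} {m}) (proj (along A' {M..}) y))"
        by (rule op_small_into[OF subspace_X slab_X op slab_step[OF _ a(1)] IH[OF a(1)]])
    qed
    then have "op_small (p d) (slab W f A) (\<lambda>y. (y - proj (along A' {M..}) y) + ?G y)"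
      using insert
      by (intro op_small_plus[OF subspace_X slab_subspace slab_X q_pos _ G_op]
          bounded_op_minus_op[OF subspace_X bounded_op_id proj_op]) auto
    moreover have "(y - proj (along A' {M..}) y) + ?G y = y - proj (along (insert a A') {M..}) y"
      if y: "y \<in> slab W f A" for y
    proof -
      have yX: "y \<in> X" using y slab_X by blast
      let ?z = "proj (along A' {M..}) y"
      have "?z = proj (along {a} {..<M}) ?z + proj (along {a} (- {..<M})) ?z"
        by (rule proj_along_split[OF proj_in[OF yX] a(2)])
      moreover have "- {..<M} = {M..}" by auto
      moreover have "proj (along {a} {M..}) ?z = proj (along (insert a A') {M..}) y"
        unfolding proj_proj[OF yX] by (rule proj_cong[OF _ yX]) (auto simp: along_def)
      ultimately show ?thesis
        using proj_split_sum[OF proj_in[OF yX] a(2), of M "along A' {M..}"] by (simp add: algebra_simps)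
    qed
    ultimately show ?case by (rule op_small_cong[rotated])
  qed
  from this[OF fin order_refl] show ?thesis .
qed

text \<open>Up to \<epsilon> / 2, each \<open>t k\<close> is a multiple \<gamma> k of one vector.
  Either \<open>\<gamma> K = 0\<close> and \<open>t K\<close> itself is small, or two consecutive
  terms are combined with coefficients \<gamma> (Suc K) and - \<gamma> K, normalised, so that the
  multiples cancel.\<close>

lemma op_small_point: "op_small (p d) (slab W f {}) (\<lambda>y. y)"
  unfolding op_small_def small_blocks_def
proof (intro allI impI)
  fix c \<epsilon> :: real and t :: "nat \<Rightarrow> 'x" and K :: nat
  assume t: "\<forall>k. t k \<in> slab W f {}" and \<epsilon>: "0 < \<epsilon>"
  let ?q = "p d"
  let ?e = "tens (\<lambda>l\<in>I. unit_seq (f l))"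
  have "\<exists>c. norm (t k - smul c ?e) < \<epsilon> / 2" for k
  proof -
    have "t k \<in> W" "proj (slot f {} UNIV) (t k) = t k" using t by (auto simp: slab_def)
    moreover have "slot f {} UNIV = (\<lambda>l. {f l})" by (auto simp: slot_def)
    ultimately have "t k \<in> closure (range (\<lambda>c. smul c ?e))"
      using proj_point_in_line[of "t k" f] W_X by (auto simp del: range_composition)
    then obtain c where "dist (smul c ?e) (t k) < \<epsilon> / 2"
      using half_gt_zero[OF \<epsilon>] unfolding closure_approachable by blast
    then show ?thesis by (intro exI[of _ c]) (simp add: dist_norm norm_minus_commute)
  qed
  then obtain \<gamma> where \<gamma>: "\<And>k. norm (t k - smul (\<gamma> k) ?e) < \<epsilon> / 2" by metis
  show "\<exists>F a. finite F \<and> F \<subseteq> {K..} \<and> coeff_sum ?q F a = 1 \<and> norm (comb F a t) < \<epsilon>"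
  proof (cases "\<gamma> K = 0")
    case True
    have "norm (comb {K} (\<lambda>_. 1) t) < \<epsilon>" using \<gamma>[of K] True \<epsilon> by (simp add: comb_def)
    then show ?thesis by (intro exI[of _ "{K}"] exI[of _ "\<lambda>_. 1"]) (simp add: coeff_sum_def)
  next
    case False
    let ?F = "{K, Suc K}"
    define b where "b k = (if k = K then \<gamma> (Suc K) else - \<gamma> K)" for k
    define s where "s = coeff_sum ?q ?F b"
    have "0 < norm (\<gamma> K) powr ?q" using False by simp
    then have s: "0 < s" by (simp add: s_def coeff_sum_def b_def add_nonneg_pos)
    define a where "a k = of_real (s powr (- 1 / ?q)) * b k" for k
    have a: "coeff_sum ?q ?F a = 1"
      unfolding a_def coeff_sum_scale s_def[symmetric] by (rule normalize_powr[OF s q_pos])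
    have "comb ?F b (\<lambda>k. smul (\<gamma> k) ?e) = 0"
      by (simp add: comb_def b_def mult.commute flip: scale_left_distrib)
    then have "comb ?F a (\<lambda>k. smul (\<gamma> k) ?e) = 0" unfolding a_def comb_scale by simp
    moreover have "comb ?F a (\<lambda>k. t k - smul (\<gamma> k) ?e) = comb ?F a t - comb ?F a (\<lambda>k. smul (\<gamma> k) ?e)"
      unfolding comb_def scale_right_diff_distrib by (rule sum_subtractf)
    ultimately have "comb ?F a t = comb ?F a (\<lambda>k. t k - smul (\<gamma> k) ?e)" by simp
    also have "norm \<dots> \<le> norm (a K) * norm (t K - smul (\<gamma> K) ?e)
        + norm (a (Suc K)) * norm (t (Suc K) - smul (\<gamma> (Suc K)) ?e)"
      unfolding comb_def by (simp add: norm_triangle_le norm_smul)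
    also have "\<dots> \<le> 1 * norm (t K - smul (\<gamma> K) ?e) + 1 * norm (t (Suc K) - smul (\<gamma> (Suc K)) ?e)"
      using coeff_le_1[OF _ a q_pos] by (intro add_mono mult_right_mono) auto
    also have "\<dots> < \<epsilon>" using \<gamma>[of K] \<gamma>[of "Suc K"] by simp
    finally show ?thesis using a by (intro exI[of _ ?F] exI[of _ a]) auto
  qed
qed

text \<open>The number n of possible entries depends on f but not on y, so the identity is one
  finite sum of projections onto single entries.\<close>

lemma op_small_line:
  assumes "\<And>g. op_small (p d) (slab W g {}) (\<lambda>y. y)"
  shows "op_small (p d) (slab W f {d}) (\<lambda>y. y)"
proof -
  obtain n where n: "\<forall>y\<in>W. proj (slot f {d} UNIV) y = y \<longrightarrow> proj (along {d} {..<n}) y = y"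
    using finite_line by blast
  have "op_small (p d) (slab W f {d}) (\<lambda>y. \<Sum>m<n. proj (along {d} {m}) y)"
  proof (rule op_small_sum[OF subspace_X slab_subspace slab_X q_pos proj_op])
    fix m
    have "proj (along {d} {m}) y \<in> slab W (f(d := m)) {}" if y: "y \<in> slab W f {d}" for y
    proof -
      have "y \<in> X" using y slab_X by blast
      then have "proj (along {} UNIV) y = y" by (rule proj_UNIV) (simp add: along_def)
      then show ?thesis using slab_step[OF y, of d m "{}" UNIV] by simp
    qed
    then show "op_small (p d) (slab W f {d}) (proj (along {d} {m}))"
      by (rule op_small_into[OF subspace_X slab_X proj_op _ assms])
  qed
  moreover have "(\<Sum>m<n. proj (along {d} {m}) y) = y" if "y \<in> slab W f {d}" for y
    using n that proj_split_sum[OF _ d, of y n] W_X by (auto simp: slab_def)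
  ultimately show ?thesis by (rule op_small_cong[rotated])
qed

text \<open>A gliding hump: if \<open>t\<close> has no small blocks, then some normalised blocks of \<open>t\<close> are arbitrarily
  close to block diagonal vectors \<open>z k\<close>, so \<open>L\<close> of them have a sum of norm about \<open>L powr \<kappa> A\<close>,
  whereas their position in \<open>t\<close> makes it about \<open>L powr (1 / p d)\<close>.\<close>

lemma op_small_hump:
  assumes A: "A \<subseteq> I" "A \<noteq> {}" "A \<noteq> {d}"
    and IH: "\<And>a g. a \<in> A \<Longrightarrow> op_small (p d) (slab W g (A - {a})) (\<lambda>y. y)"
  shows "op_small (p d) (slab W f A) (\<lambda>y. y)"
  unfolding op_small_def
proof (intro allI impI, rule ccontr)
  let ?q = "p d"
  fix c t
  assume t: "\<forall>k. t k \<in> slab W f A" "upper_bounded ?q c t" and "\<not> small_blocks ?q t"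
  then obtain \<epsilon> K0 where \<epsilon>: "0 < \<epsilon>"
    and big: "\<And>F a. finite F \<Longrightarrow> F \<subseteq> {K0..} \<Longrightarrow> coeff_sum ?q F a = 1 \<Longrightarrow> \<epsilon> \<le> norm (comb F a t)"
    unfolding small_blocks_def by (metis not_le)
  have V_X: "comb F a t \<in> X" "comb F a t \<in> slab W f A" for F a
    using comb_in[OF slab_subspace, of F t f A] t(1) slab_X by blast+
  have upper: "norm (comb F a t) \<le> c * coeff_sum ?q F a powr (1 / ?q)" if "finite F" for F a
    using t(2) that unfolding upper_bounded_def by blast
  \<comment> \<open>The lower bound for normalised blocks, made homogeneous by rescaling the
    coefficients.\<close>
  have big': "\<epsilon> * coeff_sum ?q F a powr (1 / ?q) \<le> norm (comb F a t)"
    if F: "finite F" "F \<subseteq> {K0..}" and pos: "0 < coeff_sum ?q F a" for F a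
  proof -
    let ?s = "coeff_sum ?q F a"
    let ?r = "?s powr (- 1 / ?q)"
    have "coeff_sum ?q F (\<lambda>k. of_real ?r * a k) = 1"
      unfolding coeff_sum_scale by (rule normalize_powr[OF pos q_pos])
    from big[OF F this] have "\<epsilon> \<le> ?r * norm (comb F a t)" by (simp add: comb_scale)
    then have "\<epsilon> * ?s powr (1 / ?q) \<le> ?r * norm (comb F a t) * ?s powr (1 / ?q)"
      by (intro mult_right_mono) auto
    also have "\<dots> = norm (comb F a t)" using pos by (simp add: powr_minus_divide)
    finally show ?thesis .
  qed
  have cpos: "\<epsilon> \<le> c"
  proof -
    have "coeff_sum ?q {K0} (\<lambda>_. 1 :: 'k) = 1" by (simp add: coeff_sum_def)
    then show ?thesis using big[of "{K0}" "\<lambda>_. 1"] upper[of "{K0}" "\<lambda>_. 1"] by simp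
  qed
  have main: "\<epsilon> * real L powr (1 / ?q) \<le> c * real L powr \<kappa> A + \<epsilon> / 2 \<and>
      \<epsilon> / 2 * real L powr \<kappa> A \<le> c * real L powr (1 / ?q) + \<epsilon> / 2" if L: "1 \<le> L" for L :: nat
  proof -
    \<comment> \<open>Each block will be off by at most 2 \<eta>. This is at most \<epsilon> / 2 for
      a single block, and L blocks together are off by at most \<epsilon> / 2.\<close>
    define \<eta> where "\<eta> = \<epsilon> / (4 * real L)"
    have \<eta>: "0 < \<eta>" using \<epsilon> L by (simp add: \<eta>_def)
    \<comment> \<open>A block that lies, up to \<eta>, at or beyond level M and also below M' in all
      coordinates of A; K' bounds the indices of t that it uses.\<close>
    define R where "R M K' M' = (\<lambda>(F, a). finite F \<and> F \<subseteq> {K0..} \<and> coeff_sum ?q F a = 1 \<and>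
        (\<forall>k\<in>F. k < K') \<and> M < M' \<and>
        norm (comb F a t - proj (along A {M..}) (comb F a t)) < \<eta> \<and>
        norm (comb F a t - proj (along A {..<M'}) (comb F a t)) < \<eta>)"
      for M K' M' :: nat
    have step: "\<exists>K' M' x. R M K' M' x \<and> (\<forall>k\<in>fst x. K \<le> k) \<and> K \<le> K'" for K M
    proof -
      have "small_blocks ?q (\<lambda>k. t k - proj (along A {M..}) (t k))"
        using op_small_slab[OF IH A(1), of f M] t unfolding op_small_def by blast
      then obtain F a where F: "finite F" "F \<subseteq> {max K0 K..}" "coeff_sum ?q F a = 1"
        "norm (comb F a (\<lambda>k. t k - proj (along A {M..}) (t k))) < \<eta>"
        by (rule small_blocksD[OF _ \<eta>])
      have tX: "t k \<in> X" for k using t(1) slab_X by blast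
      have "comb F a (\<lambda>k. t k - proj (along A {M..}) (t k)) = comb F a t - proj (along A {M..}) (comb F a t)"
        by (rule comb_op[OF subspace_X bounded_op_minus_op[OF subspace_X bounded_op_id proj_op] tX])
      moreover obtain M1 where M1: "\<And>m. m \<ge> M1 \<Longrightarrow> norm (proj (along A {..<m}) (comb F a t) - comb F a t) < \<eta>"
        using LIMSEQ_D[OF proj_along_tendsto[OF A(1) V_X(1)] \<eta>] by blast
      moreover have "\<forall>k\<in>F. k < max K (Suc (Max (insert 0 F)))"
        using F(1) by (auto simp: less_Suc_eq_le less_max_iff_disj)
      ultimately show ?thesis
        using F M1[of "max M1 (Suc M)"]
        by (intro exI[of _ "max K (Suc (Max (insert 0 F)))"] exI[of _ "max M1 (Suc M)"] exI[of _ "(F, a)"])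
           (auto simp: R_def norm_minus_commute)
    qed
    have "\<exists>S. \<forall>n. True \<and> (case (S n, S (Suc n)) of ((K, M, x), (K', M', x')) \<Rightarrow>
        R M K' M' x' \<and> (\<forall>k\<in>fst x'. K \<le> k) \<and> K \<le> K')"
    proof (rule dependent_nat_choice)
      fix z :: "nat \<times> nat \<times> nat set \<times> (nat \<Rightarrow> 'k)" and n :: nat
      show "\<exists>z'. True \<and> (case (z, z') of ((K, M, x), (K', M', x')) \<Rightarrow>
          R M K' M' x' \<and> (\<forall>k\<in>fst x'. K \<le> k) \<and> K \<le> K')"
        using step[of "fst (snd z)" "fst z"] by (auto simp: case_prod_beta) 
    qed simp
    then obtain S where S: "\<And>n. case (S n, S (Suc n)) of ((K, M, x), (K', M', x')) \<Rightarrow>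
        R M K' M' x' \<and> (\<forall>k\<in>fst x'. K \<le> k) \<and> K \<le> K'" by auto
    \<comment> \<open>A state stores the block chosen on entering it. Hence block n is read off from
      \<open>S (Suc n)\<close>, and the block stored in \<open>S 0\<close> is arbitrary.\<close>
    define K M F a where "K n = fst (S n)" "M n = fst (snd (S n))"
      "F n = fst (snd (snd (S (Suc n))))" "a n = snd (snd (snd (S (Suc n))))" for n
    have SR: "R (M n) (K (Suc n)) (M (Suc n)) (F n, a n)" "\<And>k. k \<in> F n \<Longrightarrow> K n \<le> k" "K n \<le> K (Suc n)" for n
      using S[of n] by (auto simp: K_M_F_a_def case_prod_beta)
    have F: "finite (F n)" "F n \<subseteq> {K0..}" "coeff_sum ?q (F n) (a n) = 1" "\<And>k. k \<in> F n \<Longrightarrow> k < K (Suc n)"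
      "M n < M (Suc n)" for n
      using SR(1)[of n] by (auto simp: R_def)
    have Kmono: "K m \<le> K n" if "m \<le> n" for m n by (rule lift_Suc_mono_le[where f = K, OF SR(3) that])
    have Mmono: "M m \<le> M n" if "m \<le> n" for m n
      by (rule lift_Suc_mono_le[where f = M, OF less_imp_le[OF F(5)] that])
    have "F m \<inter> F n = {}" if "m < n" for m n
      using F(4)[of _ m] SR(2)[of _ n] Kmono[of "Suc m" n] that by fastforce
    then have disF: "disjoint_family_on F {..<L}"
      unfolding disjoint_family_on_def by (metis Int_commute linorder_neqE_nat)
    define B where "B n = {M n..<M (Suc n)}" for n
    have "B m \<inter> B n = {}" if "m < n" for m n
      using Mmono[of "Suc m" n] that by (auto simp: B_def)
    then have disB: "disjoint_family_on B {..<L}"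
      unfolding disjoint_family_on_def by (metis Int_commute linorder_neqE_nat)
    define y where "y n = comb (F n) (a n) t" for n
    define z where "z n = proj (slot f A (B n)) (y n)" for n
    have yX: "y n \<in> X" for n by (simp add: y_def V_X)
    have zX: "z n \<in> X" for n by (simp add: z_def proj_in yX)
    have zz: "proj (slot f A (B n)) (z n) = z n" for n
      unfolding z_def proj_proj[OF yX] by (rule proj_cong[OF _ yX]) auto
    \<comment> \<open>One \<eta> pays for cutting off below \<open>M n\<close>, the other for
      cutting off from \<open>M (Suc n)\<close> on. Freezing the other coordinates is free because
      \<open>y n\<close> lies in the slab.\<close>
    have zy: "norm (z n - y n) \<le> 2 * \<eta>" for n
    proof -
      let ?P = "proj (along A {M n..})" and ?Q = "proj (along A {..<M (Suc n)})"
      have "y n = proj (slot f A UNIV) (y n)" using V_X(2) by (simp add: y_def slab_def)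
      then have "z n = proj (slot f A (B n)) (proj (slot f A UNIV) (y n))" by (simp add: z_def)
      also have "\<dots> = ?P (?Q (proj (slot f A UNIV) (y n)))"
        unfolding proj_proj[OF yX] proj_proj[OF proj_in[OF yX]]
        by (rule proj_cong[OF _ yX]) (auto simp: along_def slot_def B_def)
      also have "\<dots> = ?P (?Q (y n))" using \<open>y n = proj (slot f A UNIV) (y n)\<close> by simp
      finally have "norm (z n - y n) = norm (?P (?Q (y n) - y n) + (?P (y n) - y n))"
        by (simp add: bounded_op_diff[OF subspace_X proj_op] proj_in yX)
      moreover have "norm (?P (?Q (y n) - y n)) \<le> norm (?Q (y n) - y n)"
        by (intro proj_norm_le subspace_diff[OF subspace_X] proj_in yX)
      moreover have "norm (?Q (y n) - y n) < \<eta>" "norm (?P (y n) - y n) < \<eta>"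
        using SR(1)[of n] by (auto simp: R_def y_def norm_minus_commute)
      ultimately show ?thesis
        using norm_triangle_ineq[of "?P (?Q (y n) - y n)" "?P (y n) - y n"] by linarith
    qed
    have zupper: "norm (z n) \<le> c" for n
      using proj_norm_le[OF yX, of "slot f A (B n)" n] upper[OF F(1), of n "a n"] F(3)[of n]
      by (simp add: z_def y_def)
    have "2 * \<eta> \<le> \<epsilon> / 2" using L \<epsilon> by (simp add: \<eta>_def field_simps)
    then have zlower: "\<epsilon> / 2 \<le> norm (z n)" for n
      using big[OF F(1,2,3), of n] zy[of n] norm_triangle_ineq2[of "y n" "y n - z n"]
      by (simp add: y_def norm_minus_commute)
    have sum_close: "norm ((\<Sum>n<L. z n) - (\<Sum>n<L. y n)) \<le> \<epsilon> / 2"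
    proof -
      have "norm ((\<Sum>n<L. z n) - (\<Sum>n<L. y n)) \<le> (\<Sum>n<L. norm (z n - y n))"
        unfolding sum_subtractf[symmetric] by (rule norm_sum)
      also have "\<dots> \<le> (\<Sum>n<L. 2 * \<eta>)" by (intro sum_mono zy)
      also have "\<dots> = \<epsilon> / 2" using L by (simp add: \<eta>_def)
      finally show ?thesis .
    qed
    \<comment> \<open>With outer coefficients 1, the L normalised blocks form one combination of t
      with coefficient sum L.\<close>
    obtain b where b: "\<And>t. comb {..<L} (\<lambda>_. 1) (\<lambda>k. comb (F k) (a k) t) = comb (\<Union>k\<in>{..<L}. F k) b t"
      "\<And>q. coeff_sum q (\<Union>k\<in>{..<L}. F k) b = (\<Sum>k\<in>{..<L}. norm (1::'k) powr q * coeff_sum q (F k) (a k))"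
      by (rule comb_comb[where a = a and a' = "\<lambda>_. 1", OF finite_lessThan F(1) disF]) blast
    have sb: "coeff_sum ?q (\<Union>k\<in>{..<L}. F k) b = real L" using b(2)[of ?q] by (simp add: F(3))
    have yb: "(\<Sum>n<L. y n) = comb (\<Union>k\<in>{..<L}. F k) b t" using b(1)[of t] by (simp add: comb_def y_def)
    have finU: "finite (\<Union>k\<in>{..<L}. F k)" "(\<Union>k\<in>{..<L}. F k) \<subseteq> {K0..}" using F(1,2) by blast+
    have "\<epsilon> * real L powr (1 / ?q) \<le> norm (\<Sum>n<L. y n)"
      using big'[OF finU, of b] L unfolding yb sb by simp
    moreover have "norm (\<Sum>n<L. y n) \<le> c * real L powr (1 / ?q)"
      using upper[OF finU(1), of b] unfolding yb sb .
    moreover have "norm (\<Sum>n<L. z n) \<le> c * real L powr \<kappa> A"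
      by (rule upper_estimate[OF A(1,2) disB zX zz zupper]) (use cpos \<epsilon> in simp)
    moreover have "\<epsilon> / 2 * real L powr \<kappa> A \<le> norm (\<Sum>n<L. z n)"
      by (rule lower_estimate[OF A(1,2) disB zX zz zlower]) (use \<epsilon> in simp)
    ultimately show ?thesis
      using sum_close norm_triangle_ineq2[of "\<Sum>n<L. y n" "\<Sum>n<L. z n"]
        norm_triangle_ineq2[of "\<Sum>n<L. z n" "\<Sum>n<L. y n"] norm_minus_commute[of "\<Sum>n<L. z n" "\<Sum>n<L. y n"]
      by linarith
  qed
  have \<kappa>: "0 < \<kappa> A" by (rule \<kappa>_pos[OF A(1,2)])
  \<comment> \<open>For large L the larger power wins; the additive error is absorbed by passing
    from c to c + \<epsilon>. Which half of \<open>main\<close> is contradicted depends on which of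
    the two exponents is larger.\<close>
  have compare: False
    if \<alpha>\<beta>: "0 < \<beta>" "\<beta> < \<alpha>" and u: "0 < u" and le: "\<And>L::nat. 1 \<le> L \<Longrightarrow> u * real L powr \<alpha> \<le> c * real L powr \<beta> + \<epsilon> / 2"
    for \<alpha> \<beta> u
  proof -
    obtain L :: nat where L: "1 \<le> L" "(c + \<epsilon>) / u < real L powr (\<alpha> - \<beta>)"
      using ex_nat_powr_gt[of "\<alpha> - \<beta>"] \<alpha>\<beta> by auto
    have "1 \<le> real L powr \<beta>" using L(1) \<alpha>\<beta> by (simp add: ge_one_powr_ge_zero)
    then have "\<epsilon> / 2 \<le> \<epsilon> * real L powr \<beta>" using \<epsilon> mult_left_mono[of 1 "real L powr \<beta>" \<epsilon>] by simp
    then have "u * real L powr \<alpha> \<le> (c + \<epsilon>) * real L powr \<beta>" using le[OF L(1)] by (simp add: algebra_simps)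
    also have "\<dots> < (u * real L powr (\<alpha> - \<beta>)) * real L powr \<beta>"
      using L u \<open>1 \<le> real L powr \<beta>\<close> by (intro mult_strict_right_mono) (auto simp: field_simps)
    also have "\<dots> = u * real L powr \<alpha>" by (simp flip: powr_add)
    finally show False by simp
  qed
  consider "\<kappa> A < 1 / ?q" | "1 / ?q < \<kappa> A" using \<kappa>_neq[OF A] by linarith
  then show False
  proof cases
    case 1
    then show ?thesis using compare[OF \<kappa> 1 \<epsilon>] main by blast
  next
    case 2
    then show ?thesis using compare[OF _ 2, of "\<epsilon> / 2"] main \<epsilon> q_pos by simp
  qed
qed

text \<open>Induction on the number of free coordinates, with f arbitrary because freezing a
  coordinate changes it. The set \<open>{d}\<close> is singled out since its \<kappa> equals
  \<open>1 / p d\<close> and the growth comparison fails there.\<close>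

lemma op_small_all: "A \<subseteq> I \<Longrightarrow> op_small (p d) (slab W f A) (\<lambda>y. y)"
proof (induction "card A" arbitrary: A f rule: less_induct)
  case less
  have "finite A" using less.prems finite_I by (rule finite_subset)
  then have IH: "op_small (p d) (slab W g (A - {a})) (\<lambda>y. y)" if "a \<in> A" for a g
    using that less.prems by (intro less.hyps card_Diff1_less) auto
  consider "A = {}" | "A = {d}" | "A \<noteq> {}" "A \<noteq> {d}" by blast
  then show ?case
  proof cases
    case 1
    then show ?thesis using op_small_point by simp
  next
    case 2
    then show ?thesis using op_small_line[OF op_small_point] by simp
  next
    case 3
    then show ?thesis using op_small_hump[OF less.prems 3 IH] by simp
  qed
qed

text \<open>An isomorphism would carry the line in direction d to a sequence in W with an upper
  estimate of exponent \<open>p d\<close> and, by boundedness of the inverse, without small blocks.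
  This contradicts \<open>op_small_all\<close> for \<open>A = I\<close>.\<close>

lemma not_homeomorphic: "\<not> linearly_homeomorphic smul X W"
proof
  assume "linearly_homeomorphic smul X W"
  then obtain T S where T: "linear_on smul X T" and h: "homeomorphism X W T S"
    unfolding linearly_homeomorphic_def by blast
  have TW: "T x \<in> W" "S (T x) = x" if "x \<in> X" for x using h that by (auto simp: homeomorphism_def)
  have ST: "S y \<in> X" "T (S y) = y" if "y \<in> W" for y using h that by (auto simp: homeomorphism_def)
  have "linear_on smul W S"
    unfolding linear_on_def
  proof (intro conjI ballI allI)
    fix x y assume "x \<in> W" "y \<in> W"
    then have "T (S x + S y) = x + y" using T ST by (simp add: linear_on_def)
    then show "S (x + y) = S x + S y"
      using TW(2)[OF subspace_add[OF subspace_X ST(1) ST(1)], of x y] \<open>x \<in> W\<close> \<open>y \<in> W\<close> by simp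
  next
    fix c y assume "y \<in> W"
    then have "T (smul c (S y)) = smul c y" using T ST by (simp add: linear_on_def)
    then show "S (smul c y) = smul c (S y)"
      using TW(2)[OF subspace_scale[OF subspace_X ST(1)], of y c] \<open>y \<in> W\<close> by simp
  qed
  then obtain s where s: "0 < s" "\<And>y. y \<in> W \<Longrightarrow> norm (S y) \<le> s * norm y"
    using continuous_linear_bounded[OF W_subspace] h unfolding homeomorphism_def by metis
  obtain r where r: "0 < r" "\<And>x. x \<in> X \<Longrightarrow> norm (T x) \<le> r * norm x"
    using continuous_linear_bounded[OF subspace_X T] h unfolding homeomorphism_def by metis
  have T_op: "bounded_op X T"
    using T TW W_X r unfolding bounded_op_def by blast
  define t where "t k = T (line d k)" for k
  have comb_t: "comb F a t = T (comb F a (line d))" for F a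
    unfolding t_def by (rule comb_op[OF subspace_X T_op line_in[OF d]])
  have line_X: "comb F a (line d) \<in> X" for F a by (intro comb_in subspace_X line_in d)
  have "upper_bounded (p d) r t"
    unfolding upper_bounded_def
  proof (intro allI impI)
    fix F :: "nat set" and a :: "nat \<Rightarrow> 'k" assume F: "finite F"
    have "norm (comb F a t) \<le> r * norm (comb F a (line d))" unfolding comb_t by (rule r(2)[OF line_X])
    also have "\<dots> \<le> r * coeff_sum (p d) F a powr (1 / p d)"
      using r(1) by (intro mult_left_mono norm_comb_line_le[OF d F]) auto
    finally show "norm (comb F a t) \<le> r * coeff_sum (p d) F a powr (1 / p d)" .
  qed
  moreover have "t k \<in> slab W (\<lambda>_. 0) I" for k
  proof -
    have "t k \<in> W" unfolding t_def by (rule TW(1)[OF line_in[OF d]])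
    moreover have "proj (slot (\<lambda>_. 0) I UNIV) (t k) = t k"
      using \<open>t k \<in> W\<close> W_X by (intro proj_UNIV) (auto simp: slot_def)
    ultimately show ?thesis by (simp add: slab_def)
  qed
  ultimately have "small_blocks (p d) t"
    using op_small_all[OF order_refl, of "\<lambda>_. 0"] unfolding op_small_def by blast
  then obtain F a where F: "finite F" "coeff_sum (p d) F a = 1" "norm (comb F a t) < 1 / s"
    using small_blocksD[of "p d" t "1 / s" 0] s(1) by auto
  have "1 \<le> norm (comb F a (line d))" using norm_comb_line_ge[OF d F(1), of a] F(2) by simp
  also have "\<dots> = norm (S (comb F a t))" unfolding comb_t TW(2)[OF line_X] ..
  also have "\<dots> \<le> s * norm (comb F a t)" by (rule s(2)) (simp add: comb_t TW(1)[OF line_X])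
  also have "\<dots> < s * (1 / s)" using F(3) s(1) by (intro mult_strict_left_mono)
  also have "\<dots> = 1" using s(1) by simp
  finally show False by simp
qed

end

section \<open>The direct sum decomposition\<close>

context triangular
begin

lemma topological_direct_sum_upper:
  "topological_direct_sum smul X (upper ` X) {y \<in> X. upper y = 0}"
proof -
  let ?Y = "upper ` X" and ?Z = "{y \<in> X. upper y = 0}"
  \<comment> \<open>As the kernel of a bounded operator, the range is a closed subspace, just like
    the complement.\<close>
  have Y_eq: "?Y = {y \<in> X. upper y - y = 0}" using upper_idem upper_in by (auto simp: image_iff) metis
  have op: "bounded_op X (\<lambda>y. upper y - y)"
    by (intro bounded_op_minus_op subspace_X upper_op bounded_op_id)
  have kernel: "closed_subspace smul {y \<in> X. G y = 0}" if G: "bounded_op X G" for G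
    unfolding closed_subspace_def
  proof
    show "module.subspace smul {y \<in> X. G y = 0}"
      using bounded_op_add[OF G] bounded_op_smul[OF G] bounded_op_0[OF G subspace_0[OF subspace_X]]
      by (intro subspaceI)
         (auto simp: subspace_0[OF subspace_X] subspace_add[OF subspace_X] subspace_scale[OF subspace_X])
    show "closed {y \<in> X. G y = 0}" using closed_preimage_op[OF G, of "{0}"] by simp
  qed
  have "homeomorphism (?Y \<times> ?Z) X (\<lambda>(y, z). y + z) (\<lambda>x. (upper x, x - upper x))"
    unfolding homeomorphism_def
  proof (intro conjI ballI)
    have u: "upper (y + z) = y" if "y \<in> ?Y" "z \<in> ?Z" for y z
      using that Y_eq by (auto simp: bounded_op_add[OF upper_op])
    show "(\<lambda>x. (upper x, x - upper x)) (case v of (y, z) \<Rightarrow> y + z) = v" if "v \<in> ?Y \<times> ?Z" for v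
      using that u by auto
    have in_Z: "x - upper x \<in> ?Z" if "x \<in> X" for x
      using that by (simp add: bounded_op_diff[OF subspace_X upper_op] upper_in upper_idem subspace_diff[OF subspace_X])
    show "(\<lambda>(y, z). y + z) ` (?Y \<times> ?Z) = X"
    proof
      show "(\<lambda>(y, z). y + z) ` (?Y \<times> ?Z) \<subseteq> X" using upper_in by (auto intro: subspace_add[OF subspace_X])
      show "X \<subseteq> (\<lambda>(y, z). y + z) ` (?Y \<times> ?Z)"
      proof
        fix x assume "x \<in> X"
        then show "x \<in> (\<lambda>(y, z). y + z) ` (?Y \<times> ?Z)"
          using in_Z by (intro image_eqI[of _ _ "(upper x, x - upper x)"]) auto
      qed
    qed
    show "continuous_on (?Y \<times> ?Z) (\<lambda>(y, z). y + z)"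
      unfolding case_prod_beta by (intro continuous_intros)
    show "(case (upper x, x - upper x) of (y, z) \<Rightarrow> y + z) = x" for x by simp
    show "(\<lambda>x. (upper x, x - upper x)) ` X = ?Y \<times> ?Z"
    proof
      show "(\<lambda>x. (upper x, x - upper x)) ` X \<subseteq> ?Y \<times> ?Z" using in_Z by auto
      show "?Y \<times> ?Z \<subseteq> (\<lambda>x. (upper x, x - upper x)) ` X"
      proof
        fix v assume v: "v \<in> ?Y \<times> ?Z"
        then obtain y z where yz: "v = (y, z)" "y \<in> ?Y" "z \<in> ?Z" by auto
        have "y + z \<in> X" using yz upper_in by (auto intro: subspace_add[OF subspace_X])
        then show "v \<in> (\<lambda>x. (upper x, x - upper x)) ` X"
          using u[OF yz(2,3)] yz(1) by (intro image_eqI[of _ _ "y + z"]) auto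
      qed
    qed
    show "continuous_on X (\<lambda>x. (upper x, x - upper x))"
      by (intro continuous_intros bounded_op_continuous[OF subspace_X upper_op])
  qed
  then show ?thesis
    unfolding topological_direct_sum_def using kernel[OF upper_op] kernel[OF op] Y_eq by auto
qed

lemma proj_slot_single:
  assumes y: "y \<in> X" "proj (slot f {a} UNIV) y = y" and b: "b \<in> I" "b \<noteq> a"
  shows "proj (along {b} {f b}) y = y"
proof -
  have "proj (along {b} {f b}) (proj (slot f {a} UNIV) y) = proj (slot f {a} UNIV) y"
    unfolding proj_proj[OF y(1)] by (rule proj_cong[OF _ y(1)]) (use b in \<open>auto simp: along_def slot_def\<close>)
  then show ?thesis using y by simp
qed

lemma not_primary:
  assumes i_neq: "\<And>A. A \<subseteq> I \<Longrightarrow> A \<noteq> {} \<Longrightarrow> A \<noteq> {i} \<Longrightarrow> \<kappa> A \<noteq> 1 / p i"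
    and j_neq: "\<And>A. A \<subseteq> I \<Longrightarrow> A \<noteq> {} \<Longrightarrow> A \<noteq> {j} \<Longrightarrow> \<kappa> A \<noteq> 1 / p j"
  shows "\<not> primary smul X"
proof -
  have sub: "subspace (upper ` X)" "subspace {y \<in> X. upper y = 0}"
    using topological_direct_sum_upper unfolding topological_direct_sum_def closed_subspace_def by auto
  have Y: "upper y = y" "y \<in> X" if "y \<in> upper ` X" for y using that upper_idem upper_in by auto
  have "no_line smul I p X J (upper ` X) i"
  proof
    show "subspace (upper ` X)" by (rule sub)
    show "upper ` X \<subseteq> X" using upper_in by blast
    show "proj S y \<in> upper ` X" if "y \<in> upper ` X" for S y
      using that Y[OF that] upper_proj_commute[of y S] proj_in[of y S] by (metis imageI)
    show "i \<in> I" by (rule i)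
    show "\<exists>n. \<forall>y\<in>upper ` X. proj (slot f {i} UNIV) y = y \<longrightarrow> proj (along {i} {..<n}) y = y" for f
    proof (intro exI ballI impI)
      fix y assume y: "y \<in> upper ` X" "proj (slot f {i} UNIV) y = y"
      have "proj (along {j} {f j}) y = y"
        by (rule proj_slot_single[OF Y(2)[OF y(1)] y(2) j]) (use ij in simp)
      then have "y = proj (along {i} {..f j}) y"
        using upper_column[OF Y(2)[OF y(1)], of "f j"] Y(1)[OF y(1)] by simp
      \<comment> \<open>The diagonal belongs to the range, so column \<open>f j\<close> has entries
        in the rows up to and including \<open>f j\<close>.\<close>
      then show "proj (along {i} {..<Suc (f j)}) y = y" by (simp add: lessThan_Suc_atMost)
    qed
  qed (rule i_neq)
  then have 1: "\<not> linearly_homeomorphic smul X (upper ` X)" by (rule no_line.not_homeomorphic)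
  have "no_line smul I p X J {y \<in> X. upper y = 0} j"
  proof
    show "subspace {y \<in> X. upper y = 0}" by (rule sub)
    show "{y \<in> X. upper y = 0} \<subseteq> X" by blast
    show "proj S y \<in> {y \<in> X. upper y = 0}" if "y \<in> {y \<in> X. upper y = 0}" for S y
      using that bounded_op_0[OF proj_op] by (auto simp: upper_proj_commute proj_in)
    show "j \<in> I" by (rule j)
    show "\<exists>n. \<forall>y\<in>{y \<in> X. upper y = 0}. proj (slot f {j} UNIV) y = y \<longrightarrow> proj (along {j} {..<n}) y = y" for f
    proof (intro exI ballI impI)
      fix y assume y: "y \<in> {y \<in> X. upper y = 0}" "proj (slot f {j} UNIV) y = y"
      then have yX: "y \<in> X" and u: "upper y = 0" by auto
      have "proj (along {i} {f i}) y = y"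
        by (rule proj_slot_single[OF yX y(2) i ij])
      \<comment> \<open>In the kernel the diagonal entry vanishes too, so row \<open>f i\<close>
        lives strictly before column \<open>f i\<close>.\<close>
      then have "proj (along {j} {f i..}) y = 0" using upper_row[OF yX, of "f i"] u by simp
      moreover have "- {..<f i} = {f i..}" by auto
      ultimately show "proj (along {j} {..<f i}) y = y"
        using proj_along_split[OF yX j, of "{..<f i}"] by simp
    qed
  qed (rule j_neq)
  then have 2: "\<not> linearly_homeomorphic smul X {y \<in> X. upper y = 0}" by (rule no_line.not_homeomorphic)
  show ?thesis
    unfolding primary_def using topological_direct_sum_upper 1 2 by blast
qed

end

theorem theorem4p2:
  fixes N i j :: nat
    and p :: "nat \<Rightarrow> real"
    and smul :: "'k::{real_normed_field, euclidean_space} \<Rightarrow> 'x::banach \<Rightarrow> 'x"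
    and X :: "'x set"
  assumes "N \<ge> 2"
    and "\<And>k. k \<in> {1..N} \<Longrightarrow> 1 < p k"
    and "normed_space_over smul"
    and "completed_projective_tensor_product smul {1..N}
           (\<lambda>k. lp_space (p k)) (\<lambda>k. lp_norm (p k)) X"
    and "i \<in> {1..N}" and "j \<in> {1..N}" and "i \<noteq> j"
    and "1 / p i + 1 / p j > 1"
    and "\<And>k. k \<in> {i, j} \<Longrightarrow>
           p k \<notin> {r_exponent p A | A. A \<noteq> {} \<and> A \<subseteq> {1..N} \<and> k \<notin> A}"
  shows "\<not> primary smul X"
proof -
  let ?E = "\<lambda>k. lp_space (p k) :: (nat \<Rightarrow> 'k) set"
  let ?alg = "algebraic_tensor_product {1..N} ?E"
  obtain J where J:
    "\<forall>s \<in> ?alg. \<forall>t \<in> ?alg. J (\<lambda>\<phi>. s \<phi> + t \<phi>) = J s + J t"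
    "\<forall>c. \<forall>t \<in> ?alg. J (\<lambda>\<phi>. c * t \<phi>) = smul c (J t)"
    "\<forall>t \<in> ?alg. norm (J t) = projective_norm {1..N} ?E (\<lambda>k. lp_norm (p k)) t"
    "closure (J ` ?alg) = X"
    using assms(4) unfolding completed_projective_tensor_product_def by (elim exE conjE)
  have "lp_tensor smul {1..N} p X J"
  proof (intro lp_tensor.intro lp_tensor_axioms.intro)
    show "{1..N} \<noteq> {}" using assms(1) by simp
    show "J (\<lambda>\<phi>. s \<phi> + t \<phi>) = J s + J t" if "s \<in> ?alg" "t \<in> ?alg" for s t
      using J(1) that by blast
    show "J (\<lambda>\<phi>. c * t \<phi>) = smul c (J t)" if "t \<in> ?alg" for c t
      using J(2) that by blast
    show "norm (J t) = projective_norm {1..N} ?E (\<lambda>k. lp_norm (p k)) t" if "t \<in> ?alg" for t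
      using J(3) that by blast
  qed (fact finite_atLeastAtMost assms(2,3) J(4))+
  then interpret lp_tensor smul "{1..N}" p X J .
  \<comment> \<open>The assumption deals with the sets that do not contain k. If A contains k and
    another index, then both 1 and the sum over A exceed \<open>1 / p k\<close>, and so does their
    minimum.\<close>
  have neq: "\<kappa> A \<noteq> 1 / p k" if k: "k \<in> {i, j}" and A: "A \<subseteq> {1..N}" "A \<noteq> {}" "A \<noteq> {k}" for k A
  proof (cases "k \<in> A")
    case True
    have kI: "k \<in> {1..N}" using k assms(5,6) by auto
    obtain l where l: "l \<in> A" "l \<noteq> k" using True A(3) by blast
    have fin: "finite A" using A(1) by (rule finite_subset) simp
    have "1 / p k < (\<Sum>l\<in>{k, l}. 1 / p l)" using l A(1) p_pos[of l] by auto
    also have "\<dots> \<le> (\<Sum>l\<in>A. 1 / p l)"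
    proof (rule sum_mono2[OF fin])
      show "0 \<le> 1 / p b" if "b \<in> A - {k, l}" for b
        using that A(1) by (auto intro!: less_imp_le[OF p_pos])
    qed (use True l in auto)
    finally have "1 / p k < (\<Sum>l\<in>A. 1 / p l)" .
    moreover have "1 / p k < 1" using assms(2)[OF kI] by simp
    ultimately have "1 / p k < \<kappa> A" by (simp only: \<kappa>_def min_less_iff_conj simp_thms)
    then show ?thesis by simp
  next
    case False
    then have "p k \<noteq> r_exponent p A" using assms(9)[OF k] A by blast
    then show ?thesis by (auto simp: r_exponent_def \<kappa>_def)
  qed
  interpret triangular smul "{1..N}" p X J i j
    by unfold_locales (use assms(5-8) in auto)
  show ?thesis by (rule not_primary) (use neq in auto)
qed

end
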